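(* Let $\Bbbk$ be a field, let $G$ be a finite group whose order is invertible in $\Bbbk$ and which is split by $\Bbbk$, and let $\rho:G\to\mathrm{GL}(V)$ be a representation of $G$ on a finite dimensional vector space $V$. Let $r:V\to S(V)$ be a $G$-equivariant linear map, let $\bar r:S(V)\to S(V)$ be the unique derivation extending $r$, and let $\delta:S(V)\rtimes G\to S(V)\rtimes G$ be the derivation with $\delta(fg)=\bar r(f)g$ for all $f\in S(V)$ and $g\in G$. Let $\sigma:S(V)\to T(V)$ be a $G$-equivariant linear section of the natural surjection $\pi:T(V)\to S(V)$, let $D:T(V)\to S(V)\otimes V\otimes S(V)$ be the unique linear derivation with $D(v)=1\otimes v\otimes1$ for all $v\in V$, and for $v\in V$ write $D(\sigma(r(v)))=v_{(1)}\otimes v_{(2)}\otimes v_{(3)}$, with an implicit sum. Then there is a $\delta^e$-lifting $\delta_\bullet:K_\bullet\rtimes G\to K_\bullet\rtimes G$ of $\delta$ to the resolution $K_\bullet\rtimes G$ of $S(V)\rtimes G$ such that for all $p\ge0$ and $v_1,\dots,v_p\in V$ $$\delta_p(1\otimes v_1\wedge\cdots\wedge v_p\otimes1\rtimes1)=\sum_{i=1}^pv_{i(1)}\otimes v_1\wedge\cdots\wedge v_{i(2)}\wedge\cdots\wedge v_p\otimes v_{i(3)}\rtimes1,$$ where $v_{i(2)}$ stands in the $i$th place. Consequently, if $H\!H^\bullet(S(V)\rtimes G)$ is identified with the cohomology of the complex $\hom(\Lambda^\bullet(V),S(V)\rtimes G)^G$, then for each $p\ge0$ and each $p$-cocycle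 $\phi\in\hom(\Lambda^p(V),S(V)\rtimes G)^G$ the Gerstenhaber bracket $[\delta,\phi]$ is represented by the cocycle $\delta_p^\sharp\phi$ given by $$(\delta_p^\sharp\phi)(v_1\wedge\cdots\wedge v_p)=\delta(\phi(v_1\wedge\cdots\wedge v_p))-\sum_{i=1}^pv_{i(1)}\,\phi(v_1\wedge\cdots\wedge v_{i(2)}\wedge\cdots\wedge v_p)\,v_{i(3)}.$$
   Context: $\otimes$ and $\hom$ are over $\Bbbk$. $S(V)$, $T(V)$ and $\Lambda^\bullet(V)$ are the symmetric, tensor and exterior algebras of $V$, with the induced actions of $G$. If $G$ acts on an algebra $A$ by automorphisms, $A\rtimes G$ is $A\otimes\Bbbk G$ with product $(a\otimes g)(b\otimes h)=ag(b)\otimes gh$. The space $S(V)\otimes V\otimes S(V)$ is a $T(V)$-bimodule via $\pi$. For an algebra $B$, $B^e=B\otimes B^{\mathrm{op}}$, and for a derivation $\delta$ of $B$, $\delta^e=\delta\otimes1+1\otimes\delta$, a derivation of $B^e$. If $P_\bullet\to B$ is a projective bimodule resolution, a $\delta^e$-lifting of $\delta$ to $P_\bullet$ is a sequence of linear maps $\delta_i:P_i\to P_i$ commuting with the differentials, compatible with $\delta:B\to B$ via the augmentation, and with $\delta_i(apb)=\delta(a)pb+a\delta_i(p)b+ap\delta(b)$ for all $a,b\in B$, $p\in P_i$. $K_\bullet=S(V)\otimes\Lambda^\bullet V\otimes S(V)\to S(V)$ is the bimodule Koszul resolution, with differential $$d(1\otimes v_1\wedge\cdots\wedge v_p\otimes1)=\sum_{i=1}^p(-1)^{i+1}\bigl(v_i\otimes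 v_1\wedge\cdots\widehat{v_i}\cdots\wedge v_p\otimes1-1\otimes v_1\wedge\cdots\widehat{v_i}\cdots\wedge v_p\otimes v_i\bigr),$$ and its natural $G$-action. For an $S(V)$-bimodule $M$ with a compatible $G$-action, meaning $g(amb)=g(a)g(m)g(b)$, $M\rtimes G$ is the $(S(V)\rtimes G)$-bimodule $M\otimes\Bbbk G$ with $(a\otimes g)(m\otimes h)=ag(m)\otimes gh$ and $(m\otimes h)(a\otimes g)=mh(a)\otimes hg$. We write $m\rtimes g$ for $m\otimes g$. Then $K_\bullet\rtimes G$ is a projective resolution of $S(V)\rtimes G$ as a bimodule over itself. Restricting maps to the elements $1\otimes\omega\otimes1\rtimes1$ with $\omega\in\Lambda^pV$ identifies $\hom_{(S(V)\rtimes G)^e}(K_p\rtimes G,S(V)\rtimes G)$ with $\hom(\Lambda^p(V),S(V)\rtimes G)^G$, where $G$ acts by $(g\cdot\phi)(\omega)=g\,\phi(g^{-1}\omega)\,g^{-1}$. Hence the cohomology of $\hom(\Lambda^\bullet(V),S(V)\rtimes G)^G$ is canonically $H\!H^\bullet(S(V)\rtimes G)$. For an algebra $B$, the Gerstenhaber bracket of a derivation $\delta$ with an $n$-cochain $\phi:B^{\otimes n}\to B$ of the standard Hochschild complex is $[\delta,\phi](b_1\otimes\cdots\otimes b_n)=\delta(\phi(b_1\otimes\cdots\otimes b_n))-\sum_j\phi(b_1\otimes\cdots\otimes\delta(b_j)\otimes\cdots\otimes b_n)$, and this induces a map $[\delta,-]$ on $H\!H^\bullet(B)$. *)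

theory Defs
  imports Complex_Main "HOL-Library.Function_Algebras"
begin

section \<open>Vector spaces of functions, linear maps on subspaces\<close>

text \<open>
  The vector space \<open>V\<close> is an abstract one: a type with a scalar multiplication, as in
  \<^theory>\<open>HOL.Vector_Spaces\<close>.  All the spaces built from it (tensor, symmetric and exterior
  algebras, tensor products, bimodules, smash products) are subspaces of function types
  \<^typ>\<open>'x \<Rightarrow> 'k\<close> with the pointwise operations.
\<close>

definition scl :: "'k::field \<Rightarrow> ('x \<Rightarrow> 'k) \<Rightarrow> 'x \<Rightarrow> 'k" where
  "scl c f = (\<lambda>x. c * f x)"

interpretation fn: vector_space "scl :: 'k::field \<Rightarrow> ('x \<Rightarrow> 'k) \<Rightarrow> 'x \<Rightarrow> 'k"
  by unfold_locales (auto simp: scl_def fun_eq_iff algebra_simps)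

definition linear_on ::
  "('k \<Rightarrow> 'a \<Rightarrow> 'a) \<Rightarrow> 'a::plus set \<Rightarrow> ('k \<Rightarrow> 'b \<Rightarrow> 'b) \<Rightarrow> ('a \<Rightarrow> 'b::plus) \<Rightarrow> bool" where
  "linear_on s A t f \<longleftrightarrow>
     (\<forall>x\<in>A. \<forall>y\<in>A. f (x + y) = f x + f y) \<and> (\<forall>c. \<forall>x\<in>A. f (s c x) = t c (f x))"

section \<open>Universal constructions\<close>

text \<open>
  Every space with a universal property below is modelled as in Halmos, \<open>Finite-Dimensional
  Vector Spaces\<close>, section 24: the tensor product of \<open>U\<close> and \<open>W\<close> is spanned by the pure tensors
  \<open>u \<otimes> w\<close>, and \<open>u \<otimes> w\<close> is the functional on bilinear forms \<open>\<beta>\<close> with value \<open>\<beta>(u, w)\<close>.  In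
  general, let \<open>P\<close> be the predicate singling out, among the functions on a set of generating
  symbols, those which respect the defining relations.  The symbol \<open>x\<close> becomes the evaluation
  \<open>pure P x\<close> at \<open>x\<close> of functions satisfying \<open>P\<close>.  Over a field linear functionals separate the
  points of the quotient of the free vector space on the symbols by the relations, so that this
  quotient is isomorphic to the span of the elements \<open>pure P x\<close>.

  \<open>lext F\<close> is the linear map sending \<open>pure P x\<close> to \<open>F x\<close>, provided \<open>F\<close> respects the
  relations: see lemma \<open>lext_pure\<close>, the universal property.  Since all definitions below
  that use \<open>lext\<close> depend on this proviso, their values on pure tensors are computed at the end.
\<close>

definition pure :: "(('x \<Rightarrow> 'k) \<Rightarrow> bool) \<Rightarrow> 'x \<Rightarrow> ('x \<Rightarrow> 'k) \<Rightarrow> 'k::zero" where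
  "pure P x = (\<lambda>l. if P l then l x else 0)"

definition lext :: "('x \<Rightarrow> 'y \<Rightarrow> 'k) \<Rightarrow> (('x \<Rightarrow> 'k) \<Rightarrow> 'k) \<Rightarrow> 'y \<Rightarrow> 'k" where
  "lext F z = (\<lambda>y. z (\<lambda>x. F x y))"

lemma lext_pure:
  assumes "\<And>y. P (\<lambda>x. F x y)"
  shows "lext F (pure P x) = F x"
  using assms by (simp add: lext_def pure_def)

lemma lext_add: "lext F (z + w) = lext F z + lext F w"
  by (simp add: lext_def fun_eq_iff)

lemma lext_scl: "lext F (scl c z) = scl c (lext F z)"
  by (simp add: lext_def scl_def)

definition multilinear_form ::
  "('k \<Rightarrow> 'a \<Rightarrow> 'a) \<Rightarrow> 'a::plus set \<Rightarrow> nat \<Rightarrow> ('a list \<Rightarrow> 'k::field) \<Rightarrow> bool" where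
  "multilinear_form s A n l \<longleftrightarrow>
     (\<forall>us vs. set us \<subseteq> A \<longrightarrow> set vs \<subseteq> A \<longrightarrow> length us + length vs + 1 = n \<longrightarrow>
        linear_on s A (*) (\<lambda>x. l (us @ [x] @ vs)))"

definition tpow :: "('k \<Rightarrow> 'a \<Rightarrow> 'a) \<Rightarrow> 'a::plus set \<Rightarrow> nat \<Rightarrow> 'a list \<Rightarrow> ('a list \<Rightarrow> 'k) \<Rightarrow> 'k::field"
  where "tpow s A n xs = pure (multilinear_form s A n) xs"

definition Tpow :: "('k \<Rightarrow> 'a \<Rightarrow> 'a) \<Rightarrow> 'a::plus set \<Rightarrow> nat \<Rightarrow> (('a list \<Rightarrow> 'k::field) \<Rightarrow> 'k) set" where
  "Tpow s A n = fn.span {tpow s A n xs | xs. set xs \<subseteq> A \<and> length xs = n}"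

definition tword :: "('k \<Rightarrow> 'v \<Rightarrow> 'v) \<Rightarrow> 'v::plus list \<Rightarrow> ('v list \<Rightarrow> 'k) \<Rightarrow> 'k::field" where
  "tword s = pure (\<lambda>l. \<forall>n. multilinear_form s UNIV n l)"

definition Talg :: "('k \<Rightarrow> 'v \<Rightarrow> 'v) \<Rightarrow> (('v::plus list \<Rightarrow> 'k::field) \<Rightarrow> 'k) set" where
  "Talg s = fn.span (range (tword s))"

definition tmul where
  "tmul s f g = lext (\<lambda>xs. lext (\<lambda>ys. tword s (xs @ ys)) g) f"

text \<open>
  The symmetric algebra \<open>S(V)\<close>: in addition, \<open>\<dots> x y \<dots> = \<dots> y x \<dots>\<close>.
\<close>

definition symmetric_form :: "('k \<Rightarrow> 'v \<Rightarrow> 'v) \<Rightarrow> ('v::plus list \<Rightarrow> 'k::field) \<Rightarrow> bool" where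
  "symmetric_form s l \<longleftrightarrow> (\<forall>n. multilinear_form s UNIV n l) \<and>
     (\<forall>us x y vs. l (us @ [x, y] @ vs) = l (us @ [y, x] @ vs))"

definition sword :: "('k \<Rightarrow> 'v \<Rightarrow> 'v) \<Rightarrow> 'v::plus list \<Rightarrow> ('v list \<Rightarrow> 'k) \<Rightarrow> 'k::field" where
  "sword s = pure (symmetric_form s)"

definition Salg :: "('k \<Rightarrow> 'v \<Rightarrow> 'v) \<Rightarrow> (('v::plus list \<Rightarrow> 'k::field) \<Rightarrow> 'k) set" where
  "Salg s = fn.span (range (sword s))"

definition smul where
  "smul s f g = lext (\<lambda>xs. lext (\<lambda>ys. sword s (xs @ ys)) g) f"

abbreviation sone where "sone s \<equiv> sword s []"
abbreviation svec where "svec s v \<equiv> sword s [v]"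

text \<open>The surjection \<open>\<pi>: T(V) \<rightarrow> S(V)\<close>.\<close>

definition proj_TS where
  "proj_TS s = lext (sword s)"

text \<open>
  The exterior power \<open>\<Lambda>\<^sup>p(V)\<close>: words of length \<open>p\<close>, in addition \<open>\<dots> x x \<dots> = 0\<close>.
\<close>

definition alternating_form :: "('k \<Rightarrow> 'v \<Rightarrow> 'v) \<Rightarrow> nat \<Rightarrow> ('v::plus list \<Rightarrow> 'k::field) \<Rightarrow> bool" where
  "alternating_form s p l \<longleftrightarrow> multilinear_form s UNIV p l \<and>
     (\<forall>us x vs. length us + length vs + 2 = p \<longrightarrow> l (us @ [x, x] @ vs) = 0)"

definition wedge :: "('k \<Rightarrow> 'v \<Rightarrow> 'v) \<Rightarrow> nat \<Rightarrow> 'v::plus list \<Rightarrow> ('v list \<Rightarrow> 'k) \<Rightarrow> 'k::field" where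
  "wedge s p = pure (alternating_form s p)"

definition Ext :: "('k \<Rightarrow> 'v \<Rightarrow> 'v) \<Rightarrow> nat \<Rightarrow> (('v::plus list \<Rightarrow> 'k::field) \<Rightarrow> 'k) set" where
  "Ext s p = fn.span {wedge s p vs | vs. length vs = p}"

text \<open>
  The triple tensor product \<open>S(V) \<otimes> M \<otimes> S(V)\<close>, for a subspace \<open>M\<close> with scalar multiplication
  \<open>t\<close>, and its \<open>S(V)\<close>-bimodule structure.
\<close>

definition trilinear_form where
  "trilinear_form s t M \<beta> \<longleftrightarrow>
     (\<forall>m\<in>M. \<forall>c\<in>Salg s. linear_on scl (Salg s) (*) (\<lambda>a. \<beta> (a, m, c))) \<and>
     (\<forall>a\<in>Salg s. \<forall>c\<in>Salg s. linear_on t M (*) (\<lambda>m. \<beta> (a, m, c))) \<and>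
     (\<forall>a\<in>Salg s. \<forall>m\<in>M. linear_on scl (Salg s) (*) (\<lambda>c. \<beta> (a, m, c)))"

definition tri where
  "tri s t M a m c = pure (trilinear_form s t M) (a, m, c)"

definition SMS where
  "SMS s t M = fn.span {tri s t M a m c | a m c. a \<in> Salg s \<and> m \<in> M \<and> c \<in> Salg s}"

definition SMS_left where
  "SMS_left s t M f x = lext (\<lambda>(a, m, c). tri s t M (smul s f a) m c) x"

definition SMS_right where
  "SMS_right s t M x f = lext (\<lambda>(a, m, c). tri s t M a m (smul s c f)) x"

section \<open>Group actions and smash products\<close>

text \<open>
  A finite group is a type of class \<^class>\<open>finite\<close> and \<^class>\<open>group_add\<close>: the class of all
  (not necessarily commutative) groups, which Isabelle/HOL writes additively.  So \<open>g + h\<close> is the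
  product \<open>gh\<close>, \<open>0\<close> the neutral element and \<open>- g\<close> the inverse of \<open>g\<close>.
\<close>

definition group_rep_on ::
  "('k \<Rightarrow> 'v \<Rightarrow> 'v) \<Rightarrow> 'v::plus set \<Rightarrow> ('g::group_add \<Rightarrow> 'v \<Rightarrow> 'v) \<Rightarrow> bool" where
  "group_rep_on s W \<rho> \<longleftrightarrow> (\<forall>g. linear_on s W s (\<rho> g) \<and> \<rho> g ` W \<subseteq> W) \<and>
     (\<forall>w\<in>W. \<rho> 0 w = w) \<and> (\<forall>g h. \<forall>w\<in>W. \<rho> (g + h) w = \<rho> g (\<rho> h w))"

definition irreducible_on ::
  "(('x \<Rightarrow> 'k::field) set) \<Rightarrow> ('g::group_add \<Rightarrow> ('x \<Rightarrow> 'k) \<Rightarrow> 'x \<Rightarrow> 'k) \<Rightarrow> bool" where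
  "irreducible_on W \<tau> \<longleftrightarrow> fn.subspace W \<and> group_rep_on scl W \<tau> \<and> W \<noteq> {0} \<and>
     (\<forall>U. fn.subspace U \<longrightarrow> U \<subseteq> W \<longrightarrow> (\<forall>g. \<tau> g ` U \<subseteq> U) \<longrightarrow> U = {0} \<or> U = W)"

text \<open>
  \<open>G\<close> is split by \<open>k\<close>: the endomorphisms of each irreducible representation of \<open>G\<close> over \<open>k\<close>
  are the scalars.  An irreducible representation has dimension at most \<open>|G|\<close>, so up to
  isomorphism it lives on some subspace of the functions \<open>G \<rightarrow> k\<close> (on which \<open>\<tau>\<close> is an arbitrary
  action).
\<close>

definition group_split_by :: "'g::{finite,group_add} itself \<Rightarrow> 'k::field itself \<Rightarrow> bool" where
  "group_split_by _ _ \<longleftrightarrow>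
     (\<forall>(W :: ('g \<Rightarrow> 'k) set) (\<tau> :: 'g \<Rightarrow> ('g \<Rightarrow> 'k) \<Rightarrow> 'g \<Rightarrow> 'k) f.
        irreducible_on W \<tau> \<longrightarrow> linear_on scl W scl f \<longrightarrow> f ` W \<subseteq> W \<longrightarrow>
        (\<forall>g. \<forall>w\<in>W. f (\<tau> g w) = \<tau> g (f w)) \<longrightarrow> (\<exists>c. \<forall>w\<in>W. f w = scl c w))"

definition Tact where
  "Tact s \<rho> g = lext (\<lambda>vs. tword s (map (\<rho> g) vs))"

definition Sact where
  "Sact s \<rho> g = lext (\<lambda>vs. sword s (map (\<rho> g) vs))"

definition Eact where
  "Eact s \<rho> p g = lext (\<lambda>vs. wedge s p (map (\<rho> g) vs))"

text \<open>
  \<open>M \<rtimes> G = M \<otimes> kG\<close> for a space \<open>M\<close> of functions on \<open>'y\<close>: the family \<open>(m\<^sub>g)\<close> stands for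
  \<open>\<Sum>\<^sub>g m\<^sub>g \<otimes> g\<close>, and is stored as the function \<open>(g, y) \<mapsto> m\<^sub>g(y)\<close>.  \<open>rtimes m g\<close> is \<open>m \<rtimes> g\<close>.
\<close>

definition rtimes :: "('y \<Rightarrow> 'k::zero) \<Rightarrow> 'g \<Rightarrow> 'g \<times> 'y \<Rightarrow> 'k" where
  "rtimes m g = (\<lambda>(h, y). if h = g then m y else 0)"

definition component :: "('g \<times> 'y \<Rightarrow> 'k) \<Rightarrow> 'g \<Rightarrow> 'y \<Rightarrow> 'k" where
  "component x g = (\<lambda>y. x (g, y))"

definition Rtimes :: "('y \<Rightarrow> 'k) set \<Rightarrow> ('g \<times> 'y \<Rightarrow> 'k) set" where
  "Rtimes M = {x. \<forall>g. component x g \<in> M}"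

text \<open>\<open>F \<rtimes> G\<close>, for \<open>F: M \<rightarrow> N\<close>.\<close>

definition rtimes_map :: "(('y \<Rightarrow> 'k) \<Rightarrow> 'z \<Rightarrow> 'k) \<Rightarrow> ('g \<times> 'y \<Rightarrow> 'k) \<Rightarrow> 'g \<times> 'z \<Rightarrow> 'k" where
  "rtimes_map F x = (\<lambda>(g, z). F (component x g) z)"

definition SG where
  "SG s = Rtimes (Salg s)"

definition SG_mul ::
  "('k::field \<Rightarrow> 'v::plus \<Rightarrow> 'v) \<Rightarrow> ('g::{finite,group_add} \<Rightarrow> 'v \<Rightarrow> 'v) \<Rightarrow>
    ('g \<times> ('v list \<Rightarrow> 'k) \<Rightarrow> 'k) \<Rightarrow> ('g \<times> ('v list \<Rightarrow> 'k) \<Rightarrow> 'k) \<Rightarrow> 'g \<times> ('v list \<Rightarrow> 'k) \<Rightarrow> 'k" where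
  "SG_mul s \<rho> a b =
     (\<Sum>g\<in>UNIV. \<Sum>h\<in>UNIV. rtimes (smul s (component a g) (Sact s \<rho> g (component b h))) (g + h))"

abbreviation SG_one where "SG_one s \<equiv> rtimes (sone s) 0"

section \<open>Derivations, bimodule maps and liftings\<close>

definition derivation_on where
  "derivation_on A mul M lact ract D \<longleftrightarrow>
     linear_on scl A scl D \<and> D ` A \<subseteq> M \<and>
     (\<forall>a\<in>A. \<forall>b\<in>A. D (mul a b) = ract (D a) b + lact a (D b))"

definition bimodule_hom_on where
  "bimodule_hom_on B M lact ract N lact' ract' f \<longleftrightarrow>
     linear_on scl M scl f \<and> f ` M \<subseteq> N \<and>
     (\<forall>b\<in>B. \<forall>x\<in>M. f (lact b x) = lact' b (f x) \<and> f (ract x b) = ract' (f x) b)"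

definition delta_e_lifting where
  "delta_e_lifting B \<delta> P lact ract d \<epsilon> \<delta>s \<longleftrightarrow>
     (\<forall>i. linear_on scl (P i) scl (\<delta>s i) \<and> \<delta>s i ` P i \<subseteq> P i \<and>
       (\<forall>a\<in>B. \<forall>b\<in>B. \<forall>x\<in>P i.
          \<delta>s i (ract i (lact i a x) b) =
            ract i (lact i (\<delta> a) x) b + ract i (lact i a (\<delta>s i x)) b + ract i (lact i a x) (\<delta> b))) \<and>
     (\<forall>i. \<forall>x\<in>P (Suc i). d (Suc i) (\<delta>s (Suc i) x) = \<delta>s i (d (Suc i) x)) \<and>
     (\<forall>x\<in>P 0. \<epsilon> (\<delta>s 0 x) = \<delta> (\<epsilon> x))"

section \<open>The Koszul resolution\<close>

text \<open>\<open>ktri s p a \<omega> c\<close> is \<open>a \<otimes> \<omega> \<otimes> c\<close> in \<open>K\<^sub>p = S(V) \<otimes> \<Lambda>\<^sup>p(V) \<otimes> S(V)\<close>.\<close>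

abbreviation ktri where "ktri s p \<equiv> tri s scl (Ext s p)"
abbreviation Kos where "Kos s p \<equiv> SMS s scl (Ext s p)"

definition omit :: "nat \<Rightarrow> 'a list \<Rightarrow> 'a list" where
  "omit i xs = take i xs @ drop (Suc i) xs"

text \<open>
  The differential \<open>K\<^sub>p \<rightarrow> K\<^sub>p\<^sub>-\<^sub>1\<close> (\<open>p \<ge> 1\<close>); positions are counted from \<open>0\<close>, hence the sign \<open>(-1)\<^sup>i\<close>.
  On pure tensors see lemma \<open>kos_d_ktri\<close>.
\<close>

definition kos_d where
  "kos_d s p = lext (\<lambda>(a, \<omega>, c). lext (\<lambda>vs. \<Sum>i<p. scl ((-1) ^ i)
      (ktri s (p - 1) (smul s a (svec s (vs ! i))) (wedge s (p - 1) (omit i vs)) c -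
       ktri s (p - 1) a (wedge s (p - 1) (omit i vs)) (smul s (svec s (vs ! i)) c))) \<omega>)"

text \<open>
  The augmentation \<open>K\<^sub>0 \<rightarrow> S(V)\<close>, \<open>a \<otimes> 1 \<otimes> c \<mapsto> ac\<close>; \<open>\<Lambda>\<^sup>0(V)\<close> is spanned by the empty word.
\<close>

definition kos_aug where
  "kos_aug s = lext (\<lambda>(a, \<omega>, c). lext (\<lambda>vs. smul s a c) \<omega>)"

definition kos_act where
  "kos_act s \<rho> p g = lext (\<lambda>(a, \<omega>, c). ktri s p (Sact s \<rho> g a) (Eact s \<rho> p g \<omega>) (Sact s \<rho> g c))"

abbreviation KG where "KG s p \<equiv> Rtimes (Kos s p)"

definition KG_left ::
  "('k::field \<Rightarrow> 'v::plus \<Rightarrow> 'v) \<Rightarrow> ('g::{finite,group_add} \<Rightarrow> 'v \<Rightarrow> 'v) \<Rightarrow> nat \<Rightarrow> _" where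
  "KG_left s \<rho> p b x = (\<Sum>g\<in>UNIV. \<Sum>h\<in>UNIV.
     rtimes (SMS_left s scl (Ext s p) (component b g) (kos_act s \<rho> p g (component x h))) (g + h))"

definition KG_right ::
  "('k::field \<Rightarrow> 'v::plus \<Rightarrow> 'v) \<Rightarrow> ('g::{finite,group_add} \<Rightarrow> 'v \<Rightarrow> 'v) \<Rightarrow> nat \<Rightarrow> _" where
  "KG_right s \<rho> p x b = (\<Sum>h\<in>UNIV. \<Sum>g\<in>UNIV.
     rtimes (SMS_right s scl (Ext s p) (component x h) (Sact s \<rho> h (component b g))) (h + g))"

definition KG_d where
  "KG_d s p = rtimes_map (kos_d s p)"

definition KG_aug where
  "KG_aug s = rtimes_map (kos_aug s)"

section \<open>The complex \<open>hom(\<Lambda>(V), S(V) \<rtimes> G)\<^sup>G\<close>\<close>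

definition kos_cochain where
  "kos_cochain s \<rho> p \<phi> \<longleftrightarrow>
     linear_on scl (Ext s p) scl \<phi> \<and> \<phi> ` Ext s p \<subseteq> SG s \<and>
     (\<forall>g. \<forall>\<omega>\<in>Ext s p.
        SG_mul s \<rho> (SG_mul s \<rho> (rtimes (sone s) g) (\<phi> (Eact s \<rho> p (- g) \<omega>))) (rtimes (sone s) (- g))
          = \<phi> \<omega>)"

text \<open>
  The bimodule map \<open>K\<^sub>p \<rtimes> G \<rightarrow> S(V) \<rtimes> G\<close> restricting to \<open>\<phi>\<close>:
  \<open>a \<otimes> \<omega> \<otimes> c \<rtimes> g \<mapsto> a \<phi>(\<omega>) (c \<rtimes> g)\<close>.
\<close>

definition kos_ext where
  "kos_ext s \<rho> \<phi> x = (\<Sum>g\<in>UNIV.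
     lext (\<lambda>(a, \<omega>, c). SG_mul s \<rho> (SG_mul s \<rho> (rtimes a 0) (\<phi> \<omega>)) (rtimes c g)) (component x g))"

text \<open>
  The differential is the one of \<open>hom(K \<rtimes> G, S(V) \<rtimes> G)\<close>, composition with \<open>d\<close>, transported
  along the identification.
\<close>

definition kos_cocycle where
  "kos_cocycle s \<rho> p \<phi> \<longleftrightarrow> kos_cochain s \<rho> p \<phi> \<and>
     (\<forall>\<omega>\<in>Ext s (Suc p).
        kos_ext s \<rho> \<phi> (KG_d s (Suc p) (rtimes (ktri s (Suc p) (sone s) \<omega> (sone s)) 0)) = 0)"

section \<open>The standard complex\<close>

text \<open>
  The bar resolution of \<open>B = S(V) \<rtimes> G\<close>: \<open>Bar\<^sub>n = B \<otimes> B\<^sup>\<otimes>\<^sup>n \<otimes> B\<close>, a tensor power of \<open>B\<close>.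
\<close>

abbreviation btens where "btens s n \<equiv> tpow scl (SG s) n"
abbreviation Btens where "Btens s n \<equiv> Tpow scl (SG s) n"
abbreviation Bar where "Bar s n \<equiv> Btens s (n + 2)"

definition merge_at :: "('a \<Rightarrow> 'a \<Rightarrow> 'a) \<Rightarrow> nat \<Rightarrow> 'a list \<Rightarrow> 'a list" where
  "merge_at mul i bs = take i bs @ [mul (bs ! i) (bs ! Suc i)] @ drop (i + 2) bs"

definition bar_left where
  "bar_left s \<rho> n b = lext (\<lambda>bs. btens s (n + 2) (SG_mul s \<rho> b (hd bs) # tl bs))"

definition bar_right where
  "bar_right s \<rho> n x b = lext (\<lambda>bs. btens s (n + 2) (butlast bs @ [SG_mul s \<rho> (last bs) b])) x"

text \<open>The differential \<open>Bar\<^sub>n \<rightarrow> Bar\<^sub>n\<^sub>-\<^sub>1\<close> (\<open>n \<ge> 1\<close>) and the augmentation.\<close>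

definition bar_d where
  "bar_d s \<rho> n = lext (\<lambda>bs. \<Sum>i<n + 1. scl ((-1) ^ i) (btens s (n + 1) (merge_at (SG_mul s \<rho>) i bs)))"

definition bar_aug where
  "bar_aug s \<rho> = lext (\<lambda>bs. SG_mul s \<rho> (bs ! 0) (bs ! 1))"

text \<open>Hochschild \<open>n\<close>-cochains are linear maps \<open>c: B\<^sup>\<otimes>\<^sup>n \<rightarrow> B\<close>.\<close>

definition hoch_cochain where
  "hoch_cochain s n c \<longleftrightarrow> linear_on scl (Btens s n) scl c \<and> c ` Btens s n \<subseteq> SG s"

text \<open>The value on \<open>b\<^sub>1 \<otimes> \<dots> \<otimes> b\<^sub>n\<^sub>+\<^sub>1\<close> of the differential of an \<open>n\<close>-cochain \<open>c\<close>.\<close>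

definition hoch_d where
  "hoch_d s \<rho> n c bs =
     SG_mul s \<rho> (hd bs) (c (btens s n (tl bs))) +
     (\<Sum>i<n. scl ((-1) ^ (i + 1)) (c (btens s n (merge_at (SG_mul s \<rho>) i bs)))) +
     scl ((-1) ^ (n + 1)) (SG_mul s \<rho> (c (btens s n (butlast bs))) (last bs))"

definition hoch_cohomologous where
  "hoch_cohomologous s \<rho> n c c' \<longleftrightarrow>
     (case n of
        0 \<Rightarrow> \<forall>z\<in>Btens s 0. c z = c' z
      | Suc m \<Rightarrow> \<exists>e. hoch_cochain s m e \<and>
          (\<forall>bs. set bs \<subseteq> SG s \<longrightarrow> length bs = n \<longrightarrow>
             c (btens s n bs) - c' (btens s n bs) = hoch_d s \<rho> m e bs))"

definition gerst_bracket where
  "gerst_bracket s n \<delta> c z =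
     \<delta> (c z) - c (lext (\<lambda>bs. \<Sum>j<n. btens s n (bs[j := \<delta> (bs ! j)])) z)"

section \<open>Identification of the two cohomologies\<close>

text \<open>
  Morphisms of complexes of bimodules from the bar resolution to \<open>K \<rtimes> G\<close> over the identity of
  \<open>S(V) \<rtimes> G\<close>.  Any of them induces the canonical identification of the cohomology of
  \<open>hom(\<Lambda>(V), S(V) \<rtimes> G)\<^sup>G\<close> with Hochschild cohomology: the class of \<open>\<phi>\<close> goes to that of
  \<open>b\<^sub>1 \<otimes> \<dots> \<otimes> b\<^sub>p \<mapsto> \<Phi>(\<theta>\<^sub>p(1 \<otimes> b\<^sub>1 \<otimes> \<dots> \<otimes> b\<^sub>p \<otimes> 1))\<close>, with \<open>\<Phi>\<close> the bimodule map
  restricting to \<open>\<phi>\<close>.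
\<close>

definition comparison where
  "comparison s \<rho> \<theta> \<longleftrightarrow>
     (\<forall>n. bimodule_hom_on (SG s) (Bar s n) (bar_left s \<rho> n) (bar_right s \<rho> n)
            (KG s n) (KG_left s \<rho> n) (KG_right s \<rho> n) (\<theta> n)) \<and>
     (\<forall>n. \<forall>x\<in>Bar s (Suc n). KG_d s (Suc n) (\<theta> (Suc n) x) = \<theta> n (bar_d s \<rho> (Suc n) x)) \<and>
     (\<forall>x\<in>Bar s 0. KG_aug s (\<theta> 0 x) = bar_aug s \<rho> x)"

definition to_hoch where
  "to_hoch s \<rho> \<theta> p \<phi> z =
     kos_ext s \<rho> \<phi> (\<theta> p (lext (\<lambda>bs. btens s (p + 2) (SG_one s # bs @ [SG_one s])) z))"

section \<open>Values on pure tensors\<close>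


lemma linear_on_fieldI:
  assumes "\<And>x y. x \<in> A \<Longrightarrow> y \<in> A \<Longrightarrow> f (x + y) = f x + f y" "\<And>c x. x \<in> A \<Longrightarrow> f (s c x) = t c (f x)"
  shows "linear_on s A t f"
  using assms by (simp add: linear_on_def)

lemma pure_span_induct [consumes 1, case_names zero step]:
  fixes P :: "('x \<Rightarrow> 'k::field) \<Rightarrow> bool"
  assumes z: "z \<in> fn.span {pure P x | x. Q x}"
    and zero: "R (\<lambda>l. 0)"
    and step: "\<And>c u z. Q u \<Longrightarrow> R z \<Longrightarrow> R (\<lambda>l. c * pure P u l + z l)"
  shows "R z"
  using z
proof (induction rule: fn.span_induct_alt)
  case base
  have "(0 :: ('x \<Rightarrow> 'k) \<Rightarrow> 'k) = (\<lambda>l. 0)" by (simp add: fun_eq_iff)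
  then show ?case using zero by simp
next
  case (step c x y)
  then obtain u where "x = pure P u" "Q u" by auto
  moreover have "scl c x + y = (\<lambda>l. c * x l + y l)" by (simp add: fun_eq_iff scl_def)
  ultimately show ?case using assms(3)[of u y c] step by simp
qed

lemma pure_span_bad:
  assumes "z \<in> fn.span {pure P x | x. Q x}" and "\<not> P l"
  shows "z l = 0"
  using assms(1) by (induction rule: pure_span_induct) (simp_all add: pure_def assms(2))

lemma pure_span_zero:
  assumes "z \<in> fn.span {pure P x | x. Q x}"
  shows "z (\<lambda>x. 0) = 0"
  using assms by (induction rule: pure_span_induct) (simp_all add: pure_def)

lemma pure_span_add:
  assumes "z \<in> fn.span {pure P x | x. Q x}" "P l" "P l'" "P (\<lambda>x. l x + l' x)"
  shows "z (\<lambda>x. l x + l' x) = z l + z l'"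
  using assms(1)
proof (induction rule: pure_span_induct)
  case (step c u z)
  then show ?case by (simp add: pure_def assms(2-) distrib_left)
qed simp

lemma pure_span_scl:
  assumes "z \<in> fn.span {pure P x | x. Q x}" "P l" "P (\<lambda>x. c * l x)"
  shows "z (\<lambda>x. c * l x) = c * z l"
  using assms(1)
proof (induction rule: pure_span_induct)
  case (step d u z)
  then show ?case by (simp add: pure_def assms(2-) distrib_left mult.left_commute)
qed simp

lemma lext_pure_span:
  fixes N :: "('y \<Rightarrow> 'k::field) set"
  assumes N: "fn.subspace N" and z: "z \<in> fn.span {pure P x | x. Q x}"
    and P: "\<And>y. P (\<lambda>x. F x y)" and Q: "\<And>x. Q x \<Longrightarrow> F x \<in> N"
  shows "lext F z \<in> N"
  using z
proof (induction rule: fn.span_induct_alt)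
  case base
  have "lext F 0 = (0 :: 'y \<Rightarrow> 'k)" by (simp add: lext_def fun_eq_iff)
  then show ?case using fn.subspace_0[OF N] by metis
next
  case (step c x y)
  then obtain u where u: "x = pure P u" "Q u" by auto
  have "lext F x = F u" unfolding u(1) by (rule lext_pure[where P = P and F = F]) (rule P)
  then have "lext F (scl c x + y) = scl c (F u) + lext F y" by (simp add: lext_add lext_scl)
  then show ?case using fn.subspace_add[OF N fn.subspace_scale[OF N Q[OF u(2)]] step(2)] by metis
qed

lemma multilinear_zero: "multilinear_form s A n (\<lambda>x. 0)"
  by (simp add: multilinear_form_def linear_on_def)
lemma multilinear_add: "multilinear_form s A n l \<Longrightarrow> multilinear_form s A n l' \<Longrightarrow> multilinear_form s A n (\<lambda>x. l x + l' x)"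
  by (simp add: multilinear_form_def linear_on_def algebra_simps)
lemma multilinear_scl: "multilinear_form s A n l \<Longrightarrow> multilinear_form s A n (\<lambda>x. c * l x)"
  by (simp add: multilinear_form_def linear_on_def algebra_simps)

lemma symmetric_zero: "symmetric_form s (\<lambda>x. 0)"
  by (simp add: symmetric_form_def multilinear_zero)
lemma symmetric_add: "symmetric_form s l \<Longrightarrow> symmetric_form s l' \<Longrightarrow> symmetric_form s (\<lambda>x. l x + l' x)"
  by (simp add: symmetric_form_def multilinear_add)
lemma symmetric_scl: "symmetric_form s l \<Longrightarrow> symmetric_form s (\<lambda>x. c * l x)"
  by (simp add: symmetric_form_def multilinear_scl)
lemma alternating_zero: "alternating_form s p (\<lambda>x. 0)"
  by (simp add: alternating_form_def multilinear_zero)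
lemma alternating_add: "alternating_form s p l \<Longrightarrow> alternating_form s p l' \<Longrightarrow> alternating_form s p (\<lambda>x. l x + l' x)"
  by (simp add: alternating_form_def multilinear_add)
lemma alternating_scl: "alternating_form s p l \<Longrightarrow> alternating_form s p (\<lambda>x. c * l x)"
  by (simp add: alternating_form_def multilinear_scl)

lemma multilinear_append:
  assumes "\<forall>n. multilinear_form s UNIV n l"
  shows "\<forall>n. multilinear_form s UNIV n (\<lambda>ys. l (xs @ ys))"
proof -
  have "linear_on s UNIV (*) (\<lambda>x. l ((xs @ us) @ [x] @ vs))" for us vs
    using assms unfolding multilinear_form_def by blast
  then show ?thesis unfolding multilinear_form_def by simp
qed

lemma symmetric_append:
  assumes "symmetric_form s l"
  shows "symmetric_form s (\<lambda>ys. l (xs @ ys))"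
proof -
  have "l (xs @ us @ [x, y] @ vs) = l (xs @ us @ [y, x] @ vs)" for us x y vs
  proof -
    have "l ((xs @ us) @ [x, y] @ vs) = l ((xs @ us) @ [y, x] @ vs)"
      using assms unfolding symmetric_form_def by blast
    then show ?thesis by simp
  qed
  then show ?thesis
    using assms multilinear_append[of s l xs] unfolding symmetric_form_def by blast
qed

lemma Salg_alt: "Salg s = fn.span {pure (symmetric_form s) x | x. True}"
  by (simp add: Salg_def sword_def full_SetCompr_eq)
lemma Talg_alt: "Talg s = fn.span {pure (\<lambda>l. \<forall>n. multilinear_form s UNIV n l) x | x. True}"
  by (simp add: Talg_def tword_def full_SetCompr_eq)
lemma Ext_alt: "Ext s p = fn.span {pure (alternating_form s p) vs | vs. length vs = p}"
  by (simp add: Ext_def wedge_def)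

lemma Salg_form_add:
  assumes "g \<in> Salg s" "symmetric_form s l" "symmetric_form s l'"
  shows "g (\<lambda>x. l x + l' x) = g l + g l'"
  by (rule pure_span_add[of g "symmetric_form s" "\<lambda>_. True"])
    (use assms symmetric_add[of s l l'] in \<open>auto simp: Salg_alt\<close>)
lemma Salg_form_scl:
  assumes "g \<in> Salg s" "symmetric_form s l"
  shows "g (\<lambda>x. c * l x) = c * g l"
  by (rule pure_span_scl[of g "symmetric_form s" "\<lambda>_. True"])
    (use assms symmetric_scl[of s l c] in \<open>auto simp: Salg_alt\<close>)

lemma symmetric_smul:
  assumes g: "g \<in> Salg s"
  shows "symmetric_form s (\<lambda>xs. lext (\<lambda>ys. sword s (xs @ ys)) g y)"
proof (cases "symmetric_form s y")
  case False
  then have "(\<lambda>xs. lext (\<lambda>ys. sword s (xs @ ys)) g y) = (\<lambda>xs. 0)"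
    using pure_span_zero[OF g[unfolded Salg_alt]] by (simp add: lext_def sword_def pure_def)
  then show ?thesis by (simp add: symmetric_zero)
next
  case True
  have E: "lext (\<lambda>ys. sword s (xs @ ys)) g y = g (\<lambda>ys. y (xs @ ys))" for xs
    using True by (simp add: lext_def sword_def pure_def)
  have ml: "linear_on s UNIV (*) (\<lambda>x. y (us @ [x] @ vs))" for us vs
    using True unfolding symmetric_form_def multilinear_form_def by auto
  have 1: "linear_on s UNIV (*) (\<lambda>x. g (\<lambda>ys. y (us @ [x] @ vs @ ys)))" for us vs
  proof (rule linear_on_fieldI)
    fix x x'
    have "(\<lambda>ys. y (us @ [x + x'] @ vs @ ys)) = (\<lambda>ys. y (us @ [x] @ vs @ ys) + y (us @ [x'] @ vs @ ys))"
      using ml unfolding linear_on_def by blast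
    moreover have "symmetric_form s (\<lambda>ys. y (us @ [x] @ vs @ ys))" for x
      using symmetric_append[OF True, of "us @ [x] @ vs"] by simp
    ultimately show "g (\<lambda>ys. y (us @ [x + x'] @ vs @ ys)) = g (\<lambda>ys. y (us @ [x] @ vs @ ys)) + g (\<lambda>ys. y (us @ [x'] @ vs @ ys))"
      using Salg_form_add[OF g] by simp
  next
    fix c x
    have "(\<lambda>ys. y (us @ [s c x] @ vs @ ys)) = (\<lambda>ys. c * y (us @ [x] @ vs @ ys))"
      using ml unfolding linear_on_def by blast
    moreover have "symmetric_form s (\<lambda>ys. y (us @ [x] @ vs @ ys))" for x
      using symmetric_append[OF True, of "us @ [x] @ vs"] by simp
    ultimately show "g (\<lambda>ys. y (us @ [s c x] @ vs @ ys)) = c * g (\<lambda>ys. y (us @ [x] @ vs @ ys))"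
      using Salg_form_scl[OF g] by simp
  qed
  have 2: "(\<lambda>ys. y (us @ [x, x'] @ vs @ ys)) = (\<lambda>ys. y (us @ [x', x] @ vs @ ys))" for us x x' vs
    using True unfolding symmetric_form_def by blast
  show ?thesis
    unfolding E symmetric_form_def multilinear_form_def using 1 2 by simp
qed

lemma smul_sword:
  "smul s (sword s xs) (sword s ys) = sword s (xs @ ys)"
proof -
  have y: "sword s ys \<in> Salg s" unfolding Salg_def by (simp add: fn.span_base)
  have "smul s (sword s xs) (sword s ys) = lext (\<lambda>ys. sword s (xs @ ys)) (sword s ys)"
    unfolding smul_def by (subst (2) sword_def) (rule lext_pure, rule symmetric_smul[OF y])
  also have "\<dots> = sword s (xs @ ys)"
  proof (subst (2) sword_def, rule lext_pure)
    fix z show "symmetric_form s (\<lambda>ys. sword s (xs @ ys) z)"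
      using symmetric_append[of s z xs] by (cases "symmetric_form s z") (auto simp: sword_def pure_def symmetric_zero)
  qed
  finally show ?thesis .
qed

lemma smul_closed:
  assumes "f \<in> Salg s" "g \<in> Salg s" shows "smul s f g \<in> Salg s"
  unfolding smul_def
proof (rule lext_pure_span[OF _ assms(1)[unfolded Salg_alt]])
  show "fn.subspace (Salg s)" by (simp add: Salg_def fn.subspace_span)
  show "symmetric_form s (\<lambda>x. lext (\<lambda>ys. sword s (x @ ys)) g y)" for y by (rule symmetric_smul[OF assms(2)])
  show "lext (\<lambda>ys. sword s (xs @ ys)) g \<in> Salg s" for xs
  proof (rule lext_pure_span[OF _ assms(2)[unfolded Salg_alt]])
    show "fn.subspace (Salg s)" by (simp add: Salg_def fn.subspace_span)
    show "symmetric_form s (\<lambda>ys. sword s (xs @ ys) z)" for z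
      using symmetric_append[of s z xs] by (cases "symmetric_form s z") (auto simp: sword_def pure_def symmetric_zero)
    show "sword s (xs @ ys) \<in> Salg s" for ys unfolding Salg_def by (simp add: fn.span_base)
  qed
qed

lemma smul_linear_left: "linear_on scl A scl (\<lambda>f. smul s f g)"
  by (simp add: linear_on_def smul_def lext_add lext_scl)

lemma smul_linear_right:
  assumes f: "f \<in> Salg s" shows "linear_on scl (Salg s) scl (smul s f)"
proof (rule linear_on_fieldI)
  fix g h assume gh: "g \<in> Salg s" "h \<in> Salg s"
  show "smul s f (g + h) = smul s f g + smul s f h"
  proof
    fix y
    define lg where "lg = (\<lambda>xs. lext (\<lambda>ys. sword s (xs @ ys)) g y)"
    define lh where "lh = (\<lambda>xs. lext (\<lambda>ys. sword s (xs @ ys)) h y)"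
    have "symmetric_form s lg" "symmetric_form s lh"
      unfolding lg_def lh_def by (rule symmetric_smul, rule gh)+
    then have "f (\<lambda>xs. lg xs + lh xs) = f lg + f lh"
      by (rule Salg_form_add[OF f])
    moreover have "smul s f (g + h) y = f (\<lambda>xs. lg xs + lh xs)"
      unfolding smul_def lg_def lh_def lext_add by (simp add: lext_def[of _ f])
    moreover have "smul s f g y = f lg" "smul s f h y = f lh"
      unfolding smul_def lg_def lh_def by (simp_all add: lext_def[of _ f])
    ultimately show "smul s f (g + h) y = (smul s f g + smul s f h) y" by simp
  qed
next
  fix c g assume g: "g \<in> Salg s"
  show "smul s f (scl c g) = scl c (smul s f g)"
  proof
    fix y
    define lg where "lg = (\<lambda>xs. lext (\<lambda>ys. sword s (xs @ ys)) g y)"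
    have "symmetric_form s lg"
      unfolding lg_def by (rule symmetric_smul, rule g)
    then have "f (\<lambda>xs. c * lg xs) = c * f lg"
      by (rule Salg_form_scl[OF f])
    moreover have "smul s f (scl c g) y = f (\<lambda>xs. c * lg xs)"
      unfolding smul_def lg_def lext_scl by (simp add: lext_def[of _ f] scl_def)
    moreover have "smul s f g y = f lg"
      unfolding smul_def lg_def by (simp add: lext_def[of _ f])
    ultimately show "smul s f (scl c g) y = scl c (smul s f g) y" by (simp add: scl_def)
  qed
qed


lemma Salg_subspace: "fn.subspace (Salg s)" by (simp add: Salg_def)
lemma sword_Salg: "sword s xs \<in> Salg s" unfolding Salg_def by (simp add: fn.span_base)
lemma Ext_subspace: "fn.subspace (Ext s p)" by (simp add: Ext_def)
lemma wedge_Ext: "length vs = p \<Longrightarrow> wedge s p vs \<in> Ext s p"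
  unfolding Ext_def by (auto intro: fn.span_base)

lemma Ext_form_add:
  assumes "g \<in> Ext s p" "alternating_form s p l" "alternating_form s p l'"
  shows "g (\<lambda>x. l x + l' x) = g l + g l'"
  by (rule pure_span_add[of g "alternating_form s p" "\<lambda>vs. length vs = p"])
    (use assms alternating_add[of s p l l'] in \<open>auto simp: Ext_alt\<close>)
lemma Ext_form_scl:
  assumes "g \<in> Ext s p" "alternating_form s p l"
  shows "g (\<lambda>x. c * l x) = c * g l"
  by (rule pure_span_scl[of g "alternating_form s p" "\<lambda>vs. length vs = p"])
    (use assms alternating_scl[of s p l c] in \<open>auto simp: Ext_alt\<close>)

lemma linear_on_sum:
  assumes "\<And>i. i \<in> I \<Longrightarrow> linear_on s A (*) (f i :: _ \<Rightarrow> 'k::field)"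
  shows "linear_on s A (*) (\<lambda>x. \<Sum>i\<in>I. f i x)"
  using assms by (auto simp: linear_on_def sum.distrib sum_distrib_left intro: sum.cong)

lemma linear_on_mult:
  "linear_on s A (*) f \<Longrightarrow> linear_on s A (*) (\<lambda>x. (c::'k::field) * f x)"
  by (simp add: linear_on_def distrib_left mult.left_commute)

lemma omit_left: "i < length us \<Longrightarrow> omit i (us @ vs) = omit i us @ vs"
  by (simp add: omit_def)
lemma omit_right: "length us \<le> i \<Longrightarrow> omit i (us @ vs) = us @ omit (i - length us) vs"
  by (simp add: omit_def Suc_diff_le)
lemma length_omit: "i < length us \<Longrightarrow> length (omit i us) = length us - 1"
  by (simp add: omit_def)

lemma alternating_koszul:
  fixes h :: "'v::plus \<Rightarrow> 'v list \<Rightarrow> 'k::field"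
  assumes lin: "\<And>us. length us = p - 1 \<Longrightarrow> linear_on s UNIV (*) (\<lambda>v. h v us)"
    and alt: "\<And>v. alternating_form s (p - 1) (h v)"
  shows "alternating_form s p (\<lambda>vs. \<Sum>i<p. (-1) ^ i * h (vs ! i) (omit i vs))"
  unfolding alternating_form_def multilinear_form_def
proof (intro conjI allI impI)
  fix us vs :: "'v list" assume p: "length us + length vs + 1 = p"
  have ml: "linear_on s UNIV (*) (\<lambda>x. h v (us' @ [x] @ vs'))" if "length us' + length vs' + 1 = p - 1" for v us' vs'
    using alt[of v] that unfolding alternating_form_def multilinear_form_def by auto
  show "linear_on s UNIV (*) (\<lambda>x. \<Sum>i<p. (-1) ^ i * h ((us @ [x] @ vs) ! i) (omit i (us @ [x] @ vs)))"
  proof (rule linear_on_sum, rule linear_on_mult)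
    fix i assume "i \<in> {..<p}"
    then consider "i < length us" | "i = length us" | "i > length us" "i < p" by force
    then show "linear_on s UNIV (*) (\<lambda>x. h ((us @ [x] @ vs) ! i) (omit i (us @ [x] @ vs)))"
    proof cases
      case 1
      then show ?thesis using ml[of "omit i us" vs "us ! i"] p by (simp add: omit_left length_omit nth_append)
    next
      case 2
      then show ?thesis using lin[of "us @ vs"] p by (simp add: omit_right nth_append) (simp add: omit_def)
    next
      case 3
      define j where "j = i - (length us + 1)"
      have j: "i = length us + 1 + j" "j < length vs" using 3 p by (auto simp: j_def)
      have "omit i ((us @ [x]) @ vs) = (us @ [x]) @ omit j vs" for x
        using j by (subst omit_right) auto
      moreover have "(us @ [x] @ vs) ! i = vs ! j" for x
        using j by (simp add: nth_append)
      ultimately show ?thesis using ml[of us "omit j vs" "vs ! j"] p j by (simp add: length_omit)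
    qed
  qed
next
  fix us vs :: "'v list" and x assume p: "length us + length vs + 2 = p"
  let ?k = "length us" and ?w = "us @ [x, x] @ vs"
  have z: "h v (us' @ [x, x] @ vs') = 0" if "length us' + length vs' + 2 = p - 1" for v us' vs'
    using alt[of v] that unfolding alternating_form_def by auto
  have 0: "(-1) ^ i * h (?w ! i) (omit i ?w) = 0" if "i \<in> {..<p} - {?k, Suc ?k}" for i
  proof -
    from that consider "i < ?k" | "i > Suc ?k" "i < p" by force
    then show ?thesis
    proof cases
      case 1
      then show ?thesis using z[of "omit i us" vs] p by (simp add: omit_left length_omit)
    next
      case 2
      define j where "j = i - (?k + 2)"
      have j: "i = ?k + 2 + j" "j < length vs" using 2 p by (auto simp: j_def)
      have "omit i ((us @ [x, x]) @ vs) = (us @ [x, x]) @ omit j vs"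
        using j by (subst omit_right) auto
      then show ?thesis using z[of us "omit j vs"] p j by (simp add: length_omit)
    qed
  qed
  have "(\<Sum>i<p. (-1) ^ i * h (?w ! i) (omit i ?w)) = (\<Sum>i\<in>{?k, Suc ?k}. (-1) ^ i * h (?w ! i) (omit i ?w))"
    using p 0 by (intro sum.mono_neutral_right) auto
  also have "\<dots> = (-1) ^ ?k * h x (us @ [x] @ vs) + (-1) ^ Suc ?k * h x (us @ [x] @ vs)"
    by (simp add: nth_append omit_def)
  finally show "(\<Sum>i<p. (-1) ^ i * h (?w ! i) (omit i ?w)) = 0" by simp
qed


lemma trilinear_zero: "trilinear_form s t M (\<lambda>x. 0)"
  by (simp add: trilinear_form_def linear_on_def)

lemma trilinear_tri: "trilinear_form s t M (\<lambda>(a, m, c). tri s t M a m c y)"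
proof (cases "trilinear_form s t M y")
  case True
  then have "(\<lambda>(a, m, c). tri s t M a m c y) = y" by (auto simp: tri_def pure_def fun_eq_iff)
  then show ?thesis using True by simp
next
  case False
  then have "(\<lambda>(a, m, c). tri s t M a m c y) = (\<lambda>x. 0)" by (auto simp: tri_def pure_def fun_eq_iff)
  then show ?thesis using trilinear_zero by simp
qed

lemma lext_tri:
  assumes "\<And>y. trilinear_form s t M (\<lambda>x. F x y)"
  shows "lext F (tri s t M a m c) = F (a, m, c)"
  unfolding tri_def by (rule lext_pure) (rule assms)

lemma trilinear_formI:
  assumes "\<And>m c. m \<in> M \<Longrightarrow> c \<in> Salg s \<Longrightarrow> linear_on scl (Salg s) (*) (\<lambda>a. \<beta> (a, m, c))"
    "\<And>a c. a \<in> Salg s \<Longrightarrow> c \<in> Salg s \<Longrightarrow> linear_on t M (*) (\<lambda>m. \<beta> (a, m, c))"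
    "\<And>a m. a \<in> Salg s \<Longrightarrow> m \<in> M \<Longrightarrow> linear_on scl (Salg s) (*) (\<lambda>c. \<beta> (a, m, c))"
  shows "trilinear_form s t M \<beta>"
  using assms by (simp add: trilinear_form_def)

lemma tri_linear1: "m \<in> M \<Longrightarrow> c \<in> Salg s \<Longrightarrow> linear_on scl (Salg s) (*) (\<lambda>a. tri s t M a m c y)"
  using trilinear_tri[of s t M y] by (simp add: trilinear_form_def)
lemma tri_linear2: "a \<in> Salg s \<Longrightarrow> c \<in> Salg s \<Longrightarrow> linear_on t M (*) (\<lambda>m. tri s t M a m c y)"
  using trilinear_tri[of s t M y] by (simp add: trilinear_form_def)
lemma tri_linear3: "a \<in> Salg s \<Longrightarrow> m \<in> M \<Longrightarrow> linear_on scl (Salg s) (*) (\<lambda>c. tri s t M a m c y)"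
  using trilinear_tri[of s t M y] by (simp add: trilinear_form_def)

lemma linear_on_comp:
  assumes "linear_on s A t f" "f ` A \<subseteq> B" "linear_on t B u g"
  shows "linear_on s A u (\<lambda>x. g (f x))"
  using assms by (auto simp: linear_on_def image_subset_iff)

lemma SMS_left_tri:
  assumes f: "f \<in> Salg s"
  shows "SMS_left s t M f (tri s t M a m c) = tri s t M (smul s f a) m c"
proof -
  have "SMS_left s t M f (tri s t M a m c) = (\<lambda>(a, m, c). tri s t M (smul s f a) m c) (a, m, c)"
    unfolding SMS_left_def
  proof (rule lext_tri, rule trilinear_formI)
    fix y
    show "linear_on scl (Salg s) (*) (\<lambda>a. (case (a, m, c) of (a, m, c) \<Rightarrow> tri s t M (smul s f a) m c) y)"
      if "m \<in> M" "c \<in> Salg s" for m c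
      using linear_on_comp[OF smul_linear_right[OF f] _ tri_linear1[OF that]] smul_closed[OF f] by (auto simp: image_subset_iff)
  qed (simp_all add: smul_closed[OF f] tri_linear2 tri_linear3)
  then show ?thesis by simp
qed

lemma svec_linear: "linear_on s UNIV scl (svec s)"
proof -
  have "linear_on s UNIV (*) (\<lambda>x. svec s x l)" for l
  proof (cases "symmetric_form s l")
    case True
    then have "multilinear_form s UNIV 1 l" by (simp add: symmetric_form_def)
    from this[unfolded multilinear_form_def, rule_format, of "[]" "[]"]
    have "linear_on s UNIV (*) (\<lambda>x. l [x])" by simp
    with True show ?thesis by (simp add: sword_def pure_def)
  qed (simp add: sword_def pure_def linear_on_def)
  then show ?thesis by (simp add: linear_on_def fun_eq_iff scl_def)
qed

lemma alternating_wedge: "alternating_form s p (\<lambda>vs. wedge s p vs l)"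
proof (cases "alternating_form s p l")
  case True
  then show ?thesis by (simp add: wedge_def pure_def)
next
  case False
  then show ?thesis by (simp add: wedge_def pure_def alternating_zero)
qed

lemma alternating_image:
  fixes s :: "'k::field \<Rightarrow> 'v::plus \<Rightarrow> 'v"
  assumes "linear_on scl (Ext s p) (*) F"
  shows "alternating_form s p (\<lambda>vs. F (wedge s p vs))"
  unfolding alternating_form_def multilinear_form_def
proof (intro conjI allI impI)
  fix us vs :: "'v list" assume p: "length us + length vs + 1 = p"
  have W: "wedge s p (us @ [x] @ vs) \<in> Ext s p" for x using p by (intro wedge_Ext) simp
  have ml: "linear_on s UNIV (*) (\<lambda>x. wedge s p (us @ [x] @ vs) l)" for l
    using alternating_wedge[of s p l] p unfolding alternating_form_def multilinear_form_def by auto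
  have "linear_on s UNIV scl (\<lambda>x. wedge s p (us @ [x] @ vs))"
    using ml unfolding linear_on_def by (auto simp: fun_eq_iff scl_def)
  from linear_on_comp[OF this _ assms] W
  show "linear_on s UNIV (*) (\<lambda>x. F (wedge s p (us @ [x] @ vs)))" by (simp add: image_subset_iff)
next
  fix us vs :: "'v list" and x assume p: "length us + length vs + 2 = p"
  have "wedge s p (us @ [x, x] @ vs) l = 0" for l
    using alternating_wedge[of s p l] p unfolding alternating_form_def by auto
  then have "wedge s p (us @ [x, x] @ vs) = scl 0 (wedge s p (us @ [x, x] @ vs))" by (simp add: scl_def fun_eq_iff)
  moreover have "wedge s p (us @ [x, x] @ vs) \<in> Ext s p" using p by (intro wedge_Ext) simp
  ultimately show "F (wedge s p (us @ [x, x] @ vs)) = 0"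
    using assms unfolding linear_on_def by (metis mult_zero_left)
qed

lemma linear_on_diff:
  assumes "linear_on s A (*) f" "linear_on s A (*) g"
  shows "linear_on s A (*) (\<lambda>x. f x - (g x::'k::field))"
  using assms by (simp add: linear_on_def algebra_simps)

lemma sum_apply: "(\<Sum>i\<in>I. f i) x = (\<Sum>i\<in>I. f i x)"
  by (induction I rule: infinite_finite_induct) auto

lemma alternating_kos_d:
  fixes s :: "'k::field \<Rightarrow> 'v::plus \<Rightarrow> 'v"
  assumes a: "a \<in> Salg s" and c: "c \<in> Salg s"
  shows "alternating_form s p (\<lambda>vs. (\<Sum>i<p. scl ((-1) ^ i)
      (ktri s (p - 1) (smul s a (svec s (vs ! i))) (wedge s (p - 1) (omit i vs)) c -
       ktri s (p - 1) a (wedge s (p - 1) (omit i vs)) (smul s (svec s (vs ! i)) c))) y)"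
proof -
  define h where "h v us = ktri s (p - 1) (smul s a (svec s v)) (wedge s (p - 1) us) c y -
    ktri s (p - 1) a (wedge s (p - 1) us) (smul s (svec s v) c) y" for v us
  have sv: "range (svec s) \<subseteq> Salg s" using sword_Salg by blast
  have 1: "linear_on s UNIV scl (\<lambda>v. smul s a (svec s v))"
    by (rule linear_on_comp[OF svec_linear sv smul_linear_right[OF a]])
  have 2: "linear_on s UNIV scl (\<lambda>v. smul s (svec s v) c)"
    by (rule linear_on_comp[OF svec_linear sv smul_linear_left])
  have r1: "range (\<lambda>v. smul s a (svec s v)) \<subseteq> Salg s" and r2: "range (\<lambda>v. smul s (svec s v) c) \<subseteq> Salg s"
    using a c smul_closed sword_Salg by blast+
  have "alternating_form s p (\<lambda>vs. \<Sum>i<p. (-1) ^ i * h (vs ! i) (omit i vs))"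
  proof (rule alternating_koszul)
    fix us :: "'v list" assume "length us = p - 1"
    then have W: "wedge s (p - 1) us \<in> Ext s (p - 1)" by (rule wedge_Ext)
    show "linear_on s UNIV (*) (\<lambda>v. h v us)" unfolding h_def
      by (rule linear_on_diff)
        (rule linear_on_comp[OF 1 r1 tri_linear1[OF W c]] linear_on_comp[OF 2 r2 tri_linear3[OF a W]])+
  next
    fix v
    have "smul s a (svec s v) \<in> Salg s" "smul s (svec s v) c \<in> Salg s" using r1 r2 by auto
    then show "alternating_form s (p - 1) (h v)"
      using a c unfolding h_def
      by (intro alternating_image[where F = "\<lambda>w. ktri s (p - 1) (smul s a (svec s v)) w c y - ktri s (p - 1) a w (smul s (svec s v) c) y"] linear_on_diff tri_linear2)
  qed
  then show ?thesis by (simp add: h_def scl_def sum_apply)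
qed


lemma pure_span_cong:
  assumes "z \<in> fn.span {pure P x | x. Q x}" "P l = P l'" "\<And>x. Q x \<Longrightarrow> l x = l' x"
  shows "z l = z l'"
  using assms(1)
proof (induction rule: pure_span_induct)
  case (step c u z)
  then show ?case by (simp add: pure_def assms(2) assms(3)[OF step(1)])
qed simp

lemma alternating_cong1:
  fixes s :: "'k::field \<Rightarrow> 'v::plus \<Rightarrow> 'v"
  assumes l: "\<And>vs. length vs = p \<Longrightarrow> l vs = l' vs" and alt: "alternating_form s p l"
  shows "alternating_form s p l'"
  unfolding alternating_form_def multilinear_form_def
proof (intro conjI allI impI)
  fix us vs :: "'v list" assume p: "length us + length vs + 1 = p"
  have "(\<lambda>x. l' (us @ [x] @ vs)) = (\<lambda>x. l (us @ [x] @ vs))" using p l by (auto simp: fun_eq_iff)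
  then show "linear_on s UNIV (*) (\<lambda>x. l' (us @ [x] @ vs))"
    using alt p unfolding alternating_form_def multilinear_form_def by simp
next
  fix us vs :: "'v list" and x assume p: "length us + length vs + 2 = p"
  then show "l' (us @ [x, x] @ vs) = 0"
    using alt l[of "us @ [x, x] @ vs"] unfolding alternating_form_def by simp
qed

lemma alternating_cong:
  assumes "\<And>vs. length vs = p \<Longrightarrow> l vs = l' vs"
  shows "alternating_form s p l = alternating_form s p l'"
  using alternating_cong1[of p l l'] alternating_cong1[of p l' l] assms by metis

lemma Ext_form_cong:
  assumes "\<omega> \<in> Ext s p" "\<And>vs. length vs = p \<Longrightarrow> l vs = l' vs"
  shows "\<omega> l = \<omega> l'"
  by (rule pure_span_cong[OF assms(1)[unfolded Ext_alt] alternating_cong assms(2)]) (rule assms(2))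

lemma Ext_form_linear:
  assumes w: "\<omega> \<in> Ext s p" and alt: "\<And>a. a \<in> A \<Longrightarrow> alternating_form s p (f a)"
    and lin: "\<And>vs. length vs = p \<Longrightarrow> linear_on t A (*) (\<lambda>a. f a vs)"
    and A: "\<And>a b. a \<in> A \<Longrightarrow> b \<in> A \<Longrightarrow> a + b \<in> A" "\<And>a c. a \<in> A \<Longrightarrow> t c a \<in> A"
  shows "linear_on t A (*) (\<lambda>a. \<omega> (f a))"
proof (rule linear_on_fieldI)
  fix x y assume xy: "x \<in> A" "y \<in> A"
  have "\<omega> (f (x + y)) = \<omega> (\<lambda>vs. f x vs + f y vs)"
    by (rule Ext_form_cong[OF w]) (use lin xy in \<open>auto simp: linear_on_def\<close>)
  then show "\<omega> (f (x + y)) = \<omega> (f x) + \<omega> (f y)"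
    using Ext_form_add[OF w alt[OF xy(1)] alt[OF xy(2)]] by simp
next
  fix c x assume x: "x \<in> A"
  have "\<omega> (f (t c x)) = \<omega> (\<lambda>vs. c * f x vs)"
    by (rule Ext_form_cong[OF w]) (use lin x in \<open>auto simp: linear_on_def\<close>)
  then show "\<omega> (f (t c x)) = c * \<omega> (f x)"
    using Ext_form_scl[OF w alt[OF x]] by simp
qed

lemma Salg_add: "a \<in> Salg s \<Longrightarrow> b \<in> Salg s \<Longrightarrow> a + b \<in> Salg s"
  using Salg_subspace fn.subspace_add by blast
lemma Salg_scl: "a \<in> Salg s \<Longrightarrow> scl c a \<in> Salg s"
  using Salg_subspace fn.subspace_scale by blast

lemma lext_wedge:
  assumes "\<And>y. alternating_form s p (\<lambda>vs. F vs y)"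
  shows "lext F (wedge s p vs) = F vs"
  unfolding wedge_def by (rule lext_pure) (rule assms)

lemma lext_linear: "linear_on scl A (*) (\<lambda>z. lext F z y)"
  by (simp add: linear_on_def lext_def scl_def)

lemma kos_d_ktri:
  fixes s :: "'k::field \<Rightarrow> 'v::ab_group_add \<Rightarrow> 'v"
  assumes a: "a \<in> Salg s" and c: "c \<in> Salg s"
  shows "kos_d s p (ktri s p a (wedge s p vs) c) = (\<Sum>i<p. scl ((-1) ^ i)
      (ktri s (p - 1) (smul s a (svec s (vs ! i))) (wedge s (p - 1) (omit i vs)) c -
       ktri s (p - 1) a (wedge s (p - 1) (omit i vs)) (smul s (svec s (vs ! i)) c)))"
proof -
  define G where "G a c vs = (\<Sum>i<p. scl ((-1) ^ i)
      (ktri s (p - 1) (smul s a (svec s (vs ! i))) (wedge s (p - 1) (omit i vs)) c -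
       ktri s (p - 1) a (wedge s (p - 1) (omit i vs)) (smul s (svec s (vs ! i)) c)))" for a c vs
  have alt: "alternating_form s p (\<lambda>vs. G a c vs y)" if "a \<in> Salg s" "c \<in> Salg s" for a c y
    unfolding G_def by (rule alternating_kos_d[OF that])
  have W: "wedge s (p - 1) (omit i vs) \<in> Ext s (p - 1)" if "length vs = p" "i < p" for i and vs :: "'v list"
    using that by (intro wedge_Ext) (simp add: length_omit)
  have G_y: "G a c vs y = (\<Sum>i<p. (-1) ^ i *
      (ktri s (p - 1) (smul s a (svec s (vs ! i))) (wedge s (p - 1) (omit i vs)) c y -
       ktri s (p - 1) a (wedge s (p - 1) (omit i vs)) (smul s (svec s (vs ! i)) c) y))" for a c vs y
    by (simp add: G_def sum_apply scl_def)
  have c1: "(\<lambda>a. smul s a (svec s v)) ` Salg s \<subseteq> Salg s" "(\<lambda>a. smul s (svec s v) a) ` Salg s \<subseteq> Salg s" for v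
    using smul_closed sword_Salg by blast+
  have lin_a: "linear_on scl (Salg s) (*) (\<lambda>a. G a c vs y)" if "length vs = p" "c \<in> Salg s" for vs c y
    unfolding G_y
  proof (rule linear_on_sum, rule linear_on_mult, rule linear_on_diff)
    fix i assume "i \<in> {..<p}"
    then have "wedge s (p - 1) (omit i vs) \<in> Ext s (p - 1)" using W that by auto
    note w = this
    show "linear_on scl (Salg s) (*) (\<lambda>a. ktri s (p - 1) (smul s a (svec s (vs ! i))) (wedge s (p - 1) (omit i vs)) c y)"
      by (rule linear_on_comp[OF smul_linear_left c1(1) tri_linear1[OF w that(2)]])
    show "linear_on scl (Salg s) (*) (\<lambda>a. ktri s (p - 1) a (wedge s (p - 1) (omit i vs)) (smul s (svec s (vs ! i)) c) y)"
      by (rule tri_linear1[OF w smul_closed[OF sword_Salg that(2)]])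
  qed
  have lin_c: "linear_on scl (Salg s) (*) (\<lambda>c. G a c vs y)" if "length vs = p" "a \<in> Salg s" for vs a y
    unfolding G_y
  proof (rule linear_on_sum, rule linear_on_mult, rule linear_on_diff)
    fix i assume "i \<in> {..<p}"
    then have "wedge s (p - 1) (omit i vs) \<in> Ext s (p - 1)" using W that by auto
    note w = this
    show "linear_on scl (Salg s) (*) (\<lambda>c. ktri s (p - 1) a (wedge s (p - 1) (omit i vs)) (smul s (svec s (vs ! i)) c) y)"
      by (rule linear_on_comp[OF smul_linear_right[OF sword_Salg] c1(2) tri_linear3[OF that(2) w]])
    show "linear_on scl (Salg s) (*) (\<lambda>c. ktri s (p - 1) (smul s a (svec s (vs ! i))) (wedge s (p - 1) (omit i vs)) c y)"
      by (rule tri_linear3[OF smul_closed[OF that(2) sword_Salg] w])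
  qed
  have "kos_d s p (ktri s p a (wedge s p vs) c) = (\<lambda>(a, \<omega>, c). lext (G a c) \<omega>) (a, wedge s p vs, c)"
    unfolding kos_d_def G_def[symmetric]
  proof (rule lext_tri, rule trilinear_formI)
    fix y :: "(('v list \<Rightarrow> 'k) \<Rightarrow> 'k) \<times> (('v list \<Rightarrow> 'k) \<Rightarrow> 'k) \<times> (('v list \<Rightarrow> 'k) \<Rightarrow> 'k) \<Rightarrow> 'k"
    show "linear_on scl (Salg s) (*) (\<lambda>a. (case (a, \<omega>, c) of (a, \<omega>, c) \<Rightarrow> lext (G a c) \<omega>) y)"
      if "\<omega> \<in> Ext s p" "c \<in> Salg s" for \<omega> c
      unfolding lext_def prod.case
      by (rule Ext_form_linear[OF that(1) alt lin_a]) (simp_all add: that Salg_add Salg_scl)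
    show "linear_on scl (Salg s) (*) (\<lambda>c. (case (a, \<omega>, c) of (a, \<omega>, c) \<Rightarrow> lext (G a c) \<omega>) y)"
      if "a \<in> Salg s" "\<omega> \<in> Ext s p" for \<omega> a
      unfolding lext_def prod.case
      by (rule Ext_form_linear[OF that(2) alt lin_c]) (simp_all add: that Salg_add Salg_scl)
  qed (simp add: lext_linear)
  also have "\<dots> = G a c vs"
    unfolding prod.case by (rule lext_wedge) (rule alt[OF a c])
  finally show ?thesis by (simp add: G_def)
qed


lemma symmetric_multilinear: "symmetric_form s l \<Longrightarrow> multilinear_form s A n l"
proof -
  assume "symmetric_form s l"
  then have "linear_on s UNIV (*) (\<lambda>x. l (us @ [x] @ vs))" for us vs
    by (auto simp: symmetric_form_def multilinear_form_def)
  then show ?thesis by (simp add: multilinear_form_def linear_on_def)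
qed

lemma symmetric_sword: "symmetric_form s (\<lambda>vs. sword s vs l)"
  by (cases "symmetric_form s l") (simp_all add: sword_def pure_def symmetric_zero)

lemma proj_TS_tword: "proj_TS s (tword s vs) = sword s vs"
  unfolding proj_TS_def tword_def
  by (rule lext_pure) (use symmetric_multilinear[OF symmetric_sword] in blast)

lemma tmul_tword: "tmul s (tword s xs) (tword s ys) = tword s (xs @ ys)"
proof -
  have ml: "\<forall>n. multilinear_form s UNIV n (\<lambda>vs. tword s vs l)" for l
  proof (cases "\<forall>n. multilinear_form s UNIV n l")
    case True
    then have "(\<lambda>vs. tword s vs l) = l" by (simp add: tword_def pure_def)
    then show ?thesis using True by simp
  next
    case False
    then have "(\<lambda>vs. tword s vs l) = (\<lambda>_. 0)" by (auto simp: tword_def pure_def fun_eq_iff)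
    then show ?thesis by (simp add: multilinear_zero)
  qed
  have 1: "lext (\<lambda>ys. tword s (xs @ ys)) (tword s ys) = tword s (xs @ ys)" for xs
    by (subst (2) tword_def, rule lext_pure, rule multilinear_append[OF ml])
  have "multilinear_form s UNIV n (\<lambda>xs. tword s (xs @ ys) l)" for n l
    unfolding multilinear_form_def
  proof (intro allI impI)
    fix us vs
    have "linear_on s UNIV (*) (\<lambda>x. tword s (us @ [x] @ (vs @ ys)) l)"
      using ml unfolding multilinear_form_def by blast
    then show "linear_on s UNIV (*) (\<lambda>x. tword s ((us @ [x] @ vs) @ ys) l)" by simp
  qed
  then show ?thesis
    unfolding tmul_def 1 by (subst (2) tword_def) (rule lext_pure, blast)
qed

lemma multilinear_map:
  fixes s :: "'k::field \<Rightarrow> 'v::plus \<Rightarrow> 'v"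
  assumes "linear_on s UNIV s f" "multilinear_form s UNIV n l"
  shows "multilinear_form s UNIV n (\<lambda>vs. l (map f vs))"
  unfolding multilinear_form_def
proof (intro allI impI)
  fix us vs :: "'v list" assume "length us + length vs + 1 = n"
  then have "linear_on s UNIV (*) (\<lambda>x. l (map f us @ [x] @ map f vs))"
    using assms(2) unfolding multilinear_form_def by simp
  from linear_on_comp[OF assms(1) _ this]
  show "linear_on s UNIV (*) (\<lambda>x. l (map f (us @ [x] @ vs)))" by simp
qed

lemma Sact_form:
  assumes "linear_on s UNIV s (\<rho> g)"
  shows "symmetric_form s (\<lambda>vs. sword s (map (\<rho> g) vs) l)"
proof -
  have "symmetric_form s (\<lambda>vs. sword s vs l)" by (rule symmetric_sword)
  then show ?thesis unfolding symmetric_form_def using multilinear_map[OF assms] by auto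
qed

lemma Sact_sword:
  "linear_on s UNIV s (\<rho> g) \<Longrightarrow> Sact s \<rho> g (sword s vs) = sword s (map (\<rho> g) vs)"
  unfolding Sact_def by (subst (2) sword_def) (rule lext_pure, rule Sact_form)

lemma Sact_closed:
  "linear_on s UNIV s (\<rho> g) \<Longrightarrow> f \<in> Salg s \<Longrightarrow> Sact s \<rho> g f \<in> Salg s"
  unfolding Sact_def
  by (rule lext_pure_span[of _ f "symmetric_form s" "\<lambda>_. True"])
    (simp_all add: Salg_subspace Salg_alt[symmetric, simplified] sword_Salg Sact_form)

lemma Sact_linear: "linear_on scl A scl (Sact s \<rho> g)"
  by (simp add: linear_on_def Sact_def lext_add lext_scl)

lemma Eact_form:
  assumes "linear_on s UNIV s (\<rho> g)"
  shows "alternating_form s p (\<lambda>vs. wedge s p (map (\<rho> g) vs) l)"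
proof -
  have "alternating_form s p (\<lambda>vs. wedge s p vs l)" by (rule alternating_wedge)
  then show ?thesis unfolding alternating_form_def using multilinear_map[OF assms] by auto
qed

lemma Eact_wedge:
  "linear_on s UNIV s (\<rho> g) \<Longrightarrow> Eact s \<rho> p g (wedge s p vs) = wedge s p (map (\<rho> g) vs)"
  unfolding Eact_def by (rule lext_wedge) (rule Eact_form)

lemma Eact_closed:
  "linear_on s UNIV s (\<rho> g) \<Longrightarrow> w \<in> Ext s p \<Longrightarrow> Eact s \<rho> p g w \<in> Ext s p"
  unfolding Eact_def
  by (rule lext_pure_span[of _ w "alternating_form s p" "\<lambda>vs. length vs = p"])
    (auto simp: Ext_subspace Ext_alt[symmetric] wedge_Ext Eact_form)

lemma Eact_linear: "linear_on scl A scl (Eact s \<rho> p g)"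
  by (simp add: linear_on_def Eact_def lext_add lext_scl)

lemma SMS_right_tri:
  assumes f: "f \<in> Salg s"
  shows "SMS_right s t M (tri s t M a m c) f = tri s t M a m (smul s c f)"
proof -
  have 1: "smul s c f \<in> Salg s" if "c \<in> Salg s" for c using smul_closed that f by blast
  have "SMS_right s t M (tri s t M a m c) f = (\<lambda>(a, m, c). tri s t M a m (smul s c f)) (a, m, c)"
    unfolding SMS_right_def
  proof (rule lext_tri, rule trilinear_formI)
    fix y
    show "linear_on scl (Salg s) (*) (\<lambda>c. (case (a, m, c) of (a, m, c) \<Rightarrow> tri s t M a m (smul s c f)) y)"
      if "a \<in> Salg s" "m \<in> M" for a m
      using linear_on_comp[OF smul_linear_left _ tri_linear3[OF that]] 1 by (auto simp: image_subset_iff)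
  qed (simp_all add: 1 tri_linear1 tri_linear2)
  then show ?thesis by simp
qed

lemma kos_act_ktri:
  assumes r: "linear_on s UNIV s (\<rho> g)"
  shows "kos_act s \<rho> p g (ktri s p a w c) = ktri s p (Sact s \<rho> g a) (Eact s \<rho> p g w) (Sact s \<rho> g c)"
proof -
  have S: "Sact s \<rho> g ` Salg s \<subseteq> Salg s" and E: "Eact s \<rho> p g ` Ext s p \<subseteq> Ext s p"
    using Sact_closed[of s \<rho> g, OF r] Eact_closed[of s \<rho> g, OF r] by blast+
  have "kos_act s \<rho> p g (ktri s p a w c) =
      (\<lambda>(a, \<omega>, c). ktri s p (Sact s \<rho> g a) (Eact s \<rho> p g \<omega>) (Sact s \<rho> g c)) (a, w, c)"
    unfolding kos_act_def
  proof (rule lext_tri, rule trilinear_formI, unfold prod.case)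
    fix y
    show "linear_on scl (Salg s) (*) (\<lambda>a. ktri s p (Sact s \<rho> g a) (Eact s \<rho> p g m) (Sact s \<rho> g c) y)"
      if "m \<in> Ext s p" "c \<in> Salg s" for m c
      by (rule linear_on_comp[OF Sact_linear S tri_linear1]) (use that S E in auto)
    show "linear_on scl (Salg s) (*) (\<lambda>c. ktri s p (Sact s \<rho> g a) (Eact s \<rho> p g m) (Sact s \<rho> g c) y)"
      if "a \<in> Salg s" "m \<in> Ext s p" for m a
      by (rule linear_on_comp[OF Sact_linear S tri_linear3]) (use that S E in auto)
    show "linear_on scl (Ext s p) (*) (\<lambda>m. ktri s p (Sact s \<rho> g a) (Eact s \<rho> p g m) (Sact s \<rho> g c) y)"
      if "a \<in> Salg s" "c \<in> Salg s" for a c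
      by (rule linear_on_comp[OF Eact_linear E tri_linear2]) (use that S in auto)
  qed
  then show ?thesis by simp
qed

lemma linear_on_apply: "linear_on t A scl f \<Longrightarrow> linear_on t A (*) (\<lambda>x. f x y)"
  by (simp add: linear_on_def scl_def)

lemma kos_aug_ktri:
  assumes a: "a \<in> Salg s" and c: "c \<in> Salg s"
  shows "kos_aug s (ktri s 0 a (wedge s 0 []) c) = smul s a c"
proof -
  have alt: "alternating_form s 0 (\<lambda>vs. q)" for q
    by (simp add: alternating_form_def multilinear_form_def)
  have "kos_aug s (ktri s 0 a (wedge s 0 []) c) =
      (\<lambda>(a, \<omega>, c). lext (\<lambda>vs. smul s a c) \<omega>) (a, wedge s 0 [], c)"
    unfolding kos_aug_def
  proof (rule lext_tri, rule trilinear_formI, unfold prod.case)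
    fix y
    show "linear_on scl (Salg s) (*) (\<lambda>a. lext (\<lambda>vs. smul s a c) m y)"
      if "m \<in> Ext s 0" "c \<in> Salg s" for m c
      unfolding lext_def
      by (rule Ext_form_linear[OF that(1) alt linear_on_apply[OF smul_linear_left]]) (auto simp: Salg_add Salg_scl)
    show "linear_on scl (Salg s) (*) (\<lambda>c. lext (\<lambda>vs. smul s a c) m y)"
      if "a \<in> Salg s" "m \<in> Ext s 0" for m a
      unfolding lext_def
      by (rule Ext_form_linear[OF that(2) alt linear_on_apply[OF smul_linear_right[OF that(1)]]]) (auto simp: Salg_add Salg_scl)
    show "linear_on scl (Ext s 0) (*) (\<lambda>m. lext (\<lambda>vs. smul s a c) m y)" for a c
      by (rule lext_linear)
  qed
  also have "\<dots> = smul s a c"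
    unfolding prod.case by (rule lext_wedge) (rule alt)
  finally show ?thesis .
qed

lemma component_rtimes: "component (rtimes m g) h = (if h = g then m else 0)"
  by (simp add: component_def rtimes_def fun_eq_iff)

lemma smul_0_left: "smul s 0 g = 0"
  by (simp add: smul_def lext_def fun_eq_iff)
lemma Salg_0: "0 \<in> Salg s" using Salg_subspace fn.subspace_0 by blast
lemma smul_0_right: "f \<in> Salg s \<Longrightarrow> smul s f 0 = 0"
  using smul_linear_right[of f s] Salg_0[of s] unfolding linear_on_def by (metis fn.scale_zero_left)
lemma Sact_0: "Sact s \<rho> g 0 = 0"
  by (simp add: Sact_def lext_def fun_eq_iff)
lemma rtimes_0: "rtimes 0 g = 0"
  by (simp add: rtimes_def fun_eq_iff)

lemma SG_mul_rtimes:
  fixes s :: "'k::field \<Rightarrow> 'v::ab_group_add \<Rightarrow> 'v" and g h :: "'g::{finite,group_add}"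
  assumes a: "a \<in> Salg s"
  shows "SG_mul s \<rho> (rtimes a g) (rtimes b h) = rtimes (smul s a (Sact s \<rho> g b)) (g + h)"
proof -
  have "SG_mul s \<rho> (rtimes a g) (rtimes b h) = (\<Sum>g'\<in>UNIV. \<Sum>h'\<in>UNIV.
      if h' = h then (if g' = g then rtimes (smul s a (Sact s \<rho> g b)) (g + h) else 0) else 0)"
    unfolding SG_mul_def
    by (intro sum.cong refl) (auto simp: component_rtimes smul_0_left smul_0_right[OF a] Sact_0 rtimes_0)
  then show ?thesis by simp
qed

lemma rtimes_add: "rtimes (a + b) g = rtimes a g + rtimes b g" for a b :: "_ \<Rightarrow> 'k::field"
  by (auto simp: rtimes_def fun_eq_iff)
lemma rtimes_scl: "rtimes (scl c a) g = scl c (rtimes a g)"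
  by (auto simp: rtimes_def fun_eq_iff scl_def)
lemma rtimes_linear: "linear_on scl A scl (\<lambda>a. rtimes a g)"
  by (simp add: linear_on_def rtimes_add rtimes_scl)
lemma component_add: "component (x + y) g = component x g + component y g" for x y :: "_ \<Rightarrow> 'k::field"
  by (simp add: component_def fun_eq_iff)
lemma component_scl: "component (scl c x) g = scl c (component x g)"
  by (simp add: component_def fun_eq_iff scl_def)

lemma SG_mul_linear_left: "linear_on scl A scl (\<lambda>a. SG_mul s \<rho> a b)"
  using smul_linear_left[of UNIV s]
  by (simp add: linear_on_def SG_mul_def component_add component_scl rtimes_add rtimes_scl sum.distrib fn.scale_sum_right)

lemma SG_mul_linear_right:
  assumes r: "\<And>g. linear_on s UNIV s (\<rho> g)" and a: "a \<in> SG s"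
  shows "linear_on scl (SG s) scl (SG_mul s \<rho> a)"
proof -
  have c: "component x g \<in> Salg s" if "x \<in> SG s" for x :: "'a \<times> _ \<Rightarrow> _" and g
    using that by (simp add: SG_def Rtimes_def)
  have *: "smul s (component a g) (Sact s \<rho> g (x + y)) = smul s (component a g) (Sact s \<rho> g x) + smul s (component a g) (Sact s \<rho> g y)"
    "smul s (component a g) (Sact s \<rho> g (scl q x)) = scl q (smul s (component a g) (Sact s \<rho> g x))"
    if "x \<in> Salg s" "y \<in> Salg s" for x y q g
    using smul_linear_right[OF c[OF a, of g]] Sact_closed[of s \<rho> g, OF r] Sact_linear[of UNIV s \<rho> g] that
    unfolding linear_on_def by auto
  show ?thesis
    by (rule linear_on_fieldI)
      (simp_all add: SG_mul_def component_add component_scl *(1) *(2)[OF _ Salg_0] c rtimes_add rtimes_scl sum.distrib fn.scale_sum_right)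
qed

lemma Rtimes_subspace: "fn.subspace M \<Longrightarrow> fn.subspace (Rtimes M)"
  by (rule fn.subspaceI)
    (simp_all add: Rtimes_def component_add component_scl fn.subspace_add fn.subspace_scale,
     simp add: component_def fn.subspace_0[unfolded zero_fun_def])

lemma rtimes_SG: "a \<in> Salg s \<Longrightarrow> rtimes a g \<in> SG s"
  by (simp add: SG_def Rtimes_def component_rtimes Salg_0)

lemma SG_mul_closed:
  assumes r: "\<And>g. linear_on s UNIV s (\<rho> g)" and x: "x \<in> SG s" and y: "y \<in> SG s"
  shows "SG_mul s \<rho> x y \<in> SG s"
proof -
  have S: "fn.subspace (SG s)" unfolding SG_def by (rule Rtimes_subspace[OF Salg_subspace])
  have c: "component x g \<in> Salg s" "component y g \<in> Salg s" for g
    using x y by (simp_all add: SG_def Rtimes_def)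
  show ?thesis unfolding SG_mul_def
    by (intro fn.subspace_sum[OF S] rtimes_SG smul_closed Sact_closed[of s \<rho>, OF r] c)
qed

lemma kos_ext_rtimes:
  fixes s :: "'k::field \<Rightarrow> 'v::ab_group_add \<Rightarrow> 'v" and g :: "'g::{finite,group_add}"
  assumes r: "\<And>g. linear_on s UNIV s (\<rho> g)" and phi: "linear_on scl (Ext s p) scl \<phi>" "\<phi> ` Ext s p \<subseteq> SG s"
  shows "kos_ext s \<rho> \<phi> (rtimes (ktri s p a w c) g) =
    SG_mul s \<rho> (SG_mul s \<rho> (rtimes a 0) (\<phi> w)) (rtimes c g)"
proof -
  note R = rtimes_SG and SG = SG_mul_closed[of s \<rho>, OF r]
  have "kos_ext s \<rho> \<phi> (rtimes (ktri s p a w c) g) = (\<Sum>g'\<in>UNIV. if g' = g then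
     lext (\<lambda>(a, \<omega>, c). SG_mul s \<rho> (SG_mul s \<rho> (rtimes a 0) (\<phi> \<omega>)) (rtimes c g)) (ktri s p a w c) else 0)"
    unfolding kos_ext_def by (intro sum.cong refl) (auto simp: component_rtimes lext_def fun_eq_iff)
  also have "\<dots> = (\<lambda>(a, \<omega>, c). SG_mul s \<rho> (SG_mul s \<rho> (rtimes a 0) (\<phi> \<omega>)) (rtimes c g)) (a, w, c)"
    unfolding sum.delta[OF finite_class.finite_UNIV] if_P[OF UNIV_I]
  proof (rule lext_tri, rule trilinear_formI, unfold prod.case)
    fix y
    show "linear_on scl (Salg s) (*) (\<lambda>a. SG_mul s \<rho> (SG_mul s \<rho> (rtimes a 0) (\<phi> m)) (rtimes c g) y)" for m c
      by (rule linear_on_apply, rule linear_on_comp[OF linear_on_comp[OF rtimes_linear _ SG_mul_linear_left] _ SG_mul_linear_left])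
        (rule subset_UNIV)+
    show "linear_on scl (Salg s) (*) (\<lambda>c. SG_mul s \<rho> (SG_mul s \<rho> (rtimes a 0) (\<phi> m)) (rtimes c g) y)"
      if "a \<in> Salg s" "m \<in> Ext s p" for a m
      by (rule linear_on_apply, rule linear_on_comp[OF rtimes_linear _ SG_mul_linear_right[OF r]])
        (use that R phi in \<open>auto intro!: SG\<close>)
    show "linear_on scl (Ext s p) (*) (\<lambda>m. SG_mul s \<rho> (SG_mul s \<rho> (rtimes a 0) (\<phi> m)) (rtimes c g) y)"
      if "a \<in> Salg s" for a c
      by (rule linear_on_apply, rule linear_on_comp[OF linear_on_comp[OF phi SG_mul_linear_right[OF r]] _ SG_mul_linear_left])
        (use that R in auto)
  qed
  finally show ?thesis by simp
qed


lemma tpow_linear: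
  assumes f: "linear_on t A' s f" "f ` A' \<subseteq> A" and uv: "set us \<subseteq> A" "set vs \<subseteq> A" "length us + length vs + 1 = n"
  shows "linear_on t A' (*) (\<lambda>x. tpow s A n (us @ [f x] @ vs) l)"
proof (cases "multilinear_form s A n l")
  case True
  then have "linear_on s A (*) (\<lambda>x. l (us @ [x] @ vs))"
    using uv unfolding multilinear_form_def by blast
  from linear_on_comp[OF f this] True show ?thesis by (simp add: tpow_def pure_def)
qed (simp add: tpow_def pure_def linear_on_def)

lemma linear_on_ident: "linear_on s A s (\<lambda>x. x)" by (simp add: linear_on_def)

lemma lext_tpow:
  assumes "\<And>us vs y. set us \<subseteq> A \<Longrightarrow> set vs \<subseteq> A \<Longrightarrow> length us + length vs + 1 = n \<Longrightarrow>
    linear_on s A (*) (\<lambda>x. F (us @ [x] @ vs) y)"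
  shows "lext F (tpow s A n bs) = F bs"
  unfolding tpow_def
  by (rule lext_pure, unfold multilinear_form_def, intro allI impI, rule assms)

lemma to_hoch_btens:
  fixes s :: "'k::field \<Rightarrow> 'v::ab_group_add \<Rightarrow> 'v" and \<rho> :: "'g::{finite,group_add} \<Rightarrow> 'v \<Rightarrow> 'v"
    and \<theta> :: "nat \<Rightarrow> ((('g \<times> ('v list \<Rightarrow> 'k) \<Rightarrow> 'k) list \<Rightarrow> 'k) \<Rightarrow> 'k) \<Rightarrow> _"
  shows
  "to_hoch s \<rho> \<theta> p \<phi> (btens s p bs) = kos_ext s \<rho> \<phi> (\<theta> p (btens s (p + 2) (SG_one s # bs @ [SG_one s])))"
proof -
  have one: "(SG_one s :: 'g \<times> ('v list \<Rightarrow> 'k) \<Rightarrow> 'k) \<in> SG s" by (rule rtimes_SG[OF sword_Salg])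
  have "lext (\<lambda>bs. btens s (p + 2) (SG_one s # bs @ [SG_one s])) (btens s p bs) =
      btens s (p + 2) ((SG_one s :: 'g \<times> ('v list \<Rightarrow> 'k) \<Rightarrow> 'k) # bs @ [SG_one s])"
  proof (rule lext_tpow)
    fix us vs :: "('g \<times> ('v list \<Rightarrow> 'k) \<Rightarrow> 'k) list" and y assume a: "set us \<subseteq> SG s" "set vs \<subseteq> SG s" "length us + length vs + 1 = p"
    show "linear_on scl (SG s) (*) (\<lambda>x. btens s (p + 2) (SG_one s # (us @ [x] @ vs) @ [SG_one s]) y)"
      using tpow_linear[OF linear_on_ident, where us = "SG_one s # us" and vs = "vs @ [SG_one s]"
          and A = "SG s" and A' = "SG s" and n = "p + 2" and s = scl and l = y] a one by auto
  qed
  then show ?thesis by (simp add: to_hoch_def)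
qed

lemma gerst_bracket_btens:
  fixes s :: "'k::field \<Rightarrow> 'v::ab_group_add \<Rightarrow> 'v"
    and \<delta> :: "('g \<times> ('v list \<Rightarrow> 'k) \<Rightarrow> 'k) \<Rightarrow> 'g \<times> ('v list \<Rightarrow> 'k) \<Rightarrow> 'k"
  assumes d: "linear_on scl (SG s) scl \<delta>" "\<delta> ` SG s \<subseteq> SG s"
  shows "gerst_bracket s n \<delta> c (btens s n bs) =
    \<delta> (c (btens s n bs)) - c (\<Sum>j<n. btens s n (bs[j := \<delta> (bs ! j)]))"
proof -
  have "lext (\<lambda>bs. \<Sum>j<n. btens s n (bs[j := \<delta> (bs ! j)])) (btens s n bs) =
      (\<Sum>j<n. btens s n (bs[j := \<delta> (bs ! j)]))"
  proof (rule lext_tpow, unfold sum_apply, rule linear_on_sum)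
    fix us vs :: "('g \<times> ('v list \<Rightarrow> 'k) \<Rightarrow> 'k) list" and y j assume a: "set us \<subseteq> SG s" "set vs \<subseteq> SG s" "length us + length vs + 1 = n" and "j \<in> {..<n}"
    consider "j < length us" | "j = length us" | i where "j = length us + 1 + i" "i < length vs"
    proof -
      have "j < length us \<or> j = length us \<or> length us < j" by arith
      moreover have "j = length us + 1 + (j - length us - 1)" "j - length us - 1 < length vs" if "length us < j"
        using that a(3) \<open>j \<in> {..<n}\<close> by auto
      ultimately show thesis using that by metis
    qed
    then show "linear_on scl (SG s) (*) (\<lambda>x. btens s n ((us @ [x] @ vs)[j := \<delta> ((us @ [x] @ vs) ! j)]) y)"
    proof cases
      case 1
      have "\<delta> (us ! j) \<in> SG s" using a(1) d(2) nth_mem[OF 1] by blast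
      then have "set (us[j := \<delta> (us ! j)]) \<subseteq> SG s" using a(1) set_update_subset_insert[of us j "\<delta> (us ! j)"] by auto
      from tpow_linear[OF linear_on_ident _ this a(2), where n = n and A' = "SG s" and s = scl and l = y] 1 a
      show ?thesis by (simp add: list_update_append nth_append)
    next
      case 2
      with tpow_linear[OF d a] show ?thesis by simp
    next
      case 3
      have "\<delta> (vs ! i) \<in> SG s" using a(2) d(2) nth_mem[OF 3(2)] by blast
      then have "set (vs[i := \<delta> (vs ! i)]) \<subseteq> SG s" using a(2) set_update_subset_insert[of vs i "\<delta> (vs ! i)"] by auto
      from tpow_linear[OF linear_on_ident _ a(1) this, where n = n and A' = "SG s" and s = scl and l = y] 3 a
      show ?thesis by (simp add: list_update_append nth_append)
    qed
  qed
  then show ?thesis by (simp add: gerst_bracket_def)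
qed

lemma bar_left_btens:
  fixes s :: "'k::field \<Rightarrow> 'v::ab_group_add \<Rightarrow> 'v" and \<rho> :: "'g::{finite,group_add} \<Rightarrow> 'v \<Rightarrow> 'v"
  assumes r: "\<And>g. linear_on s UNIV s (\<rho> g)" and b: "b \<in> SG s"
  shows "bar_left s \<rho> n b (btens s (n + 2) bs) = btens s (n + 2) (SG_mul s \<rho> b (hd bs) # tl bs)"
  unfolding bar_left_def
proof (rule lext_tpow)
  note cl = SG_mul_closed[of s \<rho>, OF r b]
  fix us vs :: "('g \<times> ('v list \<Rightarrow> 'k) \<Rightarrow> 'k) list" and y assume a: "set us \<subseteq> SG s" "set vs \<subseteq> SG s" "length us + length vs + 1 = n + 2"
  show "linear_on scl (SG s) (*) (\<lambda>x. btens s (n + 2) (SG_mul s \<rho> b (hd (us @ [x] @ vs)) # tl (us @ [x] @ vs)) y)"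
  proof (cases us)
    case Nil
    have "SG_mul s \<rho> b ` SG s \<subseteq> SG s" using cl by auto
    from tpow_linear[OF SG_mul_linear_right[of s \<rho>, OF r b] this _ a(2), where us = "[]" and l = y and n = "n + 2"] a Nil
    show ?thesis by simp
  next
    case (Cons u us')
    then have "set (SG_mul s \<rho> b u # us') \<subseteq> SG s" using a cl by auto
    from tpow_linear[OF linear_on_ident _ this a(2), where n = "n + 2" and A' = "SG s" and s = scl and l = y] a Cons
    show ?thesis by simp
  qed
qed

lemma bar_right_btens:
  fixes s :: "'k::field \<Rightarrow> 'v::ab_group_add \<Rightarrow> 'v" and \<rho> :: "'g::{finite,group_add} \<Rightarrow> 'v \<Rightarrow> 'v"
  assumes r: "\<And>g. linear_on s UNIV s (\<rho> g)" and b: "b \<in> SG s"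
  shows "bar_right s \<rho> n (btens s (n + 2) bs) b = btens s (n + 2) (butlast bs @ [SG_mul s \<rho> (last bs) b])"
  unfolding bar_right_def
proof (rule lext_tpow)
  have cl: "SG_mul s \<rho> x b \<in> SG s" if "x \<in> SG s" for x by (rule SG_mul_closed[of s \<rho>, OF r that b])
  fix us vs :: "('g \<times> ('v list \<Rightarrow> 'k) \<Rightarrow> 'k) list" and y assume a: "set us \<subseteq> SG s" "set vs \<subseteq> SG s" "length us + length vs + 1 = n + 2"
  show "linear_on scl (SG s) (*)
    (\<lambda>x. btens s (n + 2) (butlast (us @ [x] @ vs) @ [SG_mul s \<rho> (last (us @ [x] @ vs)) b]) y)"
  proof (cases vs rule: rev_cases)
    case Nil
    have "(\<lambda>x. SG_mul s \<rho> x b) ` SG s \<subseteq> SG s" using cl by auto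
    from tpow_linear[OF SG_mul_linear_left[of "SG s" s \<rho> b] this a(1), where vs = "[]" and l = y and n = "n + 2"] a Nil
    show ?thesis by simp
  next
    case (snoc vs' u)
    then have "set (vs' @ [SG_mul s \<rho> u b]) \<subseteq> SG s" using a cl by auto
    from tpow_linear[OF linear_on_ident _ a(1) this, where n = "n + 2" and A' = "SG s" and s = scl and l = y] a snoc
    show ?thesis by (simp add: butlast_append)
  qed
qed

lemma merge_linear:
  fixes s :: "'k::field \<Rightarrow> 'v::ab_group_add \<Rightarrow> 'v" and \<rho> :: "'g::{finite,group_add} \<Rightarrow> 'v \<Rightarrow> 'v"
  assumes r: "\<And>g. linear_on s UNIV s (\<rho> g)" and a: "set us \<subseteq> SG s" "set vs \<subseteq> SG s"
    and n: "length us + length vs = n" and i: "i < n"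
  shows "linear_on scl (SG s) (*) (\<lambda>x. btens s n (merge_at (SG_mul s \<rho>) i (us @ [x] @ vs)) y)"
proof -
  have cl: "SG_mul s \<rho> x z \<in> SG s" if "x \<in> SG s" "z \<in> SG s" for x z
    by (rule SG_mul_closed[of s \<rho>, OF r that])
  consider "Suc i < length us" | "Suc i = length us" | "i = length us" "vs \<noteq> []"
    | j where "i = length us + 1 + j" "Suc j < length vs"
  proof -
    have "Suc i < length us \<or> Suc i = length us \<or> i = length us \<or> length us < i" by arith
    moreover have "vs \<noteq> []" if "i = length us" using that i n by auto
    moreover have "i = length us + 1 + (i - length us - 1)" "Suc (i - length us - 1) < length vs" if "length us < i"
      using that i n by auto
    ultimately show thesis using that by metis
  qed
  then show ?thesis
  proof cases
    case 1
    let ?us = "take i us @ [SG_mul s \<rho> (us ! i) (us ! Suc i)] @ drop (i + 2) us"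
    have "us ! i \<in> SG s" "us ! Suc i \<in> SG s" using 1 a nth_mem[of i us] nth_mem[of "Suc i" us] by auto
    then have "set ?us \<subseteq> SG s" using a cl set_take_subset[of i us] set_drop_subset[of "i + 2" us] by auto
    from tpow_linear[OF linear_on_ident _ this a(2), where n = n and A' = "SG s" and s = scl and l = y] 1 n
    show ?thesis by (simp add: merge_at_def nth_append)
  next
    case 2
    then obtain us' u where us: "us = us' @ [u]" "i = length us'" by (cases us rule: rev_cases) auto
    have u: "u \<in> SG s" "set us' \<subseteq> SG s" using a us by auto
    then have "SG_mul s \<rho> u ` SG s \<subseteq> SG s" using cl by auto
    from tpow_linear[OF SG_mul_linear_right[of s \<rho>, OF r u(1)] this u(2) a(2), where n = n and l = y] us n
    show ?thesis by (simp add: merge_at_def nth_append)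
  next
    case 3
    then obtain v vs' where vs: "vs = v # vs'" by (cases vs) auto
    have v: "v \<in> SG s" "set vs' \<subseteq> SG s" using a vs by auto
    then have "(\<lambda>x. SG_mul s \<rho> x v) ` SG s \<subseteq> SG s" using cl by auto
    from tpow_linear[OF SG_mul_linear_left[of "SG s" s \<rho> v] this a(1) v(2), where n = n and l = y] vs n 3
    show ?thesis by (simp add: merge_at_def nth_append)
  next
    case 4
    let ?vs = "take j vs @ [SG_mul s \<rho> (vs ! j) (vs ! Suc j)] @ drop (j + 2) vs"
    have "vs ! j \<in> SG s" "vs ! Suc j \<in> SG s" using 4 a nth_mem[of j vs] nth_mem[of "Suc j" vs] by auto
    then have "set ?vs \<subseteq> SG s" using a cl set_take_subset[of j vs] set_drop_subset[of "j + 2" vs] by auto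
    from tpow_linear[OF linear_on_ident _ a(1) this, where n = n and A' = "SG s" and s = scl and l = y] 4 n
    have lin: "linear_on scl (SG s) (*) (\<lambda>x. btens s n (us @ [x] @ ?vs) y)" by simp
    have "merge_at (SG_mul s \<rho>) i ((us @ [x]) @ vs) = us @ [x] @ ?vs" for x
      unfolding merge_at_def take_append drop_append nth_append using 4 by simp
    with lin show ?thesis by simp
  qed
qed

lemma bar_d_btens:
  fixes s :: "'k::field \<Rightarrow> 'v::ab_group_add \<Rightarrow> 'v" and \<rho> :: "'g::{finite,group_add} \<Rightarrow> 'v \<Rightarrow> 'v"
  assumes r: "\<And>g. linear_on s UNIV s (\<rho> g)"
  shows "bar_d s \<rho> n (btens s (n + 2) bs) =
    (\<Sum>i<n + 1. scl ((-1) ^ i) (btens s (n + 1) (merge_at (SG_mul s \<rho>) i bs)))"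
  unfolding bar_d_def
proof (rule lext_tpow, unfold sum_apply scl_def[of _ "btens _ _ _"], rule linear_on_sum, rule linear_on_mult)
  fix us vs :: "('g \<times> ('v list \<Rightarrow> 'k) \<Rightarrow> 'k) list" and y i assume "set us \<subseteq> SG s" "set vs \<subseteq> SG s" "length us + length vs + 1 = n + 2" "i \<in> {..<n + 1}"
  then show "linear_on scl (SG s) (*) (\<lambda>x. btens s (n + 1) (merge_at (SG_mul s \<rho>) i (us @ [x] @ vs)) y)"
    by (intro merge_linear[of s \<rho>, OF r]) auto
qed

lemma bar_aug_btens:
  fixes s :: "'k::field \<Rightarrow> 'v::ab_group_add \<Rightarrow> 'v" and \<rho> :: "'g::{finite,group_add} \<Rightarrow> 'v \<Rightarrow> 'v"
  assumes r: "\<And>g. linear_on s UNIV s (\<rho> g)"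
  shows "bar_aug s \<rho> (btens s 2 [a, b]) = SG_mul s \<rho> a b"
proof -
  have "bar_aug s \<rho> (btens s 2 [a, b]) = (\<lambda>bs. SG_mul s \<rho> (bs ! 0) (bs ! 1)) [a, b]"
    unfolding bar_aug_def
  proof (rule lext_tpow)
    fix us vs :: "('g \<times> ('v list \<Rightarrow> 'k) \<Rightarrow> 'k) list" and y assume a: "set us \<subseteq> SG s" "set vs \<subseteq> SG s" "length us + length vs + 1 = 2"
    then consider v where "us = []" "vs = [v]" | u where "us = [u]" "vs = []"
      by (cases us) (auto simp: length_Suc_conv numeral_2_eq_2)
    then show "linear_on scl (SG s) (*) (\<lambda>x. SG_mul s \<rho> ((us @ [x] @ vs) ! 0) ((us @ [x] @ vs) ! 1) y)"
    proof cases
      case 1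
      then show ?thesis using linear_on_apply[OF SG_mul_linear_left[of "SG s" s \<rho>]] by simp
    next
      case 2
      then show ?thesis using a linear_on_apply[OF SG_mul_linear_right[of s \<rho>, OF r]] by simp
    qed
  qed
  then show ?thesis by simp
qed

end

theory Submission
  imports Defs
begin

text \<open>
  The map \<open>a \<otimes> w \<otimes> c \<mapsto> rbar(a) \<otimes> w \<otimes> c + a \<nabla>(w) c + a \<otimes> w \<otimes> rbar(c)\<close>, with \<open>\<nabla>\<close> the prescribed
  formula, commutes with the Koszul differential because \<open>D(t)\<close> becomes \<open>\<pi>(t) \<otimes> 1 - 1 \<otimes> \<pi>(t)\<close> when its
  middle factor is moved to the left, minus moved to the right.  Equivariance extends it to the
  smash product.

  Let \<open>\<theta>\<close> be a comparison from the bar resolution and \<open>\<delta>\<^sup>B\<close> the obvious lifting of \<open>\<delta>\<close> to the latter.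
  Then \<open>\<delta>\<^sub>\<bullet>\<theta> - \<theta>\<delta>\<^sup>B\<close> is a morphism of complexes of bimodules over \<open>0\<close>, hence null-homotopic, since
  the bar resolution is free and \<open>K \<rtimes> G\<close> is exact.  Composing a null-homotopy with a cocycle gives
  the cochain whose coboundary is the difference of the two brackets.

  Exactness of the Koszul complex in any characteristic comes from one homotopy for each basis
  vector, built from divided differences.
\<close>


text \<open>The usual contraction of the Koszul complex divides by the total degree and fails in
  positive characteristic. On S(V) \<otimes> S(V) = k[x, y] a polynomial in y minus its image under
  y_b -> x_b is divisible by x_b - y_b without denominators, at the price of a homotopy that treats
  only one coordinate b; hence the passage through all basis vectors. These homotopies are only left
  S(V)-linear, which suffices: exactness of K \<rtimes> G concerns vector spaces and is checked
  component by component.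

  The formula for \<nabla> is written in chosen summands v_(1), v_(2), v_(3), which need not depend
  linearly on v. Linearity and equivariance in v are therefore read off from the single element
  D(\<sigma>(r(v))). The section \<sigma> enters through \<pi>\<sigma> = 1, which makes the
  commutator come out as r(v).

  Neither term of the difference of the two composites with \<theta> is a bimodule map, but both
  obey the same Leibniz rule, so the terms with \<delta>(a) cancel. Freeness of the bar resolution
  is used without bases: a linear section of the Koszul differential is extended to a bimodule
  map.\<close>

section \<open>Linear maps between spaces of functions\<close>

text \<open>
  Higher-order unification eta-expands terms of function type, and these rules would then
  push the vector space operations below the abstraction.
\<close>

declare plus_fun_apply [simp del] zero_fun_apply [simp del] minus_apply [simp del] uminus_apply [simp del]

lemmas fun_applys = plus_fun_apply zero_fun_apply minus_apply uminus_apply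

abbreviation (input) lin :: "('x \<Rightarrow> 'k::field) set \<Rightarrow> (('x \<Rightarrow> 'k) \<Rightarrow> 'y \<Rightarrow> 'k) \<Rightarrow> bool" where
  "lin A \<equiv> linear_on scl A scl"

lemma linear_on_subset: "linear_on s A t f \<Longrightarrow> B \<subseteq> A \<Longrightarrow> linear_on s B t f"
  unfolding linear_on_def by blast

lemma linear_on_zero:
  fixes f :: "('x \<Rightarrow> 'k::field) \<Rightarrow> 'y \<Rightarrow> 'k"
  assumes "lin A f" "0 \<in> A"
  shows "f 0 = 0"
  using assms by (metis linear_on_def fn.scale_zero_left)

lemma linear_on_image_sum:
  fixes f :: "('x \<Rightarrow> 'k::field) \<Rightarrow> 'y \<Rightarrow> 'k"
  assumes f: "lin A f" and A: "fn.subspace A" and x: "\<And>i. i \<in> I \<Longrightarrow> x i \<in> A"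
  shows "f (\<Sum>i\<in>I. x i) = (\<Sum>i\<in>I. f (x i))"
  using x
proof (induction I rule: infinite_finite_induct)
  case (insert i I)
  then have "(\<Sum>i\<in>I. x i) \<in> A" by (intro fn.subspace_sum[OF A]) auto
  then have "f (x i + (\<Sum>i\<in>I. x i)) = f (x i) + f (\<Sum>i\<in>I. x i)"
    using insert.prems f unfolding linear_on_def by blast
  with insert show ?case by simp
qed (use linear_on_zero[OF f fn.subspace_0[OF A]] in auto)

lemma linear_on_image_diff:
  fixes f :: "('x \<Rightarrow> 'k::field) \<Rightarrow> 'y \<Rightarrow> 'k"
  assumes f: "lin A f" and A: "fn.subspace A" and x: "x \<in> A" "y \<in> A"
  shows "f (x - y) = f x - f y"
proof -
  have "f ((x - y) + y) = f (x - y) + f y"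
    using f x fn.subspace_diff[OF A x] unfolding linear_on_def by blast
  then show ?thesis by (simp add: algebra_simps)
qed

lemma lin_comp: "linear_on s A t f \<Longrightarrow> linear_on t UNIV u g \<Longrightarrow> linear_on s A u (\<lambda>x. g (f x))"
  by (rule linear_on_comp[OF _ subset_UNIV])

lemma lin_sum: "lin UNIV f \<Longrightarrow> f (\<Sum>i\<in>I. x i) = (\<Sum>i\<in>I. f (x i))"
  and lin_diff: "lin UNIV f \<Longrightarrow> f (y - z) = f y - f z"
  using linear_on_image_sum[of UNIV f I x] linear_on_image_diff[of UNIV f y z] by auto

lemma linear_on_plus:
  "linear_on s A scl f \<Longrightarrow> linear_on s A scl g \<Longrightarrow> linear_on s A scl (\<lambda>x. f x + g x)"
  by (simp add: linear_on_def fn.scale_right_distrib)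

lemma linear_on_minus:
  "linear_on s A scl f \<Longrightarrow> linear_on s A scl g \<Longrightarrow> linear_on s A scl (\<lambda>x. f x - g x)"
  by (simp add: linear_on_def fn.scale_right_diff_distrib)

lemma linear_on_times: "linear_on s A scl f \<Longrightarrow> linear_on s A scl (\<lambda>x. scl c (f x))"
  by (simp add: linear_on_def fn.scale_right_distrib fn.scale_left_commute)

lemma linear_on_setsum:
  "(\<And>i. i \<in> I \<Longrightarrow> linear_on s A scl (f i)) \<Longrightarrow> linear_on s A scl (\<lambda>x. \<Sum>i\<in>I. f i x)"
  by (simp add: linear_on_def sum.distrib fn.scale_sum_right)

lemma linear_on_coeff: "linear_on s A (*) f \<Longrightarrow> linear_on s A scl (\<lambda>x. scl (f x) m)"
  by (simp add: linear_on_def fn.scale_left_distrib)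

lemma linear_on_lext: "lin A (lext F)"
  by (simp add: linear_on_def lext_add lext_scl)

lemma linear_on_const_zero: "linear_on s A scl (\<lambda>x. 0)"
  by (simp add: linear_on_def)

text \<open>Linearity is only assumed on the span, so additivity may be applied only to arguments
  known to lie there; the induction therefore carries membership along with the equation.\<close>

lemma linear_on_span_eq:
  fixes f :: "('x \<Rightarrow> 'k::field) \<Rightarrow> 'y \<Rightarrow> 'k"
  assumes f: "lin (fn.span X) f" and g: "lin (fn.span X) g"
    and eq: "\<And>x. x \<in> X \<Longrightarrow> f x = g x" and x: "x \<in> fn.span X"
  shows "f x = g x"
proof -
  have "x \<in> fn.span X \<and> f x = g x" using x
  proof (induction rule: fn.span_induct_alt)
    case base
    show ?case using linear_on_zero[OF f fn.span_zero] linear_on_zero[OF g fn.span_zero] fn.span_zero by metis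
  next
    case (step c x y)
    then have "x \<in> fn.span X" "scl c x \<in> fn.span X" by (auto intro: fn.span_base fn.span_scale)
    with step eq f g show ?case unfolding linear_on_def by (auto intro: fn.span_add)
  qed
  then show ?thesis by simp
qed

lemma linear_on_span_into:
  fixes f :: "('x \<Rightarrow> 'k::field) \<Rightarrow> 'y \<Rightarrow> 'k"
  assumes f: "lin (fn.span X) f" and N: "fn.subspace N"
    and into: "\<And>x. x \<in> X \<Longrightarrow> f x \<in> N" and x: "x \<in> fn.span X"
  shows "f x \<in> N"
proof -
  have "x \<in> fn.span X \<and> f x \<in> N" using x
  proof (induction rule: fn.span_induct_alt)
    case base
    show ?case using linear_on_zero[OF f fn.span_zero] fn.subspace_0[OF N] fn.span_zero by metis
  next
    case (step c x y)
    then have x: "x \<in> fn.span X" "scl c x \<in> fn.span X" by (auto intro: fn.span_base fn.span_scale)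
    then have "f (scl c x + y) = scl c (f x) + f y" using f step unfolding linear_on_def by auto
    with step x show ?case
      by (auto intro!: fn.span_add fn.subspace_add[OF N] fn.subspace_scale[OF N] into)
  qed
  then show ?thesis by simp
qed

lemma linear_sumI:
  assumes "\<And>x y. f (x + y) = f x + f y" "\<And>c x. f (scl c x) = scl c (f x)"
  shows "lin A f"
  using assms by (simp add: linear_on_def)

section \<open>The symmetric algebra\<close>

lemma Salg_eqI:
  assumes "lin (Salg s) f" "lin (Salg s) g"
    and "\<And>vs. f (sword s vs) = g (sword s vs)" and "x \<in> Salg s"
  shows "f x = g x"
  using assms linear_on_span_eq[of "range (sword s)" f g x] unfolding Salg_def by auto

lemma Ext_eqI:
  assumes "lin (Ext s p) f" "lin (Ext s p) g"
    and "\<And>vs. length vs = p \<Longrightarrow> f (wedge s p vs) = g (wedge s p vs)" and "x \<in> Ext s p"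
  shows "f x = g x"
  using assms linear_on_span_eq[of "{wedge s p vs |vs. length vs = p}" f g x] unfolding Ext_def by auto

lemma Talg_eqI:
  assumes "lin (Talg s) f" "lin (Talg s) g"
    and "\<And>vs. f (tword s vs) = g (tword s vs)" and "x \<in> Talg s"
  shows "f x = g x"
  using assms linear_on_span_eq[of "range (tword s)" f g x] unfolding Talg_def by auto

text \<open>The universal property for maps with values in a function space, so that the conditions
  are identities between values instead of one condition per coordinate. The companions
  \<open>lext_wedge_fun\<close>, \<open>lext_tword\<close>, \<open>lext_tri_fun\<close> and
  \<open>lext_tpow_fun\<close> serve the other constructions.\<close>

lemma lext_sword:
  fixes s :: "'k::field \<Rightarrow> 'v::plus \<Rightarrow> 'v"
  assumes lin: "\<And>us vs. linear_on s UNIV scl (\<lambda>x. F (us @ [x] @ vs))"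
    and swap: "\<And>us x y vs. F (us @ [x, y] @ vs) = F (us @ [y, x] @ vs)"
  shows "lext F (sword s vs) = F vs"
  unfolding sword_def
proof (rule lext_pure)
  show "symmetric_form s (\<lambda>x. F x y)" for y
    using linear_on_apply[OF lin] swap unfolding symmetric_form_def multilinear_form_def by auto
qed

lemma lext_wedge_fun:
  fixes s :: "'k::field \<Rightarrow> 'v::plus \<Rightarrow> 'v"
  assumes lin: "\<And>us vs. length us + length vs + 1 = p \<Longrightarrow> linear_on s UNIV scl (\<lambda>x. F (us @ [x] @ vs))"
    and alt: "\<And>us x vs. length us + length vs + 2 = p \<Longrightarrow> F (us @ [x, x] @ vs) = 0"
  shows "lext F (wedge s p vs) = F vs"
proof (rule lext_wedge)
  show "alternating_form s p (\<lambda>x. F x y)" for y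
    using linear_on_apply[OF lin] alt unfolding alternating_form_def multilinear_form_def
    by (auto simp: zero_fun_apply)
qed

lemma lext_tword:
  fixes s :: "'k::field \<Rightarrow> 'v::plus \<Rightarrow> 'v"
  assumes lin: "\<And>us vs. linear_on s UNIV scl (\<lambda>x. F (us @ [x] @ vs))"
  shows "lext F (tword s vs) = F vs"
  unfolding tword_def
proof (rule lext_pure)
  show "\<forall>n. multilinear_form s UNIV n (\<lambda>x. F x y)" for y
    using linear_on_apply[OF lin] unfolding multilinear_form_def by auto
qed

lemma linear_on_pointwise: "(\<And>y. linear_on s A (*) (\<lambda>x. F x y)) \<Longrightarrow> linear_on s A scl F"
  by (auto simp: linear_on_def scl_def fun_eq_iff fun_applys)

lemma wedge_linear: "length us + length vs + 1 = p \<Longrightarrow> linear_on s UNIV scl (\<lambda>x. wedge s p (us @ [x] @ vs))"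
  using alternating_wedge[of s p] by (intro linear_on_pointwise) (auto simp: alternating_form_def multilinear_form_def)

lemma wedge_repeat: "length us + length vs + 2 = p \<Longrightarrow> wedge s p (us @ [x, x] @ vs) = 0"
  using alternating_wedge[of s p] by (auto simp: alternating_form_def fun_eq_iff fun_applys)

text \<open>Polarisation of the vanishing word with \<open>x + y\<close> in two adjacent places.
  Vanishing on repetitions is the defining relation, being the stronger one in characteristic
  2.\<close>

lemma wedge_swap:
  fixes s :: "'k::field \<Rightarrow> 'v::plus \<Rightarrow> 'v"
  assumes p: "length us + length vs + 2 = p"
  shows "wedge s p (us @ [x, y] @ vs) = - wedge s p (us @ [y, x] @ vs)"
proof -
  have 1: "wedge s p (us @ [z, x + y] @ vs) = wedge s p (us @ [z, x] @ vs) + wedge s p (us @ [z, y] @ vs)" for z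
    using wedge_linear[of "us @ [z]" vs p s] p unfolding linear_on_def by simp
  have 2: "wedge s p (us @ [x + y, z] @ vs) = wedge s p (us @ [x, z] @ vs) + wedge s p (us @ [y, z] @ vs)" for z
    using wedge_linear[of us "z # vs" p s] p unfolding linear_on_def by simp
  have 0: "wedge s p (us @ [z, z] @ vs) = 0" for z using p by (rule wedge_repeat)
  have "wedge s p (us @ [x + y, x + y] @ vs) = wedge s p (us @ [x, y] @ vs) + wedge s p (us @ [y, x] @ vs)"
    unfolding 1 2 unfolding 0 by (simp add: add.commute)
  then show ?thesis unfolding 0 by (simp add: eq_neg_iff_add_eq_0)
qed

lemma symmetric_form_move:
  "symmetric_form s l \<Longrightarrow> l (us @ x # ys @ zs) = l (us @ ys @ x # zs)"
proof (induction ys arbitrary: us)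
  case (Cons y ys)
  have "l (us @ [x, y] @ (ys @ zs)) = l (us @ [y, x] @ (ys @ zs))"
    using Cons.prems unfolding symmetric_form_def by blast
  then show ?case using Cons.IH[of "us @ [y]"] Cons.prems by simp
qed simp

text \<open>Adjacent swaps carry the first letter to the end of the word; repeat until
  \<open>xs\<close> has been moved behind \<open>ys\<close>.\<close>

lemma symmetric_form_append_commute: "symmetric_form s l \<Longrightarrow> l (xs @ ys) = l (ys @ xs)"
proof (induction xs arbitrary: ys)
  case (Cons x xs)
  have "l (x # xs @ ys) = l (xs @ ys @ [x])"
    using symmetric_form_move[OF Cons.prems, of "[]" x "xs @ ys" "[]"] by simp
  then show ?case using Cons.IH[OF Cons.prems, of "ys @ [x]"] by simp
qed simp

lemma sword_append_commute: "sword s (xs @ ys) = sword s (ys @ xs)"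
  by (auto simp: sword_def pure_def fun_eq_iff intro: symmetric_form_append_commute)

section \<open>The commutative algebra structure of S(V), checked on words\<close>

lemma smul_add_left: "smul s (f + f') g = smul s f g + smul s f' g"
  and smul_scl_left: "smul s (scl c f) g = scl c (smul s f g)"
  using smul_linear_left[of UNIV s g] by (auto simp: linear_on_def)
lemma smul_add_right: "f \<in> Salg s \<Longrightarrow> g \<in> Salg s \<Longrightarrow> g' \<in> Salg s \<Longrightarrow> smul s f (g + g') = smul s f g + smul s f g'"
  and smul_scl_right: "f \<in> Salg s \<Longrightarrow> g \<in> Salg s \<Longrightarrow> smul s f (scl c g) = scl c (smul s f g)"
  using smul_linear_right[of f s] by (auto simp: linear_on_def)

lemmas Salg_mems = Salg_add Salg_scl smul_closed sword_Salg Salg_0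
lemmas smul_lins = smul_add_left smul_scl_left smul_add_right smul_scl_right

lemma smul_one_left: "a \<in> Salg s \<Longrightarrow> smul s (sone s) a = a"
  by (rule Salg_eqI[of s "smul s (sone s)" "\<lambda>a. a"])
    (auto intro!: linear_on_fieldI simp: smul_lins Salg_mems smul_sword)

lemma smul_one_right: "a \<in> Salg s \<Longrightarrow> smul s a (sone s) = a"
  by (rule Salg_eqI[of s "\<lambda>a. smul s a (sone s)" "\<lambda>a. a"])
    (auto intro!: linear_on_fieldI simp: smul_lins Salg_mems smul_sword)

lemma smul_commute: "a \<in> Salg s \<Longrightarrow> b \<in> Salg s \<Longrightarrow> smul s a b = smul s b a"
proof (rule Salg_eqI[of s "\<lambda>a. smul s a b" "smul s b"])
  assume b: "b \<in> Salg s"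
  show "smul s (sword s vs) b = smul s b (sword s vs)" for vs
    by (rule Salg_eqI[of s "smul s (sword s vs)" "\<lambda>b. smul s b (sword s vs)"])
      (auto intro!: linear_on_fieldI simp: smul_lins Salg_mems b smul_sword sword_append_commute[of s vs])
qed (auto intro!: linear_on_fieldI simp: smul_lins Salg_mems)

lemma smul_assoc:
  assumes "a \<in> Salg s" "b \<in> Salg s" "c \<in> Salg s"
  shows "smul s (smul s a b) c = smul s a (smul s b c)"
proof (rule Salg_eqI[of s "\<lambda>a. smul s (smul s a b) c" "\<lambda>a. smul s a (smul s b c)"])
  fix xs
  show "smul s (smul s (sword s xs) b) c = smul s (sword s xs) (smul s b c)"
  proof (rule Salg_eqI[of s "\<lambda>b. smul s (smul s (sword s xs) b) c" "\<lambda>b. smul s (sword s xs) (smul s b c)"])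
    fix ys
    show "smul s (smul s (sword s xs) (sword s ys)) c = smul s (sword s xs) (smul s (sword s ys) c)"
      by (rule Salg_eqI[of s _ "\<lambda>c. smul s (sword s xs) (smul s (sword s ys) c)"])
        (auto intro!: linear_on_fieldI simp: smul_lins Salg_mems assms smul_sword)
  qed (auto intro!: linear_on_fieldI simp: smul_lins Salg_mems assms)
qed (auto intro!: linear_on_fieldI simp: smul_lins Salg_mems assms)

section \<open>Triple tensor products\<close>

lemma tri_lin1: "m \<in> M \<Longrightarrow> c \<in> Salg s \<Longrightarrow> lin (Salg s) (\<lambda>a. tri s t M a m c)"
  by (rule linear_on_pointwise) (rule tri_linear1)
lemma tri_lin2: "a \<in> Salg s \<Longrightarrow> c \<in> Salg s \<Longrightarrow> linear_on t M scl (\<lambda>m. tri s t M a m c)"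
  by (rule linear_on_pointwise) (rule tri_linear2)
lemma tri_lin3: "a \<in> Salg s \<Longrightarrow> m \<in> M \<Longrightarrow> lin (Salg s) (\<lambda>c. tri s t M a m c)"
  by (rule linear_on_pointwise) (rule tri_linear3)

lemma tri_add1: "m \<in> M \<Longrightarrow> c \<in> Salg s \<Longrightarrow> a \<in> Salg s \<Longrightarrow> a' \<in> Salg s \<Longrightarrow>
    tri s t M (a + a') m c = tri s t M a m c + tri s t M a' m c"
  and tri_scl1: "m \<in> M \<Longrightarrow> c \<in> Salg s \<Longrightarrow> a \<in> Salg s \<Longrightarrow> tri s t M (scl q a) m c = scl q (tri s t M a m c)"
  using tri_lin1[of m M c s t] by (auto simp: linear_on_def)
lemma tri_add2: "a \<in> Salg s \<Longrightarrow> c \<in> Salg s \<Longrightarrow> m \<in> M \<Longrightarrow> m' \<in> M \<Longrightarrow>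
    tri s t M a (m + m') c = tri s t M a m c + tri s t M a m' c"
  and tri_scl2: "a \<in> Salg s \<Longrightarrow> c \<in> Salg s \<Longrightarrow> m \<in> M \<Longrightarrow> tri s t M a (t q m) c = scl q (tri s t M a m c)"
  using tri_lin2[of a s c t M] by (auto simp: linear_on_def)
lemma tri_add3: "a \<in> Salg s \<Longrightarrow> m \<in> M \<Longrightarrow> c \<in> Salg s \<Longrightarrow> c' \<in> Salg s \<Longrightarrow>
    tri s t M a m (c + c') = tri s t M a m c + tri s t M a m c'"
  and tri_scl3: "a \<in> Salg s \<Longrightarrow> m \<in> M \<Longrightarrow> c \<in> Salg s \<Longrightarrow> tri s t M a m (scl q c) = scl q (tri s t M a m c)"
  using tri_lin3[of a s m M t] by (auto simp: linear_on_def)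

lemmas tri_lins = tri_add1 tri_scl1 tri_add2 tri_scl2 tri_add3 tri_scl3

lemma lext_tri_fun:
  assumes "\<And>m c. m \<in> M \<Longrightarrow> c \<in> Salg s \<Longrightarrow> lin (Salg s) (\<lambda>a. F a m c)"
    "\<And>a c. a \<in> Salg s \<Longrightarrow> c \<in> Salg s \<Longrightarrow> linear_on t M scl (\<lambda>m. F a m c)"
    "\<And>a m. a \<in> Salg s \<Longrightarrow> m \<in> M \<Longrightarrow> lin (Salg s) (\<lambda>c. F a m c)"
  shows "lext (\<lambda>(a, m, c). F a m c) (tri s t M a m c) = F a m c"
proof -
  have "lext (\<lambda>(a, m, c). F a m c) (tri s t M a m c) = (\<lambda>(a, m, c). F a m c) (a, m, c)"
    by (rule lext_tri, rule trilinear_formI; unfold prod.case) (rule linear_on_apply, rule assms, assumption+)+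
  then show ?thesis by simp
qed

lemma SMS_subspace: "fn.subspace (SMS s t M)" by (simp add: SMS_def)
lemma SMS_add: "x \<in> SMS s t M \<Longrightarrow> y \<in> SMS s t M \<Longrightarrow> x + y \<in> SMS s t M"
  and SMS_scl: "x \<in> SMS s t M \<Longrightarrow> scl c x \<in> SMS s t M"
  and SMS_0: "0 \<in> SMS s t M"
  and SMS_diff: "x \<in> SMS s t M \<Longrightarrow> y \<in> SMS s t M \<Longrightarrow> x - y \<in> SMS s t M"
  and SMS_sum: "(\<And>i. i \<in> I \<Longrightarrow> f i \<in> SMS s t M) \<Longrightarrow> (\<Sum>i\<in>I. f i) \<in> SMS s t M"
  using SMS_subspace fn.subspace_add fn.subspace_scale fn.subspace_0 fn.subspace_diff fn.subspace_sum by metis+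

lemma tri_SMS: "a \<in> Salg s \<Longrightarrow> m \<in> M \<Longrightarrow> c \<in> Salg s \<Longrightarrow> tri s t M a m c \<in> SMS s t M"
  unfolding SMS_def by (auto intro!: fn.span_base)

lemma SMS_eqI:
  assumes "lin (SMS s t M) f" "lin (SMS s t M) g"
    and "\<And>a m c. a \<in> Salg s \<Longrightarrow> m \<in> M \<Longrightarrow> c \<in> Salg s \<Longrightarrow> f (tri s t M a m c) = g (tri s t M a m c)"
    and "x \<in> SMS s t M"
  shows "f x = g x"
  using assms linear_on_span_eq[of "{tri s t M a m c |a m c. a \<in> Salg s \<and> m \<in> M \<and> c \<in> Salg s}" f g x]
  unfolding SMS_def by auto

lemma SMS_intoI:
  assumes "lin (SMS s t M) f" "fn.subspace N"
    and "\<And>a m c. a \<in> Salg s \<Longrightarrow> m \<in> M \<Longrightarrow> c \<in> Salg s \<Longrightarrow> f (tri s t M a m c) \<in> N"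
    and "x \<in> SMS s t M"
  shows "f x \<in> N"
  using assms linear_on_span_into[of "{tri s t M a m c |a m c. a \<in> Salg s \<and> m \<in> M \<and> c \<in> Salg s}" f N x]
  unfolding SMS_def by auto

lemma SMS_left_add: "SMS_left s t M f (x + y) = SMS_left s t M f x + SMS_left s t M f y"
  and SMS_left_scl: "SMS_left s t M f (scl c x) = scl c (SMS_left s t M f x)"
  by (simp_all add: SMS_left_def lext_add lext_scl)
lemma SMS_right_add: "SMS_right s t M (x + y) f = SMS_right s t M x f + SMS_right s t M y f"
  and SMS_right_scl: "SMS_right s t M (scl c x) f = scl c (SMS_right s t M x f)"
  by (simp_all add: SMS_right_def lext_add lext_scl)

lemma SMS_left_closed: "f \<in> Salg s \<Longrightarrow> x \<in> SMS s t M \<Longrightarrow> SMS_left s t M f x \<in> SMS s t M"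
  by (rule SMS_intoI[of s t M "SMS_left s t M f"])
    (auto intro!: linear_sumI SMS_subspace tri_SMS smul_closed simp: SMS_left_add SMS_left_scl SMS_left_tri)
lemma SMS_right_closed: "f \<in> Salg s \<Longrightarrow> x \<in> SMS s t M \<Longrightarrow> SMS_right s t M x f \<in> SMS s t M"
  by (rule SMS_intoI[of s t M "\<lambda>x. SMS_right s t M x f"])
    (auto intro!: linear_sumI SMS_subspace tri_SMS smul_closed simp: SMS_right_add SMS_right_scl SMS_right_tri)

lemmas SMS_mems = SMS_add SMS_scl SMS_0 SMS_diff SMS_left_closed SMS_right_closed tri_SMS

lemma SMS_left_add_left:
  assumes "x \<in> SMS s t M" "f \<in> Salg s" "g \<in> Salg s"
  shows "SMS_left s t M (f + g) x = SMS_left s t M f x + SMS_left s t M g x"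
  by (rule SMS_eqI[of s t M _ "\<lambda>x. SMS_left s t M f x + SMS_left s t M g x", OF _ _ _ assms(1)])
    (auto intro!: linear_on_fieldI simp: SMS_left_add SMS_left_scl SMS_left_tri assms Salg_mems smul_lins tri_lins fn.scale_right_distrib)

lemma SMS_left_scl_left:
  assumes "x \<in> SMS s t M" "f \<in> Salg s"
  shows "SMS_left s t M (scl q f) x = scl q (SMS_left s t M f x)"
  by (rule SMS_eqI[of s t M _ "\<lambda>x. scl q (SMS_left s t M f x)", OF _ _ _ assms(1)])
    (auto intro!: linear_on_fieldI simp: SMS_left_add SMS_left_scl SMS_left_tri assms Salg_mems smul_lins tri_lins fn.scale_right_distrib mult.commute)

lemma SMS_right_add_right:
  assumes "x \<in> SMS s t M" "f \<in> Salg s" "g \<in> Salg s"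
  shows "SMS_right s t M x (f + g) = SMS_right s t M x f + SMS_right s t M x g"
  by (rule SMS_eqI[of s t M _ "\<lambda>x. SMS_right s t M x f + SMS_right s t M x g", OF _ _ _ assms(1)])
    (auto intro!: linear_on_fieldI simp: SMS_right_add SMS_right_scl SMS_right_tri assms Salg_mems smul_lins tri_lins fn.scale_right_distrib)

lemma SMS_right_scl_right:
  assumes "x \<in> SMS s t M" "f \<in> Salg s"
  shows "SMS_right s t M x (scl q f) = scl q (SMS_right s t M x f)"
  by (rule SMS_eqI[of s t M _ "\<lambda>x. scl q (SMS_right s t M x f)", OF _ _ _ assms(1)])
    (auto intro!: linear_on_fieldI simp: SMS_right_add SMS_right_scl SMS_right_tri assms Salg_mems smul_lins tri_lins fn.scale_right_distrib mult.commute)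

lemmas SMS_lins = SMS_left_add SMS_left_scl SMS_right_add SMS_right_scl
  SMS_left_add_left SMS_left_scl_left SMS_right_add_right SMS_right_scl_right

lemma SMS_left_smul:
  assumes "x \<in> SMS s t M" "f \<in> Salg s" "g \<in> Salg s"
  shows "SMS_left s t M (smul s f g) x = SMS_left s t M f (SMS_left s t M g x)"
  by (rule SMS_eqI[of s t M _ "\<lambda>x. SMS_left s t M f (SMS_left s t M g x)", OF _ _ _ assms(1)])
    (auto intro!: linear_on_fieldI simp: SMS_lins SMS_left_tri assms Salg_mems smul_assoc)

lemma SMS_right_smul:
  assumes "x \<in> SMS s t M" "f \<in> Salg s" "g \<in> Salg s"
  shows "SMS_right s t M x (smul s f g) = SMS_right s t M (SMS_right s t M x f) g"
  by (rule SMS_eqI[of s t M _ "\<lambda>x. SMS_right s t M (SMS_right s t M x f) g", OF _ _ _ assms(1)])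
    (auto intro!: linear_on_fieldI simp: SMS_lins SMS_right_tri assms Salg_mems smul_assoc)

lemma SMS_left_right:
  assumes "x \<in> SMS s t M" "f \<in> Salg s" "g \<in> Salg s"
  shows "SMS_left s t M f (SMS_right s t M x g) = SMS_right s t M (SMS_left s t M f x) g"
  by (rule SMS_eqI[of s t M "\<lambda>x. SMS_left s t M f (SMS_right s t M x g)", OF _ _ _ assms(1)])
    (auto intro!: linear_on_fieldI simp: SMS_lins SMS_right_tri SMS_left_tri assms Salg_mems)

lemma SMS_left_one: "x \<in> SMS s t M \<Longrightarrow> SMS_left s t M (sone s) x = x"
  by (rule SMS_eqI[of s t M _ "\<lambda>x. x"])
    (auto intro!: linear_on_fieldI simp: SMS_lins SMS_left_tri Salg_mems smul_one_left)

lemma SMS_right_one: "x \<in> SMS s t M \<Longrightarrow> SMS_right s t M x (sone s) = x"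
  by (rule SMS_eqI[of s t M _ "\<lambda>x. x"])
    (auto intro!: linear_on_fieldI simp: SMS_lins SMS_right_tri Salg_mems smul_one_right)

lemma SMS_left_0: "SMS_left s t M f 0 = 0" and SMS_right_0: "SMS_right s t M 0 f = 0"
  by (simp_all add: SMS_left_def SMS_right_def lext_def fun_eq_iff zero_fun_apply)

lemma SMS_left_0_left: "x \<in> SMS s t M \<Longrightarrow> SMS_left s t M 0 x = 0"
  and SMS_right_0_right: "x \<in> SMS s t M \<Longrightarrow> SMS_right s t M x 0 = 0"
  using SMS_left_scl_left[of x s t M 0 0] SMS_right_scl_right[of x s t M 0 0] by (simp_all add: Salg_0)

lemma SMS_left_linear: "lin A (SMS_left s t M f)"
  and SMS_right_linear: "lin A (\<lambda>x. SMS_right s t M x f)"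
  by (simp_all add: linear_on_def SMS_left_add SMS_left_scl SMS_right_add SMS_right_scl)

lemma SMS_left_linear_left: "x \<in> SMS s t M \<Longrightarrow> lin (Salg s) (\<lambda>f. SMS_left s t M f x)"
  and SMS_right_linear_right: "x \<in> SMS s t M \<Longrightarrow> lin (Salg s) (SMS_right s t M x)"
  by (simp_all add: linear_on_def SMS_lins)

lemma SMS_left_sum: "SMS_left s t M f (\<Sum>i\<in>I. x i) = (\<Sum>i\<in>I. SMS_left s t M f (x i))"
  and SMS_right_sum: "SMS_right s t M (\<Sum>i\<in>I. x i) f = (\<Sum>i\<in>I. SMS_right s t M (x i) f)"
  and SMS_left_diff: "SMS_left s t M f (z - y) = SMS_left s t M f z - SMS_left s t M f y"
  and SMS_right_diff: "SMS_right s t M (z - y) f = SMS_right s t M z f - SMS_right s t M y f"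
  using lin_sum[OF SMS_left_linear, where x = x and I = I]
    lin_sum[OF SMS_right_linear, where x = x and I = I]
    lin_diff[OF SMS_left_linear]
    lin_diff[OF SMS_right_linear] by auto

text \<open>S(V) \<otimes> M \<otimes> S(V) is generated as a bimodule by the elements 1 \<otimes> m
  \<otimes> 1, so maps compatible with the two multiplications need be compared only there.\<close>

lemma tri_as_mults:
  assumes "a \<in> Salg s" "m \<in> M" "c \<in> Salg s"
  shows "tri s t M a m c = SMS_left s t M a (SMS_right s t M (tri s t M (sone s) m (sone s)) c)"
  using assms by (simp add: SMS_left_tri SMS_right_tri smul_one_left smul_one_right)

lemma Kos_eqI:
  fixes s :: "'k::field \<Rightarrow> 'v::ab_group_add \<Rightarrow> 'v"
  assumes f: "lin (Kos s p) f" and g: "lin (Kos s p) g"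
    and eq: "\<And>a vs c. a \<in> Salg s \<Longrightarrow> length vs = p \<Longrightarrow> c \<in> Salg s \<Longrightarrow>
      f (ktri s p a (wedge s p vs) c) = g (ktri s p a (wedge s p vs) c)"
    and x: "x \<in> Kos s p"
  shows "f x = g x"
proof (rule SMS_eqI[OF f g _ x])
  fix a w c assume a: "a \<in> Salg s" "w \<in> Ext s p" "c \<in> Salg s"
  have w: "(\<lambda>w. ktri s p a w c) ` Ext s p \<subseteq> Kos s p" using a by (auto intro: tri_SMS)
  note lin = linear_on_comp[OF tri_lin2[OF a(1,3)] w]
  show "f (ktri s p a w c) = g (ktri s p a w c)"
    by (rule Ext_eqI[OF lin[OF f] lin[OF g] eq a(2)]) (use a in auto)
qed

text \<open>For maps known only on words, such as those built from the word recursions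
  \<open>qop\<close> and \<open>dop\<close> below, whose formulas do not apply to arbitrary
  coefficients.\<close>

lemma Kos_word_eqI:
  fixes s :: "'k::field \<Rightarrow> 'v::ab_group_add \<Rightarrow> 'v"
  assumes f: "lin (Kos s p) f" and g: "lin (Kos s p) g"
    and eq: "\<And>as vs cs. length vs = p \<Longrightarrow>
      f (ktri s p (sword s as) (wedge s p vs) (sword s cs)) = g (ktri s p (sword s as) (wedge s p vs) (sword s cs))"
    and x: "x \<in> Kos s p"
  shows "f x = g x"
proof (rule Kos_eqI[OF f g _ x])
  fix a vs c assume a: "a \<in> Salg s" "length (vs :: 'v list) = p" "c \<in> Salg s"
  have w: "wedge s p vs \<in> Ext s p" using a by (simp add: wedge_Ext)
  have 1: "(\<lambda>a. ktri s p a (wedge s p vs) c) ` Salg s \<subseteq> Kos s p"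
    "(\<lambda>c. ktri s p a (wedge s p vs) c) ` Salg s \<subseteq> Kos s p" if "a \<in> Salg s" "c \<in> Salg s" for a c
    using w that by (auto intro: tri_SMS)
  show "f (ktri s p a (wedge s p vs) c) = g (ktri s p a (wedge s p vs) c)"
  proof (rule Salg_eqI[where f = "\<lambda>a. f (ktri s p a (wedge s p vs) c)" and g = "\<lambda>a. g (ktri s p a (wedge s p vs) c)", OF _ _ _ a(1)])
    show "f (ktri s p (sword s as) (wedge s p vs) c) = g (ktri s p (sword s as) (wedge s p vs) c)" for as
      by (rule Salg_eqI[where f = "\<lambda>c. f (ktri s p (sword s as) (wedge s p vs) c)"
            and g = "\<lambda>c. g (ktri s p (sword s as) (wedge s p vs) c)", OF _ _ _ a(3)])
        (auto intro!: linear_on_comp[OF tri_lin3 1(2)] eq a f g w sword_Salg)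
  qed (auto intro!: linear_on_comp[OF tri_lin1 1(1)] eq a f g w)
qed


section \<open>Smash products\<close>

lemma Rtimes_expand:
  fixes x :: "'g::finite \<times> 'y \<Rightarrow> 'k::field"
  shows "x = (\<Sum>g\<in>UNIV. rtimes (component x g) g)"
proof
  fix z :: "'g \<times> 'y"
  obtain h y where z: "z = (h, y)" by (cases z)
  have "(\<Sum>g\<in>UNIV. rtimes (component x g) g z) = (\<Sum>g\<in>UNIV. if g = h then x (h, y) else 0)"
    by (intro sum.cong) (auto simp: z rtimes_def component_def)
  then show "x z = (\<Sum>g\<in>UNIV. rtimes (component x g) g) z" by (simp add: sum_apply z)
qed

lemma Rtimes_eqI:
  fixes f :: "('g::finite \<times> 'y \<Rightarrow> 'k::field) \<Rightarrow> 'z \<Rightarrow> 'k"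
  assumes M: "fn.subspace M" and f: "lin (Rtimes M) f" and f': "lin (Rtimes M) f'"
    and eq: "\<And>m g. m \<in> M \<Longrightarrow> f (rtimes m g) = f' (rtimes m g)" and x: "x \<in> Rtimes M"
  shows "f x = f' x"
proof -
  have c: "component x g \<in> M" for g using x by (simp add: Rtimes_def)
  have m: "rtimes (component x g) g \<in> Rtimes M" for g
    using c fn.subspace_0[OF M] by (auto simp: Rtimes_def component_rtimes)
  show ?thesis
    by (subst (1 2) Rtimes_expand) (simp add: linear_on_image_sum[OF f Rtimes_subspace[OF M] m]
        linear_on_image_sum[OF f' Rtimes_subspace[OF M] m] eq c)
qed

lemma rtimes_Rtimes: "fn.subspace M \<Longrightarrow> m \<in> M \<Longrightarrow> rtimes m g \<in> Rtimes M"
  using fn.subspace_0 by (auto simp: Rtimes_def component_rtimes)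

lemma component_rtimes_map: "component (rtimes_map F x) g = F (component x g)"
  by (simp add: component_def rtimes_map_def)

lemma Rtimes_ext:
  fixes x y :: "'h \<times> 'y \<Rightarrow> 'k"
  shows "(\<And>g. component x g = component y g) \<Longrightarrow> x = y"
  by (auto simp: component_def fun_eq_iff)

lemma rtimes_map_rtimes: "F 0 = 0 \<Longrightarrow> rtimes_map F (rtimes m g) = rtimes (F m) g"
  by (rule Rtimes_ext) (simp add: component_rtimes_map component_rtimes)

lemma rtimes_map_linear:
  fixes F :: "('y \<Rightarrow> 'k::field) \<Rightarrow> 'z \<Rightarrow> 'k"
  assumes F: "lin M F"
  shows "lin (Rtimes M :: ('h \<times> 'y \<Rightarrow> 'k) set) (rtimes_map F)"
  by (rule linear_on_fieldI; rule Rtimes_ext)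
    (use F in \<open>simp_all add: component_rtimes_map component_add component_scl Rtimes_def linear_on_def\<close>)

lemma rtimes_map_into:
  "(\<And>m. m \<in> M \<Longrightarrow> F m \<in> N) \<Longrightarrow> x \<in> Rtimes M \<Longrightarrow> rtimes_map F x \<in> Rtimes N"
  by (simp add: Rtimes_def component_rtimes_map)

text \<open>As a complex of vector spaces M \<rtimes> G is a direct sum of copies of M indexed by G,
  on which the maps act separately; preimages can be chosen one component at a time.\<close>

lemma rtimes_map_exact:
  assumes ex: "\<And>x. x \<in> M \<Longrightarrow> f x = 0 \<Longrightarrow> \<exists>y\<in>N. h y = x"
    and x: "x \<in> Rtimes M" "rtimes_map f x = 0"
  shows "\<exists>y\<in>Rtimes N. rtimes_map h y = x"
proof -
  have "f (component x g) = 0" for g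
    using x(2) component_rtimes_map[of f x g] by (simp add: component_def fun_eq_iff zero_fun_apply)
  then have "\<forall>g. \<exists>y\<in>N. h y = component x g" using ex x(1) by (simp add: Rtimes_def)
  then obtain y where y: "\<And>g. y g \<in> N" "\<And>g. h (y g) = component x g" by metis
  have c: "component (\<lambda>(g, z). y g z) g = y g" for g by (simp add: component_def)
  show ?thesis
  proof (rule bexI)
    show "rtimes_map h (\<lambda>(g, z). y g z) = x" by (rule Rtimes_ext) (simp only: component_rtimes_map c y)
    show "(\<lambda>(g, z). y g z) \<in> Rtimes N" unfolding Rtimes_def mem_Collect_eq c using y(1) by blast
  qed
qed

section \<open>Linearity of the Koszul maps and the subspaces they preserve\<close>

lemma kos_d_linear: "lin A (kos_d s p)"
  unfolding kos_d_def by (rule linear_on_lext)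
lemma kos_aug_linear: "lin A (kos_aug s)"
  unfolding kos_aug_def by (rule linear_on_lext)
lemma kos_act_linear: "lin A (kos_act s \<rho> p g)"
  unfolding kos_act_def by (rule linear_on_lext)

lemma kos_d_0: "kos_d s p 0 = 0" and kos_aug_0: "kos_aug s 0 = 0" and kos_act_0: "kos_act s \<rho> p g 0 = 0"
  using linear_on_zero[OF kos_d_linear UNIV_I] linear_on_zero[OF kos_aug_linear UNIV_I]
    linear_on_zero[OF kos_act_linear UNIV_I] by auto

lemmas kos_d_sum = lin_sum[OF kos_d_linear]
lemmas kos_d_diff = lin_diff[OF kos_d_linear]
lemmas kos_act_sum = lin_sum[OF kos_act_linear]
lemmas kos_act_diff = lin_diff[OF kos_act_linear]
lemma kos_act_scl: "kos_act s \<rho> p g (scl c x) = scl c (kos_act s \<rho> p g x)"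
  using kos_act_linear[of UNIV s \<rho> p g] by (simp add: linear_on_def)
lemma kos_act_add: "kos_act s \<rho> p g (x + y) = kos_act s \<rho> p g x + kos_act s \<rho> p g y"
  using kos_act_linear[of UNIV s \<rho> p g] by (simp add: linear_on_def)

lemma kos_aug_wedge_Nil:
  fixes s :: "'k::field \<Rightarrow> 'v::ab_group_add \<Rightarrow> 'v"
  assumes f: "lin (Kos s 0) f" and g: "lin (Kos s 0) g"
    and eq: "\<And>a c. a \<in> Salg s \<Longrightarrow> c \<in> Salg s \<Longrightarrow> f (ktri s 0 a (wedge s 0 []) c) = g (ktri s 0 a (wedge s 0 []) c)"
    and x: "x \<in> Kos s 0"
  shows "f x = g x"
proof (rule Kos_eqI[OF f g _ x])
  fix a vs c assume "a \<in> Salg s" "length (vs :: 'v list) = 0" "c \<in> Salg s"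
  then show "f (ktri s 0 a (wedge s 0 vs) c) = g (ktri s 0 a (wedge s 0 vs) c)" using eq by simp
qed

lemma Ext_intoI:
  assumes "lin (Ext s p) f" "fn.subspace N"
    and "\<And>vs. length vs = p \<Longrightarrow> f (wedge s p vs) \<in> N" and "x \<in> Ext s p"
  shows "f x \<in> N"
  using assms linear_on_span_into[of "{wedge s p vs |vs. length vs = p}" f N x] unfolding Ext_def by auto

lemma Kos_intoI:
  assumes f: "lin (Kos s p) f" and N: "fn.subspace N"
    and into: "\<And>a vs c. a \<in> Salg s \<Longrightarrow> length vs = p \<Longrightarrow> c \<in> Salg s \<Longrightarrow> f (ktri s p a (wedge s p vs) c) \<in> N"
    and x: "x \<in> Kos s p"
  shows "f x \<in> N"
proof (rule SMS_intoI[OF f N _ x])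
  fix a w c assume a: "a \<in> Salg s" "w \<in> Ext s p" "c \<in> Salg s"
  have "(\<lambda>w. ktri s p a w c) ` Ext s p \<subseteq> Kos s p" using a by (auto intro: tri_SMS)
  from Ext_intoI[OF linear_on_comp[OF tri_lin2[OF a(1,3)] this f] N into a(2)] a
  show "f (ktri s p a w c) \<in> N" by auto
qed

lemma kos_aug_closed: "x \<in> Kos s 0 \<Longrightarrow> kos_aug s x \<in> Salg s"
  for s :: "'k::field \<Rightarrow> 'v::ab_group_add \<Rightarrow> 'v"
  by (rule Kos_intoI[where f = "kos_aug s", OF kos_aug_linear Salg_subspace])
    (simp_all add: kos_aug_ktri smul_closed)

lemma kos_d_closed: "x \<in> Kos s (Suc p) \<Longrightarrow> kos_d s (Suc p) x \<in> Kos s p"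
  for s :: "'k::field \<Rightarrow> 'v::ab_group_add \<Rightarrow> 'v"
proof (rule Kos_intoI[where f = "kos_d s (Suc p)", OF kos_d_linear SMS_subspace])
  fix a vs c assume a: "a \<in> Salg s" "length (vs :: 'v list) = Suc p" "c \<in> Salg s"
  then show "kos_d s (Suc p) (ktri s (Suc p) a (wedge s (Suc p) vs) c) \<in> Kos s p"
    unfolding kos_d_ktri[OF a(1,3)]
    by (intro SMS_sum SMS_scl SMS_diff) (auto intro!: tri_SMS smul_closed sword_Salg wedge_Ext simp: length_omit)
qed

locale smash =
  fixes s :: "'k::field \<Rightarrow> 'v::ab_group_add \<Rightarrow> 'v" and \<rho> :: "'g::{finite,group_add} \<Rightarrow> 'v \<Rightarrow> 'v"
  assumes rep: "group_rep_on s UNIV \<rho>"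
begin

abbreviation act where "act \<equiv> Sact s \<rho>"
abbreviation kact where "kact \<equiv> kos_act s \<rho>"
abbreviation L where "L p \<equiv> SMS_left s scl (Ext s p)"
abbreviation R where "R p \<equiv> SMS_right s scl (Ext s p)"
abbreviation mul where "mul \<equiv> SG_mul s \<rho>"
abbreviation GL where "GL \<equiv> KG_left s \<rho>"
abbreviation GR where "GR \<equiv> KG_right s \<rho>"
abbreviation B :: "('g \<times> ('v list \<Rightarrow> 'k) \<Rightarrow> 'k) set" where "B \<equiv> SG s"
abbreviation one :: "'g \<times> ('v list \<Rightarrow> 'k) \<Rightarrow> 'k" where "one \<equiv> SG_one s"

section \<open>The action of G on S(V), the exterior powers and the Koszul complex\<close>

lemma rho_linear: "linear_on s UNIV s (\<rho> g)"
  and rho_0: "\<rho> 0 v = v" and rho_plus: "\<rho> (g + h) v = \<rho> g (\<rho> h v)"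
  using rep by (auto simp: group_rep_on_def)

lemma rho_plus_comp: "\<rho> (g + h) = \<rho> g \<circ> \<rho> h"
  by (simp add: fun_eq_iff rho_plus)

lemma act_closed: "a \<in> Salg s \<Longrightarrow> act g a \<in> Salg s"
  by (rule Sact_closed[of s \<rho> g, OF rho_linear])
lemma act_sword: "act g (sword s vs) = sword s (map (\<rho> g) vs)"
  by (rule Sact_sword[of s \<rho> g, OF rho_linear])
lemma act_add: "act g (a + b) = act g a + act g b" and act_scl: "act g (scl c a) = scl c (act g a)"
  using Sact_linear[of UNIV s \<rho> g] by (simp_all add: linear_on_def)

lemma act_smul:
  assumes "a \<in> Salg s" "b \<in> Salg s" shows "act g (smul s a b) = smul s (act g a) (act g b)"
proof (rule Salg_eqI[of s "\<lambda>a. act g (smul s a b)" "\<lambda>a. smul s (act g a) (act g b)"])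
  show "act g (smul s (sword s xs) b) = smul s (act g (sword s xs)) (act g b)" for xs
    by (rule Salg_eqI[of s "\<lambda>b. act g (smul s (sword s xs) b)" "\<lambda>b. smul s (act g (sword s xs)) (act g b)"])
      (auto intro!: linear_on_fieldI simp: smul_lins Salg_mems assms act_closed act_add act_scl smul_sword act_sword)
qed (auto intro!: linear_on_fieldI simp: smul_lins Salg_mems assms act_closed act_add act_scl)

lemma act_id: "a \<in> Salg s \<Longrightarrow> act 0 a = a"
  by (rule Salg_eqI[of s "act 0" "\<lambda>a. a"])
    (auto intro!: linear_on_fieldI simp: act_add act_scl act_sword rho_0 map_idI)

lemma act_plus: "a \<in> Salg s \<Longrightarrow> act (g + h) a = act g (act h a)"
  by (rule Salg_eqI[of s "act (g + h)" "\<lambda>a. act g (act h a)"])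
    (auto intro!: linear_on_fieldI simp: act_add act_scl act_sword rho_plus_comp)

lemma act_one: "act g (sone s) = sone s" by (simp add: act_sword)

lemma Eact_in: "w \<in> Ext s p \<Longrightarrow> Eact s \<rho> p g w \<in> Ext s p"
  by (rule Eact_closed[of s \<rho> g, OF rho_linear])
lemma Eact_wedge': "Eact s \<rho> p g (wedge s p vs) = wedge s p (map (\<rho> g) vs)"
  by (rule Eact_wedge[of s \<rho> g, OF rho_linear])

lemma Eact_id: "w \<in> Ext s p \<Longrightarrow> Eact s \<rho> p 0 w = w"
  by (rule Ext_eqI[of s p "Eact s \<rho> p 0" "\<lambda>a. a"])
    (auto intro!: Eact_linear linear_on_fieldI simp: Eact_wedge' rho_0 map_idI)

lemma Eact_plus: "w \<in> Ext s p \<Longrightarrow> Eact s \<rho> p (g + h) w = Eact s \<rho> p g (Eact s \<rho> p h w)"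
  by (rule Ext_eqI[of s p _ "\<lambda>w. Eact s \<rho> p g (Eact s \<rho> p h w)"])
    (auto intro!: Eact_linear lin_comp[OF Eact_linear Eact_linear] simp: Eact_wedge' rho_plus_comp)

lemma kact_tri: "kact p g (ktri s p a w c) = ktri s p (act g a) (Eact s \<rho> p g w) (act g c)"
  by (rule kos_act_ktri[of s \<rho> g, OF rho_linear])

lemma kact_closed: "x \<in> Kos s p \<Longrightarrow> kact p g x \<in> Kos s p"
  by (rule SMS_intoI[OF kos_act_linear SMS_subspace]) (auto simp: kact_tri intro!: tri_SMS act_closed Eact_in)

lemma kact_id: "x \<in> Kos s p \<Longrightarrow> kact p 0 x = x"
  by (rule SMS_eqI[OF kos_act_linear linear_on_ident]) (auto simp: kact_tri act_id Eact_id)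

lemma kact_plus: "x \<in> Kos s p \<Longrightarrow> kact p (g + h) x = kact p g (kact p h x)"
  by (rule SMS_eqI[OF kos_act_linear lin_comp[OF kos_act_linear kos_act_linear]])
    (auto simp: kact_tri act_plus Eact_plus)

lemma kact_left: "x \<in> Kos s p \<Longrightarrow> f \<in> Salg s \<Longrightarrow> kact p g (L p f x) = L p (act g f) (kact p g x)"
  by (rule SMS_eqI[OF lin_comp[OF SMS_left_linear kos_act_linear]
        lin_comp[OF kos_act_linear SMS_left_linear]])
    (auto simp: kact_tri SMS_left_tri act_smul act_closed)

lemma kact_right: "x \<in> Kos s p \<Longrightarrow> f \<in> Salg s \<Longrightarrow> kact p g (R p x f) = R p (kact p g x) (act g f)"
  by (rule SMS_eqI[OF lin_comp[OF SMS_right_linear kos_act_linear]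
        lin_comp[OF kos_act_linear SMS_right_linear]])
    (auto simp: kact_tri SMS_right_tri act_smul act_closed)

lemma kos_d_left:
  "x \<in> Kos s (Suc p) \<Longrightarrow> f \<in> Salg s \<Longrightarrow> kos_d s (Suc p) (L (Suc p) f x) = L p f (kos_d s (Suc p) x)"
proof (rule Kos_eqI[OF lin_comp[OF SMS_left_linear kos_d_linear]
        lin_comp[OF kos_d_linear SMS_left_linear]])
  fix a vs c assume a: "f \<in> Salg s" "a \<in> Salg s" "length (vs :: 'v list) = Suc p" "c \<in> Salg s"
  show "kos_d s (Suc p) (L (Suc p) f (ktri s (Suc p) a (wedge s (Suc p) vs) c)) =
    L p f (kos_d s (Suc p) (ktri s (Suc p) a (wedge s (Suc p) vs) c))"
    using a by (simp add: SMS_left_tri kos_d_ktri smul_closed SMS_left_sum SMS_left_diff SMS_left_scl smul_assoc sword_Salg del: sum.lessThan_Suc)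
qed

lemma kos_d_right:
  "x \<in> Kos s (Suc p) \<Longrightarrow> f \<in> Salg s \<Longrightarrow> kos_d s (Suc p) (R (Suc p) x f) = R p (kos_d s (Suc p) x) f"
proof (rule Kos_eqI[OF lin_comp[OF SMS_right_linear kos_d_linear]
        lin_comp[OF kos_d_linear SMS_right_linear]])
  fix a vs c assume a: "f \<in> Salg s" "a \<in> Salg s" "length (vs :: 'v list) = Suc p" "c \<in> Salg s"
  show "kos_d s (Suc p) (R (Suc p) (ktri s (Suc p) a (wedge s (Suc p) vs) c) f) =
    R p (kos_d s (Suc p) (ktri s (Suc p) a (wedge s (Suc p) vs) c)) f"
    using a by (simp add: SMS_right_tri kos_d_ktri smul_closed SMS_right_sum SMS_right_diff SMS_right_scl smul_assoc sword_Salg del: sum.lessThan_Suc)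
qed

lemma omit_map: "omit i (map f xs) = map f (omit i xs)"
  by (simp add: omit_def take_map drop_map)

lemma kos_d_kact:
  "x \<in> Kos s (Suc p) \<Longrightarrow> kos_d s (Suc p) (kact (Suc p) g x) = kact p g (kos_d s (Suc p) x)"
proof (rule Kos_eqI[OF lin_comp[OF kos_act_linear kos_d_linear]
        lin_comp[OF kos_d_linear kos_act_linear]])
  fix a vs c assume a: "a \<in> Salg s" "length (vs :: 'v list) = Suc p" "c \<in> Salg s"
  show "kos_d s (Suc p) (kact (Suc p) g (ktri s (Suc p) a (wedge s (Suc p) vs) c)) =
    kact p g (kos_d s (Suc p) (ktri s (Suc p) a (wedge s (Suc p) vs) c))"
    using a by (simp add: kact_tri kos_d_ktri act_closed kos_act_sum kos_act_diff kos_act_scl Eact_wedge'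
        act_smul sword_Salg act_sword omit_map del: sum.lessThan_Suc)
qed

lemma kos_aug_left: "x \<in> Kos s 0 \<Longrightarrow> f \<in> Salg s \<Longrightarrow> kos_aug s (L 0 f x) = smul s f (kos_aug s x)"
  by (rule kos_aug_wedge_Nil[OF lin_comp[OF SMS_left_linear kos_aug_linear]
        linear_on_comp[OF kos_aug_linear _ smul_linear_right]])
    (auto simp: SMS_left_tri kos_aug_ktri smul_closed smul_assoc kos_aug_closed)

lemma kos_aug_right: "x \<in> Kos s 0 \<Longrightarrow> f \<in> Salg s \<Longrightarrow> kos_aug s (R 0 x f) = smul s (kos_aug s x) f"
  by (rule kos_aug_wedge_Nil[OF lin_comp[OF SMS_right_linear kos_aug_linear]
        lin_comp[OF kos_aug_linear smul_linear_left]])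
    (auto simp: SMS_right_tri kos_aug_ktri smul_closed smul_assoc)

lemma kos_aug_kact: "x \<in> Kos s 0 \<Longrightarrow> kos_aug s (kact 0 g x) = act g (kos_aug s x)"
  by (rule kos_aug_wedge_Nil[OF lin_comp[OF kos_act_linear kos_aug_linear]
        lin_comp[OF kos_aug_linear Sact_linear]])
    (auto simp: kact_tri Eact_wedge' kos_aug_ktri act_smul act_closed)

subsection \<open>The algebra\<close>

lemma mul_rtimes: "a \<in> Salg s \<Longrightarrow> mul (rtimes a g) (rtimes b h) = rtimes (smul s a (act g b)) (g + h)"
  by (rule SG_mul_rtimes)

lemma SG_subspace: "fn.subspace B" unfolding SG_def by (rule Rtimes_subspace[OF Salg_subspace])
lemma SG_add: "x \<in> B \<Longrightarrow> y \<in> B \<Longrightarrow> x + y \<in> B" and SG_scl: "x \<in> B \<Longrightarrow> scl c x \<in> B"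
  and SG_diff: "x \<in> B \<Longrightarrow> y \<in> B \<Longrightarrow> x - y \<in> B"
  and SG_sum: "(\<And>i. i \<in> I \<Longrightarrow> F i \<in> B) \<Longrightarrow> (\<Sum>i\<in>I. F i) \<in> B"
  using SG_subspace by (auto intro: fn.subspace_add fn.subspace_scale fn.subspace_diff fn.subspace_sum)
lemma mul_closed: "x \<in> B \<Longrightarrow> y \<in> B \<Longrightarrow> mul x y \<in> B"
  by (rule SG_mul_closed[of s \<rho>, OF rho_linear])
lemma one_SG: "one \<in> B" by (rule rtimes_SG[OF sword_Salg])

lemmas SG_mems = SG_add SG_scl SG_diff SG_sum mul_closed one_SG rtimes_SG sword_Salg act_closed smul_closed

lemmas mul_linear_left = SG_mul_linear_left[of _ s \<rho>]
lemmas mul_linear_right = SG_mul_linear_right[of s \<rho>, OF rho_linear]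

lemma mul_add_left: "mul (a + a') b = mul a b + mul a' b" and mul_scl_left: "mul (scl c a) b = scl c (mul a b)"
  using mul_linear_left[of UNIV b] by (simp_all add: linear_on_def)
lemma mul_add_right: "a \<in> B \<Longrightarrow> b \<in> B \<Longrightarrow> b' \<in> B \<Longrightarrow> mul a (b + b') = mul a b + mul a b'"
  and mul_scl_right: "a \<in> B \<Longrightarrow> b \<in> B \<Longrightarrow> mul a (scl c b) = scl c (mul a b)"
  using mul_linear_right[of a] by (simp_all add: linear_on_def)
lemmas mul_lins = mul_add_left mul_scl_left mul_add_right mul_scl_right
lemma mul_diff_left: "mul (a - a') b = mul a b - mul a' b"
  by (rule lin_diff[OF mul_linear_left])
lemma mul_diff_right: "a \<in> B \<Longrightarrow> b \<in> B \<Longrightarrow> b' \<in> B \<Longrightarrow> mul a (b - b') = mul a b - mul a b'"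
  using linear_on_image_diff[OF mul_linear_right SG_subspace] by simp
lemma SG_eqI:
  assumes "lin B f" "lin B f'"
    and "\<And>m g. m \<in> Salg s \<Longrightarrow> f (rtimes m g) = f' (rtimes m g)" and "x \<in> B"
  shows "f x = f' x"
  using assms Rtimes_eqI[OF Salg_subspace] unfolding SG_def by blast

text \<open>On pure elements both sides are a g(b) gh(c) \<rtimes> ghk, since G acts by algebra
  automorphisms; the rest is linearity in each argument separately.\<close>

lemma mul_assoc:
  assumes "a \<in> B" "b \<in> B" "c \<in> B"
  shows "mul (mul a b) c = mul a (mul b c)"
proof (rule SG_eqI[of "\<lambda>a. mul (mul a b) c" "\<lambda>a. mul a (mul b c)"])
  fix a and g :: 'g assume a: "a \<in> Salg s"
  show "mul (mul (rtimes a g) b) c = mul (rtimes a g) (mul b c)"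
  proof (rule SG_eqI[of "\<lambda>b. mul (mul (rtimes a g) b) c" "\<lambda>b. mul (rtimes a g) (mul b c)"])
    fix b and h :: 'g assume b: "b \<in> Salg s"
    show "mul (mul (rtimes a g) (rtimes b h)) c = mul (rtimes a g) (mul (rtimes b h) c)"
      by (rule SG_eqI[of _ "\<lambda>c. mul (rtimes a g) (mul (rtimes b h) c)"])
        (auto intro!: linear_on_fieldI simp: mul_lins SG_mems assms a b mul_rtimes act_smul smul_assoc act_plus add.assoc)
  qed (auto intro!: linear_on_fieldI simp: mul_lins SG_mems assms a)
qed (auto intro!: linear_on_fieldI simp: mul_lins SG_mems assms)

lemma mul_one_left: "a \<in> B \<Longrightarrow> mul one a = a"
  by (rule SG_eqI[of "mul one" "\<lambda>a. a"])
    (auto intro!: linear_on_fieldI simp: mul_lins SG_mems mul_rtimes smul_one_left act_id)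

lemma mul_one_right: "a \<in> B \<Longrightarrow> mul a one = a"
  by (rule SG_eqI[of "\<lambda>a. mul a one" "\<lambda>a. a"])
    (auto intro!: linear_on_fieldI simp: mul_lins SG_mems mul_rtimes smul_one_right act_one)

subsection \<open>The bimodules\<close>

lemma KG_subspace: "fn.subspace (KG s p)" by (rule Rtimes_subspace[OF SMS_subspace])

lemma GL_rtimes:
  assumes f: "f \<in> Salg s" and x: "x \<in> Kos s p"
  shows "GL p (rtimes f g) (rtimes x h) = rtimes (L p f (kact p g x)) (g + h)"
proof -
  \<comment> \<open>The test of the inner summation variable stands outermost, so that the sums
    collapse one after the other by the rule for a sum with a single nonzero term.\<close>
  have "GL p (rtimes f g) (rtimes x h) = (\<Sum>g'\<in>UNIV. \<Sum>h'\<in>UNIV.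
      if h' = h then (if g' = g then rtimes (L p f (kact p g x)) (g + h) else 0) else 0)"
    unfolding KG_left_def
    by (intro sum.cong refl)
      (auto simp: component_rtimes SMS_left_0_left SMS_left_0 kos_act_0 kact_closed[OF x] rtimes_0 SMS_0)
  then show ?thesis by simp
qed

lemma GR_rtimes:
  assumes f: "f \<in> Salg s" and x: "x \<in> Kos s p"
  shows "GR p (rtimes x h) (rtimes f g) = rtimes (R p x (act h f)) (h + g)"
proof -
  have "GR p (rtimes x h) (rtimes f g) = (\<Sum>h'\<in>UNIV. \<Sum>g'\<in>UNIV.
      if g' = g then (if h' = h then rtimes (R p x (act h f)) (h + g) else 0) else 0)"
    unfolding KG_right_def
    by (intro sum.cong refl)
      (auto simp: component_rtimes SMS_right_0_right SMS_right_0 Sact_0 x rtimes_0 SMS_0)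
  then show ?thesis by simp
qed

lemma rtimes_KG: "x \<in> Kos s p \<Longrightarrow> rtimes x g \<in> KG s p" by (rule rtimes_Rtimes[OF SMS_subspace])
lemma KG_component: "x \<in> KG s p \<Longrightarrow> component x g \<in> Kos s p" by (simp add: Rtimes_def)
lemma SG_component: "b \<in> B \<Longrightarrow> component b g \<in> Salg s" by (simp add: SG_def Rtimes_def)

lemma GL_linear: "lin A (GL p b)"
  by (simp add: linear_on_def KG_left_def component_add component_scl kos_act_add kos_act_scl SMS_left_add SMS_left_scl
      rtimes_add rtimes_scl sum.distrib fn.scale_sum_right)
lemma GR_linear: "lin A (\<lambda>x. GR p x b)"
  by (simp add: linear_on_def KG_right_def component_add component_scl SMS_right_add SMS_right_scl
      rtimes_add rtimes_scl sum.distrib fn.scale_sum_right)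
lemma GL_linear_left: "x \<in> KG s p \<Longrightarrow> lin B (\<lambda>b. GL p b x)"
  by (simp add: linear_on_def KG_left_def component_add component_scl SMS_left_add_left SMS_left_scl_left
      rtimes_add rtimes_scl sum.distrib fn.scale_sum_right kact_closed KG_component SG_component)
lemma GR_linear_right: "x \<in> KG s p \<Longrightarrow> lin B (GR p x)"
  by (simp add: linear_on_def KG_right_def component_add component_scl SMS_right_add_right SMS_right_scl_right
      act_add act_scl act_closed rtimes_add rtimes_scl sum.distrib fn.scale_sum_right KG_component SG_component)

lemma GL_closed: "b \<in> B \<Longrightarrow> x \<in> KG s p \<Longrightarrow> GL p b x \<in> KG s p"
  unfolding KG_left_def
  by (intro fn.subspace_sum[OF KG_subspace] rtimes_KG SMS_left_closed kact_closed KG_component SG_component)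
lemma GR_closed: "b \<in> B \<Longrightarrow> x \<in> KG s p \<Longrightarrow> GR p x b \<in> KG s p"
  unfolding KG_right_def
  by (intro fn.subspace_sum[OF KG_subspace] rtimes_KG SMS_right_closed act_closed KG_component SG_component)

lemma KG_add: "x \<in> KG s p \<Longrightarrow> y \<in> KG s p \<Longrightarrow> x + y \<in> (KG s p :: ('g \<times> _ \<Rightarrow> 'k) set)"
  and KG_scl: "x \<in> KG s p \<Longrightarrow> scl c x \<in> (KG s p :: ('g \<times> _ \<Rightarrow> 'k) set)"
  and KG_diff: "x \<in> KG s p \<Longrightarrow> y \<in> KG s p \<Longrightarrow> x - y \<in> (KG s p :: ('g \<times> _ \<Rightarrow> 'k) set)"
  using KG_subspace by (auto intro: fn.subspace_add fn.subspace_scale fn.subspace_diff)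

lemma KG_lins:
  "GL p b (x + y) = GL p b x + GL p b y" "GL p b (scl c x) = scl c (GL p b x)"
  "GR p (x + y) b = GR p x b + GR p y b" "GR p (scl c x) b = scl c (GR p x b)"
  "x \<in> KG s p \<Longrightarrow> a \<in> B \<Longrightarrow> b \<in> B \<Longrightarrow> GL p (a + b) x = GL p a x + GL p b x"
  "x \<in> KG s p \<Longrightarrow> a \<in> B \<Longrightarrow> GL p (scl c a) x = scl c (GL p a x)"
  "x \<in> KG s p \<Longrightarrow> a \<in> B \<Longrightarrow> b \<in> B \<Longrightarrow> GR p x (a + b) = GR p x a + GR p x b"
  "x \<in> KG s p \<Longrightarrow> a \<in> B \<Longrightarrow> GR p x (scl c a) = scl c (GR p x a)"
  using GL_linear[of UNIV p b] GR_linear[of UNIV p b] GL_linear_left[of x p] GR_linear_right[of x p]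
  by (simp_all add: linear_on_def)

lemma GL_diff: "GL p b (x - y) = GL p b x - GL p b y" and GR_diff: "GR p (x - y) b = GR p x b - GR p y b"
  by (rule lin_diff[OF GL_linear] lin_diff[OF GR_linear])+

lemmas KG_mems = KG_add KG_scl KG_diff GL_closed GR_closed rtimes_KG kact_closed SMS_mems

lemma KG_eqI:
  assumes "lin (KG s p) f" "lin (KG s p) f'"
    and "\<And>m g. m \<in> Kos s p \<Longrightarrow> f (rtimes m (g::'g)) = f' (rtimes m g)" and "x \<in> KG s p"
  shows "f x = f' x"
  using assms Rtimes_eqI[OF SMS_subspace] by blast

lemma GL_mul:
  assumes "x \<in> KG s p" "a \<in> B" "b \<in> B"
  shows "GL p (mul a b) x = GL p a (GL p b x)"
proof (rule SG_eqI[of "\<lambda>a. GL p (mul a b) x" "\<lambda>a. GL p a (GL p b x)"])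
  fix a and g :: 'g assume a: "a \<in> Salg s"
  show "GL p (mul (rtimes a g) b) x = GL p (rtimes a g) (GL p b x)"
  proof (rule SG_eqI[of "\<lambda>b. GL p (mul (rtimes a g) b) x" "\<lambda>b. GL p (rtimes a g) (GL p b x)"])
    fix b and h :: 'g assume b: "b \<in> Salg s"
    show "GL p (mul (rtimes a g) (rtimes b h)) x = GL p (rtimes a g) (GL p (rtimes b h) x)"
      by (rule KG_eqI[of p _ "\<lambda>x. GL p (rtimes a g) (GL p (rtimes b h) x)"])
        (auto intro!: linear_on_fieldI simp: KG_lins SG_mems KG_mems assms a b mul_rtimes GL_rtimes SMS_left_smul
          kact_left kact_plus add.assoc)
  qed (auto intro!: linear_on_fieldI simp: KG_lins mul_lins KG_mems SG_mems assms a)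
qed (auto intro!: linear_on_fieldI simp: KG_lins mul_lins KG_mems SG_mems assms)

lemma GR_mul:
  assumes "x \<in> KG s p" "a \<in> B" "b \<in> B"
  shows "GR p x (mul a b) = GR p (GR p x a) b"
proof (rule SG_eqI[of "\<lambda>a. GR p x (mul a b)" "\<lambda>a. GR p (GR p x a) b"])
  fix a and g :: 'g assume a: "a \<in> Salg s"
  show "GR p x (mul (rtimes a g) b) = GR p (GR p x (rtimes a g)) b"
  proof (rule SG_eqI[of "\<lambda>b. GR p x (mul (rtimes a g) b)" "\<lambda>b. GR p (GR p x (rtimes a g)) b"])
    fix b and h :: 'g assume b: "b \<in> Salg s"
    show "GR p x (mul (rtimes a g) (rtimes b h)) = GR p (GR p x (rtimes a g)) (rtimes b h)"
      by (rule KG_eqI[of p _ "\<lambda>x. GR p (GR p x (rtimes a g)) (rtimes b h)"])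
        (auto intro!: linear_on_fieldI simp: KG_lins SG_mems KG_mems assms a b mul_rtimes GR_rtimes SMS_right_smul
          act_smul act_plus add.assoc)
  qed (auto intro!: linear_on_fieldI simp: KG_lins mul_lins KG_mems SG_mems assms a)
qed (auto intro!: linear_on_fieldI simp: KG_lins mul_lins KG_mems SG_mems assms)

lemma GL_GR:
  assumes "x \<in> KG s p" "a \<in> B" "b \<in> B"
  shows "GL p a (GR p x b) = GR p (GL p a x) b"
proof (rule SG_eqI[of "\<lambda>a. GL p a (GR p x b)" "\<lambda>a. GR p (GL p a x) b"])
  fix a and g :: 'g assume a: "a \<in> Salg s"
  show "GL p (rtimes a g) (GR p x b) = GR p (GL p (rtimes a g) x) b"
  proof (rule SG_eqI[of "\<lambda>b. GL p (rtimes a g) (GR p x b)" "GR p (GL p (rtimes a g) x)"])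
    fix b and h :: 'g assume b: "b \<in> Salg s"
    show "GL p (rtimes a g) (GR p x (rtimes b h)) = GR p (GL p (rtimes a g) x) (rtimes b h)"
      by (rule KG_eqI[of p "\<lambda>x. GL p (rtimes a g) (GR p x (rtimes b h))" "\<lambda>x. GR p (GL p (rtimes a g) x) (rtimes b h)"])
        (auto intro!: linear_on_fieldI simp: KG_lins SG_mems KG_mems assms a b GL_rtimes GR_rtimes kact_right
          SMS_left_right act_plus add.assoc)
  qed (auto intro!: linear_on_fieldI simp: KG_lins mul_lins KG_mems SG_mems assms a)
qed (auto intro!: linear_on_fieldI simp: KG_lins mul_lins KG_mems SG_mems assms)

section \<open>The differential and the augmentation of the smash product are bimodule maps\<close>

lemma KG_d_rtimes: "KG_d s p (rtimes x g) = rtimes (kos_d s p x) g"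
  by (simp add: KG_d_def rtimes_map_rtimes kos_d_0)
lemma KG_aug_rtimes: "KG_aug s (rtimes x g) = rtimes (kos_aug s x) g"
  by (simp add: KG_aug_def rtimes_map_rtimes kos_aug_0)

lemma Rtimes_UNIV: "Rtimes UNIV = UNIV" by (simp add: Rtimes_def)
lemma KG_d_linear: "lin A (KG_d s p)"
  unfolding KG_d_def by (rule linear_on_subset[OF rtimes_map_linear[where M = UNIV, OF kos_d_linear]]) (simp add: Rtimes_UNIV)
lemma KG_aug_linear: "lin A (KG_aug s)"
  unfolding KG_aug_def by (rule linear_on_subset[OF rtimes_map_linear[where M = UNIV, OF kos_aug_linear]]) (simp add: Rtimes_UNIV)

lemma KG_d_closed: "x \<in> KG s (Suc p) \<Longrightarrow> KG_d s (Suc p) x \<in> KG s p"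
  unfolding KG_d_def by (rule rtimes_map_into[OF kos_d_closed])
lemma KG_aug_closed: "x \<in> KG s 0 \<Longrightarrow> KG_aug s x \<in> SG s"
  unfolding KG_aug_def SG_def by (rule rtimes_map_into[OF kos_aug_closed])

lemma KG_d_left:
  assumes "x \<in> KG s (Suc p)" "b \<in> B"
  shows "KG_d s (Suc p) (GL (Suc p) b x) = GL p b (KG_d s (Suc p) x)"
proof (rule SG_eqI[of "\<lambda>b. KG_d s (Suc p) (GL (Suc p) b x)" "\<lambda>b. GL p b (KG_d s (Suc p) x)"])
  fix b and g :: 'g assume b: "b \<in> Salg s"
  show "KG_d s (Suc p) (GL (Suc p) (rtimes b g) x) = GL p (rtimes b g) (KG_d s (Suc p) x)"
    by (rule KG_eqI[OF lin_comp[OF GL_linear KG_d_linear]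
          lin_comp[OF KG_d_linear GL_linear] _ assms(1)])
      (simp add: GL_rtimes KG_d_rtimes b kos_d_left kact_closed kos_d_closed kos_d_kact)
qed (auto intro!: lin_comp[OF GL_linear_left KG_d_linear] GL_linear_left assms KG_d_closed)

lemma KG_d_right:
  assumes "x \<in> KG s (Suc p)" "b \<in> B"
  shows "KG_d s (Suc p) (GR (Suc p) x b) = GR p (KG_d s (Suc p) x) b"
proof (rule SG_eqI[of "\<lambda>b. KG_d s (Suc p) (GR (Suc p) x b)" "GR p (KG_d s (Suc p) x)"])
  fix b and g :: 'g assume b: "b \<in> Salg s"
  show "KG_d s (Suc p) (GR (Suc p) x (rtimes b g)) = GR p (KG_d s (Suc p) x) (rtimes b g)"
    by (rule KG_eqI[OF lin_comp[OF GR_linear KG_d_linear]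
          lin_comp[OF KG_d_linear GR_linear] _ assms(1)])
      (simp add: GR_rtimes KG_d_rtimes b kos_d_right act_closed kos_d_closed)
qed (auto intro!: lin_comp[OF GR_linear_right KG_d_linear] GR_linear_right assms KG_d_closed)

lemma KG_aug_left:
  assumes "x \<in> KG s 0" "b \<in> B"
  shows "KG_aug s (GL 0 b x) = mul b (KG_aug s x)"
proof (rule SG_eqI[of "\<lambda>b. KG_aug s (GL 0 b x)" "\<lambda>b. mul b (KG_aug s x)"])
  fix b and g :: 'g assume b: "b \<in> Salg s"
  show "KG_aug s (GL 0 (rtimes b g) x) = mul (rtimes b g) (KG_aug s x)"
    by (rule KG_eqI[OF lin_comp[OF GL_linear KG_aug_linear]
          linear_on_comp[OF KG_aug_linear _ mul_linear_right] _ assms(1)])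
      (auto simp: GL_rtimes KG_aug_rtimes b kos_aug_left kact_closed kos_aug_kact mul_rtimes KG_aug_closed rtimes_SG)
qed (auto intro!: lin_comp[OF GL_linear_left KG_aug_linear] mul_linear_left assms)

lemma KG_aug_right:
  assumes "x \<in> KG s 0" "b \<in> B"
  shows "KG_aug s (GR 0 x b) = mul (KG_aug s x) b"
proof (rule SG_eqI[of "\<lambda>b. KG_aug s (GR 0 x b)" "mul (KG_aug s x)"])
  fix b and g :: 'g assume b: "b \<in> Salg s"
  show "KG_aug s (GR 0 x (rtimes b g)) = mul (KG_aug s x) (rtimes b g)"
    by (rule KG_eqI[OF lin_comp[OF GR_linear KG_aug_linear]
          lin_comp[OF KG_aug_linear mul_linear_left] _ assms(1)])
      (auto simp: GR_rtimes KG_aug_rtimes b kos_aug_right act_closed mul_rtimes kos_aug_closed)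
qed (auto intro!: lin_comp[OF GR_linear_right KG_aug_linear] mul_linear_right assms KG_aug_closed)

end


section \<open>Exactness of the Koszul complex\<close>

lemma Salg_intoI:
  assumes "lin (Salg s) f" "fn.subspace N"
    and "\<And>vs. f (sword s vs) \<in> N" and "x \<in> Salg s"
  shows "f x \<in> N"
  using assms linear_on_span_into[of "range (sword s)" f N x] unfolding Salg_def by auto

lemma scl_lin_simps: "scl c (x + y) = scl c x + scl c y" "scl c (x - y) = scl c x - scl c y"
  by (simp_all add: fn.scale_right_distrib fn.scale_right_diff_distrib)

lemma kos_d_scl: "kos_d s p (scl c x) = scl c (kos_d s p x)"
  and kos_d_add: "kos_d s p (x + y) = kos_d s p x + kos_d s p y"
  by (simp_all add: kos_d_def lext_add lext_scl)

lemma omit_Cons: "omit 0 (x # xs) = xs" "omit (Suc i) (x # xs) = x # omit i xs"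
  by (simp_all add: omit_def)

text \<open>Exterior multiplication by \<open>v\<close> from the left. With \<open>v = b\<close> it
  is the exterior part of the homotopy in the direction \<open>b\<close>.\<close>

definition lwedge where
  "lwedge s p v = lext (\<lambda>vs. wedge s (Suc p) (v # vs))"

lemma lwedge_linear: "lin A (lwedge s p v)"
  unfolding lwedge_def by (rule linear_on_lext)

lemma lwedge_wedge: "lwedge s p v (wedge s p vs) = wedge s (Suc p) (v # vs)"
  unfolding lwedge_def
proof (rule lext_wedge_fun)
  show "linear_on s UNIV scl (\<lambda>x. wedge s (Suc p) (v # us @ [x] @ vs))" if "length us + length vs + 1 = p" for us vs
    using wedge_linear[of "v # us" vs "Suc p" s] that by simp
  show "wedge s (Suc p) (v # us @ [x, x] @ vs) = 0" if "length us + length vs + 2 = p" for us x vs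
    using wedge_repeat[of "v # us" vs "Suc p" s x] that by simp
qed

lemma lwedge_closed: "w \<in> Ext s p \<Longrightarrow> lwedge s p v w \<in> Ext s (Suc p)"
  by (rule Ext_intoI[where f = "lwedge s p v", OF lwedge_linear Ext_subspace]) (simp_all add: lwedge_wedge wedge_Ext)

lemma lwedge_sum: "lwedge s p v (\<Sum>i\<in>I. f i) = (\<Sum>i\<in>I. lwedge s p v (f i))"
  and lwedge_diff: "lwedge s p v (x - y) = lwedge s p v x - lwedge s p v y"
  and lwedge_scl: "lwedge s p v (scl c x) = scl c (lwedge s p v x)"
  using lin_sum[OF lwedge_linear] lin_diff[OF lwedge_linear]
    lwedge_linear[of UNIV s p v] by (auto simp: linear_on_def)

lemma wedge_linear_hd: "length vs = p \<Longrightarrow> linear_on s UNIV scl (\<lambda>x. wedge s (Suc p) (x # vs))"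
  using wedge_linear[of "[]" vs "Suc p" s] by simp

text \<open>Expanding the product multilinearly, a term with two factors \<open>b\<close> vanishes,
  so \<open>b\<close> occurs at most once; moving it to the front from position \<open>i\<close>
  gives the sign. The sum is \<open>b\<close> wedged with the contraction of the word by
  \<beta>.\<close>

lemma (in vector_space) wedge_map_projection:
  fixes \<beta> :: "'b \<Rightarrow> 'a"
  shows "wedge scale (length vs) (map (\<lambda>v. v - scale (\<beta> v) b) vs) = wedge scale (length vs) vs -
    (\<Sum>i<length vs. scl ((-1) ^ i * \<beta> (vs ! i)) (wedge scale (length vs) (b # omit i vs)))"
proof (induction vs)
  case (Cons v vs)
  let ?p = "length vs" and ?pi = "\<lambda>v. v - scale (\<beta> v) b"
  have om: "length (omit i vs) = ?p - 1" if "i < ?p" for i using that by (rule length_omit)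
  have l: "wedge scale (Suc ?p) (?pi v # us) = wedge scale (Suc ?p) (v # us) - scl (\<beta> v) (wedge scale (Suc ?p) (b # us))"
    if "length us = ?p" for us
    using wedge_linear_hd[OF that, of scale] unfolding linear_on_def
    by (metis (no_types, lifting) UNIV_I add_diff_cancel diff_add_cancel)
  have sw: "wedge scale (Suc ?p) (v # b # omit i vs) = - wedge scale (Suc ?p) (b # v # omit i vs)"
    and rp: "wedge scale (Suc ?p) (b # b # omit i vs) = 0" if "i < ?p" for i
    using wedge_swap[of "[]" "omit i vs" "Suc ?p" scale v b] wedge_repeat[of "[]" "omit i vs" "Suc ?p" scale b] that om[OF that]
    by auto
  \<comment> \<open>Each correction term already contains \<open>b\<close>, so wedging the inductive
    formula with \<open>b\<close> kills all of them.\<close>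
  have lb: "lwedge scale ?p b (wedge scale ?p (map ?pi vs)) = wedge scale (Suc ?p) (b # vs)"
    by (simp add: Cons.IH lwedge_diff lwedge_sum lwedge_scl rp lwedge_wedge)
  have lv: "lwedge scale ?p v (wedge scale ?p (map ?pi vs)) = wedge scale (Suc ?p) (v # vs) +
      (\<Sum>i<?p. scl ((-1) ^ i * \<beta> (vs ! i)) (wedge scale (Suc ?p) (b # v # omit i vs)))"
    by (simp add: Cons.IH lwedge_diff lwedge_sum lwedge_scl sw lwedge_wedge fn.scale_minus_right sum_negf)
  have "wedge scale (Suc ?p) (map ?pi (v # vs)) =
      wedge scale (Suc ?p) (v # map ?pi vs) - scl (\<beta> v) (wedge scale (Suc ?p) (b # map ?pi vs))"
    using l[of "map ?pi vs"] by simp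
  also have "\<dots> = wedge scale (Suc ?p) (v # vs) +
      (\<Sum>i<?p. scl ((-1) ^ i * \<beta> (vs ! i)) (wedge scale (Suc ?p) (b # v # omit i vs)))
      - scl (\<beta> v) (wedge scale (Suc ?p) (b # vs))"
    using lb lv by (simp only: lwedge_wedge)
  also have "\<dots> = wedge scale (Suc ?p) (v # vs) -
      (\<Sum>i<Suc ?p. scl ((-1) ^ i * \<beta> ((v # vs) ! i)) (wedge scale (Suc ?p) (b # omit i (v # vs))))"
    unfolding sum.lessThan_Suc_shift by (simp add: omit_def fn.scale_minus_left sum_negf algebra_simps)
  finally show ?case by simp
qed simp

locale fin_smash = smash s \<rho> + V: finite_dimensional_vector_space s basis
  for s :: "'k::field \<Rightarrow> 'v::ab_group_add \<Rightarrow> 'v" and \<rho> :: "'g::{finite,group_add} \<Rightarrow> 'v \<Rightarrow> 'v" and basis :: "'v set"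
begin

section \<open>Coordinates and polynomial operators on the Koszul complex\<close>

definition coord :: "'v \<Rightarrow> 'v \<Rightarrow> 'k" where "coord b v = V.representation basis v b"

lemma coord_linear: "linear_on s UNIV (*) (coord b)"
  by (simp add: linear_on_def coord_def V.representation_add V.representation_scale V.independent_Basis V.span_Basis)
lemma coord_add: "coord b (v + w) = coord b v + coord b w" and coord_scale: "coord b (s c v) = c * coord b v"
  using coord_linear by (auto simp: linear_on_def)
lemma coord_diff: "coord b (v - w) = coord b v - coord b w"
  using coord_add[of b "v - w" w] by simp
lemma coord_basis: "b \<in> basis \<Longrightarrow> b' \<in> basis \<Longrightarrow> coord b b' = (if b = b' then 1 else 0)"
  by (auto simp: coord_def V.representation_basis V.independent_Basis)
lemma coord_eq_0: "(\<And>b. b \<in> basis \<Longrightarrow> coord b v = 0) \<Longrightarrow> v = 0"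
  using V.sum_nonzero_representation_eq[OF V.independent_Basis, of v] V.representation_ne_zero[of basis v]
  by (simp add: V.span_Basis coord_def)

text \<open>\<open>X\<close> and \<open>Y\<close> are multiplication by the variables x_v and y_v of
  S(V) \<otimes> S(V). The Koszul differential only involves the elements \<open>Z\<close>, that is
  x_v - y_v.\<close>

abbreviation X where "X p v x \<equiv> L p (svec s v) x"
abbreviation Y where "Y p v x \<equiv> R p x (svec s v)"
abbreviation Z where "Z p v x \<equiv> X p v x - Y p v x"

abbreviation kword where "kword p as vs cs \<equiv> ktri s p (sword s as) (wedge s p vs) (sword s cs)"
abbreviation kgen where "kgen p vs \<equiv> kword p [] vs []"

lemma kgen_closed: "length vs = p \<Longrightarrow> kgen p vs \<in> Kos s p" by (intro tri_SMS sword_Salg wedge_Ext)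

text \<open>
  On \<open>S(V) \<otimes> S(V) = k[x,y]\<close>, \<open>qop b\<close> is multiplication by the image of a word in the
  variables \<open>y\<close> under the substitution \<open>y\<^sub>b \<mapsto> x\<^sub>b\<close>, and \<open>dop b\<close> multiplication by the divided
  difference of the word in the direction of \<open>b\<close>.
\<close>

primrec qop where
  "qop p b [] x = x"
| "qop p b (v # cs) x = Y p v (qop p b cs x) + scl (coord b v) (Z p b (qop p b cs x))"

primrec dop where
  "dop p b [] x = 0"
| "dop p b (v # cs) x = Y p v (dop p b cs x) - scl (coord b v) (qop p b cs x)"

lemma qop_closed: "x \<in> Kos s p \<Longrightarrow> qop p b cs x \<in> Kos s p"
  by (induction cs) (auto intro!: SMS_mems sword_Salg)
lemma dop_closed: "x \<in> Kos s p \<Longrightarrow> dop p b cs x \<in> Kos s p"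
  by (induction cs) (auto intro!: SMS_mems sword_Salg qop_closed)

lemma qop_add: "qop p b cs (x + y) = qop p b cs x + qop p b cs y"
  and qop_scl: "qop p b cs (scl c x) = scl c (qop p b cs x)"
  by (induction cs) (simp_all add: SMS_left_add SMS_right_add SMS_left_scl SMS_right_scl scl_lin_simps mult.commute)
lemma qop_linear: "lin A (qop p b cs)" by (simp add: linear_on_def qop_add qop_scl)
lemma dop_add: "dop p b cs (x + y) = dop p b cs x + dop p b cs y"
  and dop_scl: "dop p b cs (scl c x) = scl c (dop p b cs x)"
  by (induction cs) (simp_all add: SMS_left_add SMS_right_add SMS_left_scl SMS_right_scl scl_lin_simps qop_add qop_scl mult.commute)
lemma dop_linear: "lin A (dop p b cs)" by (simp add: linear_on_def dop_add dop_scl)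

lemma dop_diff: "dop p b cs (x - y) = dop p b cs x - dop p b cs y"
  and qop_diff: "qop p b cs (x - y) = qop p b cs x - qop p b cs y"
  by (rule lin_diff[OF dop_linear] lin_diff[OF qop_linear])+
lemma dop_sum: "dop p b cs (\<Sum>i\<in>I. f i) = (\<Sum>i\<in>I. dop p b cs (f i))"
  and qop_sum: "qop p b cs (\<Sum>i\<in>I. f i) = (\<Sum>i\<in>I. qop p b cs (f i))"
  by (rule lin_sum[OF dop_linear] lin_sum[OF qop_linear])+

lemma Y_commute: "x \<in> Kos s p \<Longrightarrow> Y p v (Y p w x) = Y p w (Y p v x)"
  using smul_commute[OF sword_Salg sword_Salg, of s "[v]" "[w]"]
  by (simp add: sword_Salg flip: SMS_right_smul)
lemma X_commute: "x \<in> Kos s p \<Longrightarrow> f \<in> Salg s \<Longrightarrow> L p f (X p w x) = X p w (L p f x)"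
  by (simp add: sword_Salg smul_commute flip: SMS_left_smul)
lemma Y_left: "x \<in> Kos s p \<Longrightarrow> f \<in> Salg s \<Longrightarrow> L p f (Y p w x) = Y p w (L p f x)"
  by (simp add: sword_Salg SMS_left_right)

lemmas K_lins = SMS_left_add SMS_right_add SMS_left_diff SMS_right_diff SMS_left_scl SMS_right_scl scl_lin_simps

lemma qop_left: "x \<in> Kos s p \<Longrightarrow> f \<in> Salg s \<Longrightarrow> qop p b cs (L p f x) = L p f (qop p b cs x)"
  by (induction cs) (simp_all add: K_lins X_commute Y_left qop_closed)
lemma dop_left: "x \<in> Kos s p \<Longrightarrow> f \<in> Salg s \<Longrightarrow> dop p b cs (L p f x) = L p f (dop p b cs x)"
  by (induction cs) (simp_all add: K_lins X_commute Y_left qop_closed dop_closed qop_left SMS_left_0)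
lemma qop_Y: "x \<in> Kos s p \<Longrightarrow> qop p b cs (Y p v x) = Y p v (qop p b cs x)"
proof (induction cs)
  case (Cons w cs)
  then show ?case
    using Y_commute[OF qop_closed[OF Cons.prems], where v = v and w = w] Y_commute[OF qop_closed[OF Cons.prems], where v = v and w = b]
      Y_left[OF qop_closed[OF Cons.prems] sword_Salg, where w = v] by (simp add: K_lins)
qed simp
lemma dop_Y: "x \<in> Kos s p \<Longrightarrow> dop p b cs (Y p v x) = Y p v (dop p b cs x)"
proof (induction cs)
  case (Cons w cs)
  then show ?case
    using Y_commute[OF dop_closed[OF Cons.prems], where v = v and w = w] by (simp add: K_lins qop_Y)
qed (simp add: SMS_right_0)

lemma qop_Z: "x \<in> Kos s p \<Longrightarrow> qop p b cs (Z p v x) = Z p v (qop p b cs x)"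
  by (simp add: qop_diff qop_left qop_Y sword_Salg)
lemma dop_Z: "x \<in> Kos s p \<Longrightarrow> dop p b cs (Z p v x) = Z p v (dop p b cs x)"
  by (simp add: dop_diff dop_left dop_Y sword_Salg)

lemma kos_d_qop: "x \<in> Kos s (Suc p) \<Longrightarrow> kos_d s (Suc p) (qop (Suc p) b cs x) = qop p b cs (kos_d s (Suc p) x)"
  by (induction cs) (simp_all add: kos_d_add kos_d_diff kos_d_scl kos_d_left kos_d_right sword_Salg qop_closed)
lemma kos_d_dop: "x \<in> Kos s (Suc p) \<Longrightarrow> kos_d s (Suc p) (dop (Suc p) b cs x) = dop p b cs (kos_d s (Suc p) x)"
  by (induction cs) (simp_all add: kos_d_0 kos_d_diff kos_d_scl kos_d_right sword_Salg qop_closed dop_closed kos_d_qop)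

lemma Y_linear_left: "x \<in> Kos s p \<Longrightarrow> linear_on s UNIV scl (\<lambda>v. Y p v x)"
  by (rule linear_on_comp[OF svec_linear _ SMS_right_linear_right]) (auto simp: sword_Salg)
lemma X_linear_left: "x \<in> Kos s p \<Longrightarrow> linear_on s UNIV scl (\<lambda>v. X p v x)"
  by (rule linear_on_comp[OF svec_linear _ SMS_left_linear_left]) (auto simp: sword_Salg)

text \<open>The recursions run over words. This lemma and the next three, up to
  \<open>dop_swap\<close>, show that they are multilinear and symmetric in the letters, so that
  \<open>dop\<close> descends to S(V) as \<open>sdop\<close>; the claims for \<open>qop\<close> are
  needed because it occurs in the recursion of \<open>dop\<close>.\<close>

lemma qop_slot: "x \<in> Kos s p \<Longrightarrow> linear_on s UNIV scl (\<lambda>v. qop p b (us @ [v] @ vs) x)"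
proof (induction us)
  case Nil
  then show ?case
    by (auto intro!: linear_on_plus Y_linear_left linear_on_coeff coord_linear qop_closed)
next
  case (Cons u us)
  show ?case using Cons.IH[OF Cons.prems]
    by (auto intro!: linear_on_plus linear_on_times linear_on_minus
        intro: lin_comp[OF _ SMS_right_linear] lin_comp[OF _ SMS_left_linear])
qed

lemma dop_slot: "x \<in> Kos s p \<Longrightarrow> linear_on s UNIV scl (\<lambda>v. dop p b (us @ [v] @ vs) x)"
proof (induction us)
  case Nil
  then show ?case
    by (auto intro!: linear_on_minus Y_linear_left linear_on_coeff coord_linear dop_closed)
next
  case (Cons u us)
  show ?case using Cons.IH[OF Cons.prems] qop_slot[OF Cons.prems]
    by (auto intro!: linear_on_times linear_on_minus intro: lin_comp[OF _ SMS_right_linear])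
qed

lemma qop_swap: "x \<in> Kos s p \<Longrightarrow> qop p b (us @ [v, w] @ vs) x = qop p b (us @ [w, v] @ vs) x"
proof (induction us)
  case Nil
  then have q: "qop p b vs x \<in> Kos s p" by (rule qop_closed)
  then show ?case
    using Y_commute[OF q, where v = v and w = w] Y_commute[OF q, where v = v and w = b] Y_commute[OF q, where v = w and w = b]
      Y_left[OF q sword_Salg, where w = v] Y_left[OF q sword_Salg, where w = w]
    by (simp add: K_lins algebra_simps)
qed simp

text \<open>With \<beta> = \<open>coord b\<close> and d, q the values for \<open>vs\<close>, two
  leading letters give y_v y_w d - \<beta>(w) y_v q - \<beta>(v) y_w q - \<beta>(v) \<beta>(w) z_b
  q, which is symmetric in v and w.\<close>

lemma dop_swap: "x \<in> Kos s p \<Longrightarrow> dop p b (us @ [v, w] @ vs) x = dop p b (us @ [w, v] @ vs) x"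
proof (induction us)
  case Nil
  then have q: "qop p b vs x \<in> Kos s p" "dop p b vs x \<in> Kos s p" by (auto intro: qop_closed dop_closed)
  then show ?case
    using Y_commute[OF q(2), where v = v and w = w] by (simp add: K_lins algebra_simps)
next
  case (Cons u us)
  then show ?case using qop_swap[OF Cons.prems, of b us v w vs] by simp
qed

text \<open>The inductive step is z_b (y_v d - \<beta>(v) q) = y_v (c - q) - \<beta>(v) z_b q, with
  d, q, c the values for the shorter word. Thus \<open>dop\<close> is the exact quotient by x_b -
  y_b of the word minus its image under y_b -> x_b, and the recursion never divides. The sign is
  opposite to that of (f(x_b) - f(y_b)) / (x_b - y_b).\<close>

lemma Z_dop: "x \<in> Kos s p \<Longrightarrow> Z p b (dop p b cs x) = R p x (sword s cs) - qop p b cs x"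
proof (induction cs)
  case (Cons v cs)
  have q: "qop p b cs x \<in> Kos s p" "dop p b cs x \<in> Kos s p" using Cons by (auto intro: qop_closed dop_closed)
  have "R p x (sword s (v # cs)) = Y p v (R p x (sword s cs))"
    using SMS_right_smul[OF Cons.prems sword_Salg sword_Salg, of cs "[v]"]
    by (simp add: smul_sword sword_append_commute[of s cs "[v]"])
  moreover have "Z p b (dop p b (v # cs) x) = Y p v (Z p b (dop p b cs x)) - scl (coord b v) (Z p b (qop p b cs x))"
    using Y_commute[OF q(2), where v = v and w = b] Y_left[OF q(2) sword_Salg, where w = v] by (simp add: K_lins)
  ultimately show ?case using Cons by (simp add: K_lins)
qed (simp add: SMS_left_0 SMS_right_0 SMS_right_one)

definition sdop where "sdop p b x c = lext (\<lambda>cs. dop p b cs x) c"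

lemma sdop_sword: "x \<in> Kos s p \<Longrightarrow> sdop p b x (sword s cs) = dop p b cs x"
  unfolding sdop_def by (rule lext_sword) (auto intro: dop_slot[simplified] dop_swap[simplified])

lemma sdop_linear: "lin A (sdop p b x)"
  unfolding sdop_def[abs_def] using linear_on_lext[of A "\<lambda>cs. dop p b cs x"] by simp

text \<open>\<open>sdop\<close> is a linear extension in \<open>c\<close> alone; linearity in
  \<open>x\<close> is visible on words and is carried over to all \<open>c\<close> from
  there.\<close>

lemma sdop_linear_left: assumes c: "c \<in> Salg s" shows "lin (Kos s p) (\<lambda>x. sdop p b x c)"
proof (rule linear_on_fieldI)
  show "sdop p b (x + y) c = sdop p b x c + sdop p b y c" if "x \<in> Kos s p" "y \<in> Kos s p" for x y
    by (rule Salg_eqI[OF sdop_linear linear_on_plus[OF sdop_linear sdop_linear] _ c])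
      (simp add: sdop_sword that SMS_add dop_add)
  show "sdop p b (scl q x) c = scl q (sdop p b x c)" if "x \<in> Kos s p" for x q
    by (rule Salg_eqI[OF sdop_linear linear_on_times[OF sdop_linear] _ c])
      (simp add: sdop_sword that SMS_scl dop_scl)
qed

lemma sdop_closed: "x \<in> Kos s p \<Longrightarrow> c \<in> Salg s \<Longrightarrow> sdop p b x c \<in> Kos s p"
  by (rule Salg_intoI[where f = "sdop p b x", OF sdop_linear SMS_subspace]) (simp_all add: sdop_sword dop_closed)

text \<open>
  \<open>homotopy p b\<close> sends \<open>a \<otimes> w \<otimes> c\<close> to the product of the divided difference of \<open>c\<close> with
  \<open>a \<otimes> (b \<and> w) \<otimes> 1\<close>.  It is a homotopy from the identity to \<open>collapse p b\<close> below, which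
  substitutes \<open>x\<^sub>b\<close> for \<open>y\<^sub>b\<close> and projects the exterior factor along \<open>b\<close>.  Composing the maps
  \<open>collapse p b\<close> over a basis annihilates everything of positive degree.
\<close>

definition homotopy where
  "homotopy p b = lext (\<lambda>(a, w, c). L (Suc p) a (sdop (Suc p) b (ktri s (Suc p) (sone s) (lwedge s p b w) (sone s)) c))"

lemma homotopy_linear: "lin A (homotopy p b)" unfolding homotopy_def by (rule linear_on_lext)

lemma lw_gen_closed: "w \<in> Ext s p \<Longrightarrow> ktri s (Suc p) (sone s) (lwedge s p b w) (sone s) \<in> Kos s (Suc p)"
  by (intro tri_SMS sword_Salg lwedge_closed)

lemma lw_gen_linear: "lin (Ext s p) (\<lambda>w. ktri s (Suc p) (sone s) (lwedge s p b w) (sone s))"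
  by (rule linear_on_comp[OF lwedge_linear _ tri_lin2]) (auto simp: sword_Salg lwedge_closed)

lemma homotopy_ktri:
  "homotopy p b (ktri s p a w c) = L (Suc p) a (sdop (Suc p) b (ktri s (Suc p) (sone s) (lwedge s p b w) (sone s)) c)"
  unfolding homotopy_def
proof (rule lext_tri_fun)
  show "lin (Salg s) (\<lambda>a. L (Suc p) a (sdop (Suc p) b (ktri s (Suc p) (sone s) (lwedge s p b w) (sone s)) c))"
    if "w \<in> Ext s p" "c \<in> Salg s" for w c
    by (intro SMS_left_linear_left sdop_closed lw_gen_closed that)
  show "lin (Ext s p) (\<lambda>w. L (Suc p) a (sdop (Suc p) b (ktri s (Suc p) (sone s) (lwedge s p b w) (sone s)) c))"
    if "c \<in> Salg s" for a c
    by (rule lin_comp[OF linear_on_comp[OF lw_gen_linear _ sdop_linear_left[OF that]] SMS_left_linear])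
      (use lw_gen_closed in auto)
  show "lin (Salg s) (\<lambda>c. L (Suc p) a (sdop (Suc p) b (ktri s (Suc p) (sone s) (lwedge s p b w) (sone s)) c))"
    for a w
    by (rule lin_comp[OF sdop_linear SMS_left_linear])
qed

lemma homotopy_kword:
  "length vs = p \<Longrightarrow> homotopy p b (kword p as vs cs) = L (Suc p) (sword s as) (dop (Suc p) b cs (kgen (Suc p) (b # vs)))"
  by (simp add: homotopy_ktri lwedge_wedge sdop_sword kgen_closed)

lemma homotopy_closed: "x \<in> Kos s p \<Longrightarrow> homotopy p b x \<in> Kos s (Suc p)"
  by (rule SMS_intoI[where f = "homotopy p b", OF homotopy_linear SMS_subspace])
    (auto simp: homotopy_ktri intro!: SMS_left_closed sdop_closed lw_gen_closed)

lemma kword_mults: "length vs = p \<Longrightarrow> kword p as vs cs = L p (sword s as) (R p (kgen p vs) (sword s cs))"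
  by (rule tri_as_mults) (auto simp: sword_Salg wedge_Ext)

lemma kos_d_kgen:
  "length vs = Suc p \<Longrightarrow> kos_d s (Suc p) (kgen (Suc p) vs) = (\<Sum>i<Suc p. scl ((-1) ^ i) (Z p (vs ! i) (kgen p (omit i vs))))"
  by (simp add: kos_d_ktri sword_Salg SMS_left_tri SMS_right_tri smul_sword del: sum.lessThan_Suc)

lemma kos_d_kword:
  "length vs = Suc p \<Longrightarrow> kos_d s (Suc p) (kword (Suc p) as vs cs) =
    (\<Sum>i<Suc p. scl ((-1) ^ i) (kword p (as @ [vs ! i]) (omit i vs) cs - kword p as (omit i vs) (vs ! i # cs)))"
  by (simp add: kos_d_ktri sword_Salg smul_sword del: sum.lessThan_Suc)

section \<open>The map homotopic to the identity, computed on words\<close>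

definition proj_off where "proj_off b v = v - s (coord b v) b"

text \<open>The identity minus d h + h d. In degree 0 the summand h d is dropped, since d would
  leave \<open>Kos s 0\<close>; the augmentation is treated separately in
  \<open>kos_exact_0\<close>.\<close>

definition collapse where
  "collapse p b x = x - kos_d s (Suc p) (homotopy p b x) - (case p of 0 \<Rightarrow> 0 | Suc m \<Rightarrow> homotopy m b (kos_d s p x))"

lemma collapse_linear: "lin A (collapse p b)"
proof (cases p)
  case 0
  then show ?thesis unfolding collapse_def
    by (auto intro!: linear_on_minus linear_on_ident linear_on_const_zero lin_comp[OF homotopy_linear kos_d_linear])
next
  case (Suc m)
  then show ?thesis unfolding collapse_def
    by (auto intro!: linear_on_minus linear_on_ident lin_comp[OF homotopy_linear kos_d_linear]
        lin_comp[OF kos_d_linear homotopy_linear])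
qed

lemma homotopy_sum: "homotopy p b (\<Sum>i\<in>I. f i) = (\<Sum>i\<in>I. homotopy p b (f i))"
  and homotopy_diff: "homotopy p b (x - y) = homotopy p b x - homotopy p b y"
  and homotopy_scl: "homotopy p b (scl c x) = scl c (homotopy p b x)"
  using lin_sum[OF homotopy_linear] lin_diff[OF homotopy_linear]
    homotopy_linear[of UNIV p b] by (auto simp: linear_on_def)


lemma kgen_projection:
  assumes "length vs = p"
  shows "kgen p (map (proj_off b) vs) = kgen p vs - (\<Sum>i<p. scl ((-1) ^ i * coord b (vs ! i)) (kgen p (b # omit i vs)))"
proof -
  have W: "wedge s p us \<in> Ext s p" if "length us = p" for us using that by (rule wedge_Ext)
  have om: "length (b # omit i vs) = p" if "i < p" for i using that assms by (simp add: length_omit)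
  note lin = tri_lin2[where s = s and t = scl and M = "Ext s p" and a = "sone s" and c = "sone s", OF sword_Salg sword_Salg]
  have sub: "(\<Sum>i<p. scl ((-1) ^ i * coord b (vs ! i)) (wedge s p (b # omit i vs))) \<in> Ext s p"
    by (intro fn.subspace_sum[OF Ext_subspace] fn.subspace_scale[OF Ext_subspace] W om) auto
  have "wedge s p (map (proj_off b) vs) = wedge s p vs - (\<Sum>i<p. scl ((-1) ^ i * coord b (vs ! i)) (wedge s p (b # omit i vs)))"
    using V.wedge_map_projection[of vs "coord b" b] assms by (simp add: proj_off_def[abs_def])
  then have "kgen p (map (proj_off b) vs) = kgen p vs - ktri s p (sone s) (\<Sum>i<p. scl ((-1) ^ i * coord b (vs ! i)) (wedge s p (b # omit i vs))) (sone s)"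
    using linear_on_image_diff[OF lin Ext_subspace W[OF assms] sub] by simp
  also have "ktri s p (sone s) (\<Sum>i<p. scl ((-1) ^ i * coord b (vs ! i)) (wedge s p (b # omit i vs))) (sone s) =
      (\<Sum>i<p. ktri s p (sone s) (scl ((-1) ^ i * coord b (vs ! i)) (wedge s p (b # omit i vs))) (sone s))"
    by (rule linear_on_image_sum[OF lin Ext_subspace]) (intro fn.subspace_scale[OF Ext_subspace] W om, simp)
  also have "\<dots> = (\<Sum>i<p. scl ((-1) ^ i * coord b (vs ! i)) (kgen p (b # omit i vs)))"
    by (intro sum.cong refl tri_scl2 sword_Salg W om) simp
  finally show ?thesis .
qed

text \<open>\<open>dop\<close> is assembled from the two multiplications, so it commutes with d and
  can be applied to the boundary of 1 \<otimes> b \<and> vs \<otimes> 1. Removing \<open>b\<close>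
  leaves z_b times \<open>dop\<close>, where the division is undone by \<open>Z_dop\<close>; the
  other terms get a minus sign because \<open>b\<close> shifts their positions by one.\<close>

lemma kos_d_homotopy_kword:
  assumes vs: "length vs = p"
  shows "kos_d s (Suc p) (homotopy p b (kword p as vs cs)) =
    L p (sword s as) (R p (kgen p vs) (sword s cs) - qop p b cs (kgen p vs) -
      (\<Sum>i<p. scl ((-1) ^ i) (Z p (vs ! i) (dop p b cs (kgen p (b # omit i vs))))))"
proof -
  have om: "kgen p (b # omit i vs) \<in> Kos s p" if "i < p" for i
    by (rule kgen_closed) (use that vs in \<open>simp add: length_omit\<close>)
  have K: "kgen (Suc p) (b # vs) \<in> Kos s (Suc p)" using vs by (intro kgen_closed) simp
  have "kos_d s (Suc p) (homotopy p b (kword p as vs cs)) =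
      L p (sword s as) (dop p b cs (kos_d s (Suc p) (kgen (Suc p) (b # vs))))"
    using vs K by (simp add: homotopy_kword kos_d_left dop_closed sword_Salg kos_d_dop)
  also have "kos_d s (Suc p) (kgen (Suc p) (b # vs)) =
      Z p b (kgen p vs) - (\<Sum>i<p. scl ((-1) ^ i) (Z p (vs ! i) (kgen p (b # omit i vs))))"
    using vs by (subst kos_d_kgen)
      (simp_all only: sum.lessThan_Suc_shift power_Suc omit_Cons nth_Cons_0 nth_Cons_Suc power_0 fn.scale_one
        fn.scale_minus_left sum_negf mult_minus1 length_Cons, simp)
  also have "dop p b cs \<dots> = R p (kgen p vs) (sword s cs) - qop p b cs (kgen p vs) -
      (\<Sum>i<p. scl ((-1) ^ i) (Z p (vs ! i) (dop p b cs (kgen p (b # omit i vs)))))"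
    by (simp only: dop_diff[of p b cs "Z p b (kgen p vs)"] dop_sum dop_scl dop_Z[OF kgen_closed[OF vs]] Z_dop[OF kgen_closed[OF vs]])
      (simp add: dop_Z om)
  finally show ?thesis .
qed

text \<open>The terms z_v \<open>dop\<close> with v = \<open>vs ! i\<close> come from d h and from h
  d with opposite signs and cancel. In h d the differential puts v in front of \<open>cs\<close>,
  and the recursion for the longer word adds a term \<beta>(v) \<open>qop\<close>. By
  \<open>kgen_projection\<close> these extra terms are exactly what turns the exterior word into its
  projection along \<open>b\<close>.\<close>

lemma collapse_kword:
  assumes vs: "length vs = p"
  shows "collapse p b (kword p as vs cs) = L p (sword s as) (qop p b cs (kgen p (map (proj_off b) vs)))"
proof (cases p)
  case 0
  then show ?thesis
    unfolding collapse_def kos_d_homotopy_kword[OF vs] SMS_left_diff kword_mults[OF vs, symmetric] using vs by (simp add: SMS_left_0)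
next
  case (Suc m)
  let ?L = "L p (sword s as)" and ?R = "R p (kgen p vs) (sword s cs)" and ?q = "qop p b cs (kgen p vs)"
    and ?h = "\<lambda>i. homotopy m b (kword m (as @ [vs ! i]) (omit i vs) cs) - homotopy m b (kword m as (omit i vs) (vs ! i # cs))"
    and ?D = "\<lambda>i. scl ((-1) ^ i) (Z p (vs ! i) (dop p b cs (kgen p (b # omit i vs))))"
    and ?Q = "\<lambda>i. scl ((-1) ^ i * coord b (vs ! i)) (qop p b cs (kgen p (b # omit i vs)))"
  have om: "length (omit i vs) = m" if "i < p" for i using that vs Suc by (simp add: length_omit)
  have E: "kgen p (b # omit i vs) \<in> Kos s p" if "i < p" for i by (rule kgen_closed) (use om[OF that] Suc in simp)
  have "homotopy m b (kos_d s p (kword p as vs cs)) = (\<Sum>i<p. scl ((-1) ^ i) (?h i))"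
    using vs Suc by (simp add: kos_d_kword homotopy_sum homotopy_diff homotopy_scl del: sum.lessThan_Suc)
  also have "\<dots> = (\<Sum>i<p. ?L (?D i + ?Q i))"
  proof (rule sum.cong[OF refl])
    fix i assume "i \<in> {..<p}"
    then have i: "i < p" by simp
    have "L p (sword s (as @ [vs ! i])) (dop p b cs (kgen p (b # omit i vs))) =
        L p (sword s as) (X p (vs ! i) (dop p b cs (kgen p (b # omit i vs))))"
      using SMS_left_smul[OF dop_closed[OF E[OF i]] sword_Salg sword_Salg, of as "[vs ! i]"] by (simp add: smul_sword)
    then have "?h i =
        L p (sword s as) (Z p (vs ! i) (dop p b cs (kgen p (b # omit i vs))) + scl (coord b (vs ! i)) (qop p b cs (kgen p (b # omit i vs))))"
      using Suc by (simp add: homotopy_kword om[OF i] K_lins)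
    then show "scl ((-1) ^ i) (?h i) = ?L (?D i + ?Q i)"
      by (simp only: fn.scale_right_distrib fn.scale_scale SMS_left_add SMS_left_scl)
  qed
  also have "\<dots> = ?L ((\<Sum>i<p. ?D i) + (\<Sum>i<p. ?Q i))"
    by (simp only: sum.distrib SMS_left_sum flip: SMS_left_sum)
  finally have h: "homotopy m b (kos_d s p (kword p as vs cs)) = \<dots>" .
  have "qop p b cs (kgen p (map (proj_off b) vs)) = ?q - (\<Sum>i<p. ?Q i)"
    unfolding kgen_projection[OF vs] by (simp only: qop_diff qop_sum qop_scl)
  then have "?L (qop p b cs (kgen p (map (proj_off b) vs))) =
      ?L ?R - ?L (?R - ?q - (\<Sum>i<p. ?D i)) - ?L ((\<Sum>i<p. ?D i) + (\<Sum>i<p. ?Q i))"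
    unfolding SMS_left_diff[symmetric] by simp
  also have "\<dots> = collapse p b (kword p as vs cs)"
    unfolding collapse_def h kos_d_homotopy_kword[OF vs] kword_mults[OF vs, symmetric] using Suc h by simp
  finally show ?thesis by simp
qed

lemma Z_proj_off: "x \<in> Kos s p \<Longrightarrow> Z p (proj_off b v) x = Z p v x - scl (coord b v) (Z p b x)"
proof -
  assume x: "x \<in> Kos s p"
  have "linear_on s UNIV scl (\<lambda>v. Z p v x)" by (intro linear_on_minus X_linear_left Y_linear_left x)
  then have "Z p (proj_off b v + s (coord b v) b) x = Z p (proj_off b v) x + scl (coord b v) (Z p b x)"
    unfolding linear_on_def by (metis UNIV_I)
  then show ?thesis by (simp add: proj_off_def)
qed

text \<open>Given d d = 0 this would be formal; here it is read off from the formula on words. A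
  letter v standing on the left contributes x_v, and on the right y_v + \<beta>(v) z_b after the
  substitution. The difference z_v - \<beta>(v) z_b is the element \<open>Z\<close> of the projected
  vector.\<close>

lemma kos_d_collapse:
  assumes "x \<in> Kos s (Suc p)"
  shows "kos_d s (Suc p) (collapse (Suc p) b x) = collapse p b (kos_d s (Suc p) x)"
proof (rule Kos_word_eqI[OF lin_comp[OF collapse_linear kos_d_linear]
      lin_comp[OF kos_d_linear collapse_linear] _ assms])
  fix as vs cs assume vs: "length (vs :: 'v list) = Suc p"
  have om: "length (omit i vs) = p" if "i < Suc p" for i using that vs by (simp add: length_omit)
  have E: "kgen p (map (proj_off b) (omit i vs)) \<in> Kos s p" if "i < Suc p" for i by (rule kgen_closed) (use om[OF that] in simp)
  have K: "kgen (Suc p) (map (proj_off b) vs) \<in> Kos s (Suc p)" using vs by (intro kgen_closed) simp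
  have "kos_d s (Suc p) (collapse (Suc p) b (kword (Suc p) as vs cs)) =
      L p (sword s as) (qop p b cs (kos_d s (Suc p) (kgen (Suc p) (map (proj_off b) vs))))"
    by (simp add: collapse_kword vs kos_d_left qop_closed K sword_Salg kos_d_qop)
  also have "\<dots> = (\<Sum>i<Suc p. scl ((-1) ^ i) (L p (sword s as) (qop p b cs (Z p (proj_off b (vs ! i)) (kgen p (map (proj_off b) (omit i vs)))))))"
    using vs by (simp add: kos_d_kgen omit_map qop_sum qop_scl SMS_left_sum SMS_left_scl del: sum.lessThan_Suc)
  also have "\<dots> = (\<Sum>i<Suc p. scl ((-1) ^ i) (collapse p b (kword p (as @ [vs ! i]) (omit i vs) cs - kword p as (omit i vs) (vs ! i # cs))))"
  proof (rule sum.cong[OF refl])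
    fix i assume "i \<in> {..<Suc p}"
    then have i: "i < Suc p" by simp
    have "L p (sword s (as @ [vs ! i])) (qop p b cs (kgen p (map (proj_off b) (omit i vs)))) =
        L p (sword s as) (X p (vs ! i) (qop p b cs (kgen p (map (proj_off b) (omit i vs)))))"
      using SMS_left_smul[OF qop_closed[OF E[OF i]] sword_Salg sword_Salg, of as "[vs ! i]"] by (simp add: smul_sword)
    then have "collapse p b (kword p (as @ [vs ! i]) (omit i vs) cs) - collapse p b (kword p as (omit i vs) (vs ! i # cs)) =
        L p (sword s as) (Z p (proj_off b (vs ! i)) (qop p b cs (kgen p (map (proj_off b) (omit i vs)))))"
      unfolding Z_proj_off[OF qop_closed[OF E[OF i]]] by (simp add: collapse_kword om[OF i] K_lins)
    then show "scl ((-1) ^ i) (L p (sword s as) (qop p b cs (Z p (proj_off b (vs ! i)) (kgen p (map (proj_off b) (omit i vs)))))) =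
      scl ((-1) ^ i) (collapse p b (kword p (as @ [vs ! i]) (omit i vs) cs - kword p as (omit i vs) (vs ! i # cs)))"
      unfolding qop_Z[OF E[OF i]] lin_diff[OF collapse_linear] by simp
  qed
  also have "\<dots> = collapse p b (kos_d s (Suc p) (kword (Suc p) as vs cs))"
    unfolding kos_d_kword[OF vs] lin_sum[OF collapse_linear]
    using collapse_linear[of UNIV p b] by (simp add: linear_on_def del: sum.lessThan_Suc)
  finally show "kos_d s (Suc p) (collapse (Suc p) b (kword (Suc p) as vs cs)) = collapse p b (kos_d s (Suc p) (kword (Suc p) as vs cs))" .
qed

section \<open>Exactness, by collapsing one basis direction after the other\<close>

text \<open>The span of the elements whose exterior factors have vanishing coordinates in \<open>J\<close>.\<close>

definition free_of where
  "free_of p J = fn.span {kword p as vs cs | as vs cs. length vs = p \<and> (\<forall>v\<in>set vs. \<forall>b\<in>J. coord b v = 0)}"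

lemma free_of_subspace: "fn.subspace (free_of p J)" by (simp add: free_of_def)

lemma free_of_base:
  "length vs = p \<Longrightarrow> (\<And>v b. v \<in> set vs \<Longrightarrow> b \<in> J \<Longrightarrow> coord b v = 0) \<Longrightarrow> kword p as vs cs \<in> free_of p J"
  unfolding free_of_def by (intro fn.span_base) blast

lemma free_of_intoI:
  assumes "lin (free_of p J) f" "fn.subspace N"
    and "\<And>as vs cs. length vs = p \<Longrightarrow> (\<And>v b. v \<in> set vs \<Longrightarrow> b \<in> J \<Longrightarrow> coord b v = 0) \<Longrightarrow> f (kword p as vs cs) \<in> N"
    and "x \<in> free_of p J"
  shows "f x \<in> N"
  using assms(1,4) unfolding free_of_def by (elim linear_on_span_into[OF _ assms(2)]) (use assms(3) in blast)

lemma free_of_empty: "x \<in> Kos s p \<Longrightarrow> x \<in> free_of p {}"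
proof (rule Kos_intoI[where f = "\<lambda>x. x", OF linear_on_ident])
  show N: "fn.subspace (free_of p {})" by (simp add: free_of_def)
  fix a vs c assume a: "a \<in> Salg s" "length (vs :: 'v list) = p" "c \<in> Salg s"
  then have W: "wedge s p vs \<in> Ext s p" by (simp add: wedge_Ext)
  show "ktri s p a (wedge s p vs) c \<in> free_of p {}"
  proof (rule Salg_intoI[where f = "\<lambda>a. ktri s p a (wedge s p vs) c", OF tri_lin1[OF W a(3)] N _ a(1)])
    show "ktri s p (sword s as) (wedge s p vs) c \<in> free_of p {}" for as
      by (rule Salg_intoI[where f = "ktri s p (sword s as) (wedge s p vs)", OF tri_lin3[OF sword_Salg W] N _ a(3)])
        (rule free_of_base[OF a(2)], simp)
  qed
qed

lemma free_of_sword_left: "x \<in> free_of p J \<Longrightarrow> L p (sword s as) x \<in> free_of p J"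
  by (rule free_of_intoI[where f = "L p (sword s as)", OF SMS_left_linear free_of_subspace])
    (simp_all add: SMS_left_tri sword_Salg smul_sword free_of_base)

lemma free_of_sword_right: "x \<in> free_of p J \<Longrightarrow> R p x (sword s cs) \<in> free_of p J"
  by (rule free_of_intoI[where f = "\<lambda>x. R p x (sword s cs)", OF SMS_right_linear free_of_subspace])
    (simp_all add: SMS_right_tri sword_Salg smul_sword free_of_base)

lemma free_of_qop: "x \<in> free_of p J \<Longrightarrow> qop p b cs x \<in> free_of p J"
  by (induction cs)
    (auto intro!: fn.subspace_add[OF free_of_subspace] fn.subspace_diff[OF free_of_subspace] fn.subspace_scale[OF free_of_subspace]
      free_of_sword_left free_of_sword_right)

text \<open>\<open>b\<close> has coordinate 1 at itself and 0 at the other basis vectors, so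
  subtracting a multiple of it kills that coordinate and keeps the zeros in \<open>J\<close>. The
  factor \<open>qop\<close> only changes the outer coefficients.\<close>

lemma free_of_collapse:
  assumes x: "x \<in> free_of p J" and b: "b \<in> basis" "J \<subseteq> basis" "b \<notin> J"
  shows "collapse p b x \<in> free_of p (insert b J)"
proof (rule free_of_intoI[where f = "collapse p b", OF collapse_linear free_of_subspace _ x])
  fix as vs cs assume y: "length vs = p" "\<And>v b. v \<in> set vs \<Longrightarrow> b \<in> J \<Longrightarrow> coord b v = 0"
  have "coord b' (proj_off b v) = 0" if "v \<in> set vs" "b' \<in> insert b J" for v b'
    using that y(2) b by (cases "b' = b") (auto simp: proj_off_def coord_diff coord_scale coord_basis subset_eq)
  then have "kgen p (map (proj_off b) vs) \<in> free_of p (insert b J)"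
    using y(1) by (intro free_of_base) auto
  then show "collapse p b (kword p as vs cs) \<in> free_of p (insert b J)"
    unfolding collapse_kword[OF y(1)] by (intro free_of_sword_left free_of_qop)
qed

text \<open>In positive degree there is at least one exterior factor, and a factor with all
  coordinates zero is zero.\<close>

lemma free_of_basis: "x \<in> free_of (Suc p) basis \<Longrightarrow> x = 0"
proof -
  assume x: "x \<in> free_of (Suc p) basis"
  have "kword (Suc p) as vs cs = 0"
    if vs: "length vs = Suc p" "\<And>v b. v \<in> set vs \<Longrightarrow> b \<in> basis \<Longrightarrow> coord b v = 0" for as vs cs
  proof -
    obtain v us where v: "vs = v # us" "length us = p" using vs(1) by (auto simp: length_Suc_conv)
    then have "v = 0" using vs by (auto intro: coord_eq_0)
    then have "wedge s (Suc p) vs = 0"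
      using wedge_linear_hd[OF v(2), of s] unfolding linear_on_def v(1) by (metis UNIV_I V.scale_zero_left fn.scale_zero_left)
    then show ?thesis
      using linear_on_zero[OF tri_lin2[OF sword_Salg sword_Salg] fn.subspace_0[OF Ext_subspace]] by metis
  qed
  then have "(\<lambda>x. x) x \<in> {0}"
    by (intro free_of_intoI[where f = "\<lambda>x. x", OF linear_on_ident fn.subspace_single_0 _ x]) simp
  then show ?thesis by simp
qed

text \<open>For a cycle z the summand h d z vanishes, so \<open>collapse\<close> changes z only by
  the boundary of h z, and the result is again a cycle by \<open>kos_d_collapse\<close>. Each step
  adds one direction to \<open>J\<close>; for the whole basis nothing remains of the cycle.\<close>

lemma kos_exact_step:
  assumes "finite J" "J \<subseteq> basis" "x \<in> Kos s (Suc p)" "kos_d s (Suc p) x = 0"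
  shows "\<exists>y\<in>Kos s (Suc (Suc p)). x - kos_d s (Suc (Suc p)) y \<in> free_of (Suc p) J \<and>
    kos_d s (Suc p) (x - kos_d s (Suc (Suc p)) y) = 0"
  using assms
proof (induction J)
  case empty
  then show ?case using free_of_empty by (intro bexI[of _ 0]) (auto simp: kos_d_0 SMS_0)
next
  case (insert b J)
  then obtain y where y: "y \<in> Kos s (Suc (Suc p))" "x - kos_d s (Suc (Suc p)) y \<in> free_of (Suc p) J"
    "kos_d s (Suc p) (x - kos_d s (Suc (Suc p)) y) = 0" by auto
  let ?z = "x - kos_d s (Suc (Suc p)) y"
  have z: "?z \<in> Kos s (Suc p)" using insert.prems y by (auto intro: SMS_diff kos_d_closed)
  have "collapse (Suc p) b ?z = ?z - kos_d s (Suc (Suc p)) (homotopy (Suc p) b ?z)"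
    by (simp add: collapse_def y(3) linear_on_zero[OF homotopy_linear UNIV_I])
  also have "\<dots> = x - kos_d s (Suc (Suc p)) (y + homotopy (Suc p) b ?z)"
    by (simp add: kos_d_add algebra_simps)
  finally have e: "collapse (Suc p) b ?z = x - kos_d s (Suc (Suc p)) (y + homotopy (Suc p) b ?z)" .
  have "kos_d s (Suc p) (collapse (Suc p) b ?z) = 0"
    unfolding kos_d_collapse[OF z] y(3) by (rule linear_on_zero[OF collapse_linear UNIV_I])
  moreover have "collapse (Suc p) b ?z \<in> free_of (Suc p) (insert b J)"
    by (rule free_of_collapse[OF y(2)]) (use insert in auto)
  ultimately show ?case
    unfolding e using y(1) homotopy_closed[OF z] by (blast intro: SMS_add)
qed

lemma kos_exact:
  assumes "x \<in> Kos s (Suc p)" "kos_d s (Suc p) x = 0"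
  shows "\<exists>y\<in>Kos s (Suc (Suc p)). kos_d s (Suc (Suc p)) y = x"
  using kos_exact_step[OF V.finite_Basis subset_refl assms] free_of_basis by (metis eq_iff_diff_eq_0)

text \<open>There is no exterior factor to kill here. Instead d(a \<otimes> v \<otimes> c) = av
  \<otimes> 1 \<otimes> c - a \<otimes> 1 \<otimes> vc moves the letters of the right coefficient to
  the left one by one, so modulo boundaries every element is determined by its augmentation.\<close>

lemma kos_exact_0:
  assumes x: "x \<in> Kos s 0" "kos_aug s x = 0"
  shows "\<exists>y\<in>Kos s 1. kos_d s 1 y = x"
proof -
  define N where "N = {kos_d s 1 y | y. y \<in> Kos s 1}"
  have NI: "y \<in> Kos s 1 \<Longrightarrow> kos_d s 1 y = z \<Longrightarrow> z \<in> N" for y z unfolding N_def by blast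
  have N: "fn.subspace N"
  proof (rule fn.subspaceI)
    show "0 \<in> N" by (rule NI[OF SMS_0 kos_d_0])
    show "a + b \<in> N" if "a \<in> N" "b \<in> N" for a b
    proof -
      from that obtain y z where "y \<in> Kos s 1" "a = kos_d s 1 y" "z \<in> Kos s 1" "b = kos_d s 1 z" unfolding N_def by blast
      then show ?thesis using NI[OF SMS_add kos_d_add, of y z] by simp
    qed
    show "scl c a \<in> N" if "a \<in> N" for a c
    proof -
      from that obtain y where "y \<in> Kos s 1" "a = kos_d s 1 y" unfolding N_def by blast
      then show ?thesis using NI[OF SMS_scl kos_d_scl, of y c] by simp
    qed
  qed
  define E where "E a = ktri s 0 a (wedge s 0 []) (sone s)" for a
  have E: "lin (Salg s) E" unfolding E_def by (intro tri_lin1 wedge_Ext sword_Salg) simp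
  have step: "kword 0 as [] cs - E (sword s (as @ cs)) \<in> N" for as cs
  proof (induction cs arbitrary: as)
    case Nil
    show ?case using fn.subspace_0[OF N] by (simp add: E_def)
  next
    case (Cons v cs)
    have "kos_d s 1 (kword 1 as [v] cs) = kword 0 (as @ [v]) [] cs - kword 0 as [] (v # cs)"
      using kos_d_kword[of "[v]" 0 as cs] by (simp add: omit_def)
    moreover have "kword 1 as [v] cs \<in> Kos s 1" by (intro tri_SMS sword_Salg wedge_Ext) simp
    ultimately have "kword 0 (as @ [v]) [] cs - kword 0 as [] (v # cs) \<in> N" using NI by blast
    from fn.subspace_diff[OF N Cons.IH[of "as @ [v]"] this] show ?case by simp
  qed
  have "x - E (kos_aug s x) \<in> N"
  proof -
    have lin: "lin (Kos s 0) (\<lambda>x. x - E (kos_aug s x))"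
      by (intro linear_on_minus linear_on_ident linear_on_comp[OF kos_aug_linear _ E]) (auto intro: kos_aug_closed)
    have "lin (free_of 0 {}) (\<lambda>x. x - E (kos_aug s x))"
    proof (rule linear_on_subset[OF lin])
      show "free_of 0 {} \<subseteq> Kos s 0" unfolding free_of_def
        by (intro fn.span_minimal SMS_subspace) (auto intro!: tri_SMS sword_Salg wedge_Ext)
    qed
    from free_of_intoI[OF this N _ free_of_empty[OF x(1)]] show ?thesis
      by (simp add: kos_aug_ktri sword_Salg smul_sword step)
  qed
  moreover have "E 0 = 0" by (rule linear_on_zero[OF E Salg_0])
  ultimately show ?thesis using x(2) unfolding N_def by auto
qed

lemma KG_exact:
  "x \<in> KG s (Suc p) \<Longrightarrow> KG_d s (Suc p) x = 0 \<Longrightarrow> \<exists>y\<in>KG s (Suc (Suc p)). KG_d s (Suc (Suc p)) y = x"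
  unfolding KG_d_def by (rule rtimes_map_exact[OF kos_exact])

lemma KG_exact_0: "x \<in> KG s 0 \<Longrightarrow> KG_aug s x = 0 \<Longrightarrow> \<exists>y\<in>KG s 1. KG_d s 1 y = x"
  unfolding KG_d_def KG_aug_def by (rule rtimes_map_exact[OF kos_exact_0])

end


section \<open>The lifting of the derivation\<close>

lemma wedge_update_linear: "i < length ws \<Longrightarrow> length ws = p \<Longrightarrow> linear_on s UNIV scl (\<lambda>x. wedge s p (ws[i := x]))"
  using wedge_linear[of "take i ws" "drop (Suc i) ws" p s] by (simp add: upd_conv_take_nth_drop)

lemma kos_aug_add: "kos_aug s (x + y) = kos_aug s x + kos_aug s y"
  by (simp add: kos_aug_def lext_add)

lemma tri_zero1: "m \<in> M \<Longrightarrow> c \<in> Salg s \<Longrightarrow> tri s t M 0 m c = 0"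
  and tri_zero3: "a \<in> Salg s \<Longrightarrow> m \<in> M \<Longrightarrow> tri s t M a m 0 = 0"
  using tri_scl1[of m M c s 0 t 0] tri_scl3[of a s m M 0 t 0] by (simp_all add: Salg_0)

lemma Tact_tword: "linear_on s UNIV s (\<rho> g) \<Longrightarrow> Tact s \<rho> g (tword s vs) = tword s (map (\<rho> g) vs)"
  unfolding Tact_def
proof (rule lext_tword)
  fix us vs
  assume r: "linear_on s UNIV s (\<rho> g)"
  have "linear_on s UNIV scl (\<lambda>x. tword s (us' @ [x] @ vs'))" for us' vs'
  proof (rule linear_on_pointwise)
    fix y
    show "linear_on s UNIV (*) (\<lambda>x. tword s (us' @ [x] @ vs') y)"
      by (cases "\<forall>n. multilinear_form s UNIV n y")
        (auto simp: tword_def pure_def multilinear_form_def linear_on_def)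
  qed
  from lin_comp[OF r this]
  show "linear_on s UNIV scl (\<lambda>x. tword s (map (\<rho> g) (us @ [x] @ vs)))" by simp
qed

lemma Talg_subspace: "fn.subspace (Talg s)" by (simp add: Talg_def)

lemma tword_Talg: "tword s vs \<in> Talg s" unfolding Talg_def by (simp add: fn.span_base)

lemma Talg_intoI:
  assumes "lin (Talg s) f" "fn.subspace N"
    and "\<And>vs. f (tword s vs) \<in> N" and "x \<in> Talg s"
  shows "f x \<in> N"
  using assms linear_on_span_into[of "range (tword s)" f N x] unfolding Talg_def by auto

lemma omit_update_same: "omit i (ws[i := x]) = omit i ws"
  by (simp add: omit_def)

lemma nth_omit: "j < length ws \<Longrightarrow> Suc i < length ws \<Longrightarrow> omit j ws ! i = ws ! (if i < j then i else Suc i)"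
  by (auto simp: omit_def nth_append min_def)

text \<open>The position in \<open>omit j ws\<close> of the entry that stands at \<open>i\<close> in
  \<open>ws\<close>, for \<open>i\<close> different from \<open>j\<close>.\<close>

abbreviation (input) shift where "shift j i \<equiv> (if i < j then i else i - 1)"

lemma omit_update_other:
  assumes "i \<noteq> j" "i < length ws" "j < length ws"
  shows "omit j (ws[i := x]) = (omit j ws)[(shift j i) := x]"
proof (rule nth_equalityI)
  show "length (omit j (ws[i := x])) = length ((omit j ws)[(shift j i) := x])"
    using assms by (simp add: length_omit)
  fix k assume k: "k < length (omit j (ws[i := x]))"
  then have k': "Suc k < length ws" using assms by (simp add: length_omit)
  have len: "length (omit j ws) = length ws - 1" using assms by (simp add: length_omit)
  show "omit j (ws[i := x]) ! k = (omit j ws)[(shift j i) := x] ! k"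
    using assms k' by (subst nth_omit) (auto simp: nth_list_update len nth_omit)
qed

locale delta_data = smash s \<rho>
  for s :: "'k::field \<Rightarrow> 'v::ab_group_add \<Rightarrow> 'v" and \<rho> :: "'g::{finite,group_add} \<Rightarrow> 'v \<Rightarrow> 'v" +
  fixes r :: "'v \<Rightarrow> ('v list \<Rightarrow> 'k) \<Rightarrow> 'k"
    and rbar :: "(('v list \<Rightarrow> 'k) \<Rightarrow> 'k) \<Rightarrow> ('v list \<Rightarrow> 'k) \<Rightarrow> 'k"
    and \<delta> :: "('g \<times> ('v list \<Rightarrow> 'k) \<Rightarrow> 'k) \<Rightarrow> 'g \<times> ('v list \<Rightarrow> 'k) \<Rightarrow> 'k"
    and \<sigma> :: "(('v list \<Rightarrow> 'k) \<Rightarrow> 'k) \<Rightarrow> ('v list \<Rightarrow> 'k) \<Rightarrow> 'k"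
    and D :: "(('v list \<Rightarrow> 'k) \<Rightarrow> 'k) \<Rightarrow>
      ((('v list \<Rightarrow> 'k) \<Rightarrow> 'k) \<times> 'v \<times> (('v list \<Rightarrow> 'k) \<Rightarrow> 'k) \<Rightarrow> 'k) \<Rightarrow> 'k"
    and n :: "'v \<Rightarrow> nat"
    and v1 v3 :: "'v \<Rightarrow> nat \<Rightarrow> ('v list \<Rightarrow> 'k) \<Rightarrow> 'k"
    and v2 :: "'v \<Rightarrow> nat \<Rightarrow> 'v"
  assumes r: "linear_on s UNIV scl r" "range r \<subseteq> Salg s" "\<And>g v. r (\<rho> g v) = Sact s \<rho> g (r v)"
    and rbar: "derivation_on (Salg s) (smul s) (Salg s) (smul s) (smul s) rbar"
      "\<And>v. rbar (svec s v) = r v"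
    and delta: "derivation_on (SG s) (SG_mul s \<rho>) (SG s) (SG_mul s \<rho>) (SG_mul s \<rho>) \<delta>"
      "\<And>f g. f \<in> Salg s \<Longrightarrow> \<delta> (rtimes f g) = rtimes (rbar f) g"
    and sigma: "lin (Salg s) \<sigma>" "\<sigma> ` Salg s \<subseteq> Talg s"
      "\<And>g f. f \<in> Salg s \<Longrightarrow> \<sigma> (Sact s \<rho> g f) = Tact s \<rho> g (\<sigma> f)"
      "\<And>f. f \<in> Salg s \<Longrightarrow> proj_TS s (\<sigma> f) = f"
    and D: "derivation_on (Talg s) (tmul s) (SMS s s UNIV)
        (\<lambda>t. SMS_left s s UNIV (proj_TS s t)) (\<lambda>x t. SMS_right s s UNIV x (proj_TS s t)) D"
      "\<And>v. D (tword s [v]) = tri s s UNIV (sone s) v (sone s)"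
    and sweedler: "\<And>v. D (\<sigma> (r v)) = (\<Sum>j<n v. tri s s UNIV (v1 v j) (v2 v j) (v3 v j))"
      "\<And>v j. j < n v \<Longrightarrow> v1 v j \<in> Salg s" "\<And>v j. j < n v \<Longrightarrow> v3 v j \<in> Salg s"
begin

lemma r_closed: "r v \<in> Salg s" using r(2) by auto
lemma sigma_r_closed: "\<sigma> (r v) \<in> Talg s" using sigma(2) r_closed by blast

lemma rbar_linear: "lin (Salg s) rbar"
  and rbar_closed: "a \<in> Salg s \<Longrightarrow> rbar a \<in> Salg s"
  and rbar_smul: "a \<in> Salg s \<Longrightarrow> b \<in> Salg s \<Longrightarrow> rbar (smul s a b) = smul s (rbar a) b + smul s a (rbar b)"
  using rbar(1) by (auto simp: derivation_on_def)

lemma rbar_one: "rbar (sone s) = 0"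
proof -
  have "rbar (sone s) = rbar (sone s) + rbar (sone s)"
    using rbar_smul[OF sword_Salg sword_Salg, of "[]" "[]"]
    unfolding smul_sword smul_one_left[OF rbar_closed[OF sword_Salg]] smul_one_right[OF rbar_closed[OF sword_Salg]] by simp
  then show ?thesis unfolding add_cancel_right_right .
qed

text \<open>Both sides are derivations twisted by the automorphism \<open>g\<close>, and they agree
  on V because \<open>r\<close> is equivariant; the induction over words is the uniqueness of such
  derivations.\<close>

lemma rbar_act: "a \<in> Salg s \<Longrightarrow> rbar (act g a) = act g (rbar a)"
proof (rule Salg_eqI[of s "\<lambda>a. rbar (act g a)" "\<lambda>a. act g (rbar a)"])
  show "lin (Salg s) (\<lambda>a. rbar (act g a))"
    by (rule linear_on_comp[OF Sact_linear _ rbar_linear]) (auto intro: act_closed)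
  show "lin (Salg s) (\<lambda>a. act g (rbar a))"
    by (rule lin_comp[OF rbar_linear Sact_linear])
  show "rbar (act g (sword s vs)) = act g (rbar (sword s vs))" for vs
  proof (induction vs)
    case Nil
    show ?case by (simp add: act_one rbar_one Sact_0)
  next
    case (Cons v vs)
    have "rbar (act g (smul s (svec s v) (sword s vs))) = act g (rbar (smul s (svec s v) (sword s vs)))"
      using Cons by (simp add: act_smul sword_Salg rbar_smul act_closed rbar(2) rbar_closed r_closed act_add)
        (simp add: act_sword rbar(2) r(3))
    then show ?case by (simp add: smul_sword)
  qed
qed

lemma delta_linear: "lin B \<delta>"
  and delta_closed: "a \<in> B \<Longrightarrow> \<delta> a \<in> B"
  and delta_mul: "a \<in> B \<Longrightarrow> b \<in> B \<Longrightarrow> \<delta> (mul a b) = mul (\<delta> a) b + mul a (\<delta> b)"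
  using delta(1) by (auto simp: derivation_on_def)
lemmas delta_rtimes = delta(2)

lemma delta_one: "\<delta> one = 0"
  by (simp add: delta_rtimes sword_Salg rbar_one rtimes_0)

abbreviation SVS where "SVS \<equiv> SMS s s UNIV"
abbreviation vtri where "vtri \<equiv> tri s s UNIV"

lemma D_linear: "lin (Talg s) D"
  and D_closed: "t \<in> Talg s \<Longrightarrow> D t \<in> SVS"
  and D_tmul: "t \<in> Talg s \<Longrightarrow> u \<in> Talg s \<Longrightarrow>
    D (tmul s t u) = SMS_right s s UNIV (D t) (proj_TS s u) + SMS_left s s UNIV (proj_TS s t) (D u)"
  using D(1) by (auto simp: derivation_on_def)

lemma D_Nil: "D (tword s []) = 0"
proof -
  have "D (tword s []) = D (tword s []) + D (tword s [])"
    using D_tmul[OF tword_Talg tword_Talg, of "[]" "[]"]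
    unfolding tmul_tword proj_TS_tword SMS_left_one[OF D_closed[OF tword_Talg]] SMS_right_one[OF D_closed[OF tword_Talg]] by simp
  then show ?thesis unfolding add_cancel_right_right .
qed

lemma D_Cons: "D (tword s (v # vs)) =
    SMS_right s s UNIV (vtri (sone s) v (sone s)) (sword s vs) + SMS_left s s UNIV (svec s v) (D (tword s vs))"
  using D_tmul[of "tword s [v]" "tword s vs"] by (simp add: tmul_tword tword_Talg proj_TS_tword D(2))

text \<open>The element denoted by v_(1) \<otimes> v_(2) \<otimes> v_(3). The functions
  \<open>n\<close>, \<open>v1\<close>, \<open>v2\<close>, \<open>v3\<close> are an arbitrary choice
  for each vector, whereas \<open>V\<close> is linear and equivariant, so these properties of the
  lifting are proved through \<open>V\<close>.\<close>

definition V where "V v = D (\<sigma> (r v))"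

lemma V_linear: "linear_on s UNIV scl V"
  unfolding V_def
  by (rule linear_on_comp[OF linear_on_comp[OF r(1) r(2) sigma(1)] _ D_linear]) (use sigma(2) r(2) in auto)

lemma V_closed: "V v \<in> SVS"
  unfolding V_def by (rule D_closed[OF sigma_r_closed])

subsection \<open>Derivation and commutators\<close>

text \<open>\<open>D\<close> is inner up to \<open>tau\<close>: see lemma \<open>tau_D\<close>, where a sum telescopes along each word.\<close>

definition tau where
  "tau p w = lext (\<lambda>(a, v, c). ktri s p (smul s a (svec s v)) w c - ktri s p a w (smul s (svec s v) c))"

lemma tau_linear: "lin A (tau p w)" unfolding tau_def by (rule linear_on_lext)

lemma svec_add: "svec s (v + w) = svec s v + svec s w" and svec_scl: "svec s (s c v) = scl c (svec s v)"
  using svec_linear[of s] by (auto simp: linear_on_def)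

lemma tau_tri:
  assumes w: "w \<in> Ext s p"
  shows "tau p w (vtri a v c) = ktri s p (smul s a (svec s v)) w c - ktri s p a w (smul s (svec s v) c)"
  unfolding tau_def
  by (rule lext_tri_fun; rule linear_on_fieldI)
    (simp_all add: w svec_add svec_scl smul_lins Salg_mems tri_lins scl_lin_simps algebra_simps)

lemma tau_left: "w \<in> Ext s p \<Longrightarrow> f \<in> Salg s \<Longrightarrow> x \<in> SVS \<Longrightarrow> tau p w (SMS_left s s UNIV f x) = L p f (tau p w x)"
  by (rule SMS_eqI[OF lin_comp[OF SMS_left_linear tau_linear] lin_comp[OF tau_linear SMS_left_linear]])
    (auto simp: SMS_left_tri tau_tri SMS_left_diff smul_assoc Salg_mems)

lemma tau_right: "w \<in> Ext s p \<Longrightarrow> f \<in> Salg s \<Longrightarrow> x \<in> SVS \<Longrightarrow> tau p w (SMS_right s s UNIV x f) = R p (tau p w x) f"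
  by (rule SMS_eqI[OF lin_comp[OF SMS_right_linear tau_linear] lin_comp[OF tau_linear SMS_right_linear]])
    (auto simp: SMS_right_tri tau_tri SMS_right_diff smul_assoc Salg_mems)

lemma proj_TS_linear: "lin A (proj_TS s)" unfolding proj_TS_def by (rule linear_on_lext)

lemma proj_TS_closed: "t \<in> Talg s \<Longrightarrow> proj_TS s t \<in> Salg s"
  by (rule Talg_intoI[where f = "proj_TS s", OF proj_TS_linear Salg_subspace]) (simp_all add: proj_TS_tword sword_Salg)

text \<open>For a word v vs, the summand 1 \<otimes> v \<otimes> vs of D gives v \<otimes> w
  \<otimes> vs - 1 \<otimes> w \<otimes> v vs, and v D(vs) gives v vs \<otimes> w \<otimes> 1 - v
  \<otimes> w \<otimes> vs by induction; the middle terms cancel.\<close>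

lemma tau_D:
  assumes w: "w \<in> Ext s p" and t: "t \<in> Talg s"
  shows "tau p w (D t) = ktri s p (proj_TS s t) w (sone s) - ktri s p (sone s) w (proj_TS s t)"
proof (rule Talg_eqI[where f = "\<lambda>t. tau p w (D t)", OF _ _ _ t])
  show "lin (Talg s) (\<lambda>t. tau p w (D t))"
    by (rule lin_comp[OF D_linear tau_linear])
  show "lin (Talg s) (\<lambda>t. ktri s p (proj_TS s t) w (sone s) - ktri s p (sone s) w (proj_TS s t))"
    by (intro linear_on_minus linear_on_comp[OF proj_TS_linear _ tri_lin1] linear_on_comp[OF proj_TS_linear _ tri_lin3])
      (auto simp: w sword_Salg proj_TS_closed)
  show "tau p w (D (tword s vs)) =
    ktri s p (proj_TS s (tword s vs)) w (sone s) - ktri s p (sone s) w (proj_TS s (tword s vs))" for vs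
  proof (induction vs)
    case Nil
    show ?case by (simp add: D_Nil proj_TS_tword linear_on_zero[OF tau_linear UNIV_I])
  next
    case (Cons v vs)
    have add: "tau p w (x + y) = tau p w x + tau p w y" for x y
      using tau_linear[of UNIV p w] by (simp add: linear_on_def)
    show ?case
      using Cons by (simp add: D_Cons add tau_left tau_right w sword_Salg tri_SMS D_closed tword_Talg SMS_left_diff SMS_right_diff
          tau_tri proj_TS_tword SMS_left_tri SMS_right_tri smul_sword)
  qed
qed

text \<open>The point where \<sigma> being a section of \<pi> is used: the commutator for
  \<pi>(\<sigma>(r(v))) is one for r(v).\<close>

lemma tau_V: "w \<in> Ext s p \<Longrightarrow> tau p w (V v) = ktri s p (r v) w (sone s) - ktri s p (sone s) w (r v)"
  unfolding V_def by (simp add: tau_D sigma_r_closed sigma(4) r_closed)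

subsection \<open>Equivariance\<close>

definition vact where
  "vact g = lext (\<lambda>(a, v, c). vtri (act g a) (\<rho> g v) (act g c))"

lemma vact_linear: "lin A (vact g)" unfolding vact_def by (rule linear_on_lext)

lemma rho_add: "\<rho> g (v + w) = \<rho> g v + \<rho> g w" and rho_scale: "\<rho> g (s c v) = s c (\<rho> g v)"
  using rho_linear[of g] by (auto simp: linear_on_def)

lemma vact_tri: "vact g (vtri a v c) = vtri (act g a) (\<rho> g v) (act g c)"
  unfolding vact_def
  by (rule lext_tri_fun; rule linear_on_fieldI) (simp_all add: tri_lins act_add act_scl act_closed rho_add rho_scale)

lemma vact_left: "f \<in> Salg s \<Longrightarrow> x \<in> SVS \<Longrightarrow> vact g (SMS_left s s UNIV f x) = SMS_left s s UNIV (act g f) (vact g x)"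
  by (rule SMS_eqI[OF lin_comp[OF SMS_left_linear vact_linear] lin_comp[OF vact_linear SMS_left_linear]])
    (auto simp: SMS_left_tri vact_tri act_smul act_closed)

lemma vact_right: "f \<in> Salg s \<Longrightarrow> x \<in> SVS \<Longrightarrow> vact g (SMS_right s s UNIV x f) = SMS_right s s UNIV (vact g x) (act g f)"
  by (rule SMS_eqI[OF lin_comp[OF SMS_right_linear vact_linear] lin_comp[OF vact_linear SMS_right_linear]])
    (auto simp: SMS_right_tri vact_tri act_smul act_closed)

lemma Tact_word: "Tact s \<rho> g (tword s vs) = tword s (map (\<rho> g) vs)"
  by (rule Tact_tword[of s \<rho> g, OF rho_linear])

text \<open>Both sides obey the same twisted Leibniz rule and agree on V; \<open>D_Cons\<close>
  turns this into an induction over words.\<close>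

lemma D_Tact: "t \<in> Talg s \<Longrightarrow> D (Tact s \<rho> g t) = vact g (D t)"
proof (rule Talg_eqI[of s "\<lambda>t. D (Tact s \<rho> g t)" "\<lambda>t. vact g (D t)"])
  have lin: "lin (Talg s) (Tact s \<rho> g)" unfolding Tact_def by (rule linear_on_lext)
  have "Tact s \<rho> g t \<in> Talg s" if "t \<in> Talg s" for t
    by (rule Talg_intoI[where f = "Tact s \<rho> g", OF lin _ _ that]) (simp_all add: Tact_word tword_Talg Talg_subspace)
  then show "lin (Talg s) (\<lambda>t. D (Tact s \<rho> g t))"
    by (intro linear_on_comp[OF lin _ D_linear]) auto
  show "lin (Talg s) (\<lambda>t. vact g (D t))"
    by (rule lin_comp[OF D_linear vact_linear])
  have add: "vact g (x + y) = vact g x + vact g y" for x y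
    using vact_linear[of UNIV g] by (simp add: linear_on_def)
  show "D (Tact s \<rho> g (tword s vs)) = vact g (D (tword s vs))" for vs
    by (induction vs)
      (simp_all add: Tact_word D_Nil linear_on_zero[OF vact_linear UNIV_I] D_Cons add vact_left vact_right sword_Salg
        tri_SMS D_closed tword_Talg vact_tri act_one act_sword)
qed

lemma V_act: "V (\<rho> g v) = vact g (V v)"
  unfolding V_def r(3) sigma(3)[OF r_closed] by (rule D_Tact[OF sigma_r_closed])

subsection \<open>The lifting on the Koszul complex\<close>

text \<open>Puts the middle tensor factor into position \<open>i\<close> of the exterior word. Being
  defined on all of S(V) \<otimes> V \<otimes> S(V), it makes \<open>nabla\<close> independent of
  how D(\<sigma>(r(v))) is written as a sum of pure tensors.\<close>

definition insert_at where
  "insert_at p ws i = lext (\<lambda>(a, v, c). ktri s p a (wedge s p (ws[i := v])) c)"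

lemma insert_at_linear: "lin A (insert_at p ws i)" unfolding insert_at_def by (rule linear_on_lext)

lemma insert_at_tri:
  assumes "i < p" "length ws = p"
  shows "insert_at p ws i (vtri a v c) = ktri s p a (wedge s p (ws[i := v])) c"
  unfolding insert_at_def
proof (rule lext_tri_fun)
  have W: "wedge s p (ws[i := v]) \<in> Ext s p" for v using assms by (intro wedge_Ext) simp
  show "lin (Salg s) (\<lambda>a. ktri s p a (wedge s p (ws[i := m])) c)" if "c \<in> Salg s" for m c
    by (rule tri_lin1[OF W that])
  show "linear_on s UNIV scl (\<lambda>m. ktri s p a (wedge s p (ws[i := m])) c)" if "a \<in> Salg s" "c \<in> Salg s" for a c
    by (rule linear_on_comp[OF wedge_update_linear _ tri_lin2[OF that]]) (use assms W in auto)
  show "lin (Salg s) (\<lambda>c. ktri s p a (wedge s p (ws[i := m])) c)" if "a \<in> Salg s" for m a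
    by (rule tri_lin3[OF that W])
qed

definition nabla where "nabla p ws = (\<Sum>i<p. insert_at p ws i (V (ws ! i)))"

lemma insert_at_V:
  "i < p \<Longrightarrow> length ws = p \<Longrightarrow>
    insert_at p ws i (V v) = (\<Sum>j<n v. ktri s p (v1 v j) (wedge s p (ws[i := v2 v j])) (v3 v j))"
  unfolding V_def sweedler(1) lin_sum[OF insert_at_linear]
  by (simp add: insert_at_tri)

lemma insert_at_V_closed: "i < p \<Longrightarrow> length ws = p \<Longrightarrow> insert_at p ws i (V v) \<in> Kos s p"
  unfolding insert_at_V by (intro SMS_sum tri_SMS wedge_Ext) (auto intro: sweedler)

lemma nabla_sweedler:
  "length ws = p \<Longrightarrow> nabla p ws =
    (\<Sum>i<p. \<Sum>j<n (ws ! i). ktri s p (v1 (ws ! i) j) (wedge s p (ws[i := v2 (ws ! i) j])) (v3 (ws ! i) j))"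
  unfolding nabla_def by (intro sum.cong refl) (simp add: insert_at_V)

lemma nabla_closed: "length ws = p \<Longrightarrow> nabla p ws \<in> Kos s p"
  unfolding nabla_def by (intro SMS_sum insert_at_V_closed) auto

lemma nabla_slot:
  assumes p: "length us + length vs + 1 = p"
  shows "linear_on s UNIV scl (\<lambda>x. nabla p (us @ [x] @ vs))"
  unfolding nabla_def
proof (rule linear_on_setsum)
  fix i assume i: "i \<in> {..<p}"
  let ?k = "length us"
  show "linear_on s UNIV scl (\<lambda>x. insert_at p (us @ [x] @ vs) i (V ((us @ [x] @ vs) ! i)))"
  proof (cases "i = ?k")
    case True
    \<comment> \<open>The insertion overwrites entry \<open>i\<close>, so any vector may stand
      there, and \<open>x\<close> enters only through the linear map \<open>V\<close>.\<close>
    have "insert_at p (us @ [x] @ vs) i (V ((us @ [x] @ vs) ! i)) = insert_at p (us @ [0] @ vs) i (V x)" for x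
      unfolding insert_at_def True by simp
    moreover have "linear_on s UNIV scl (\<lambda>x. insert_at p (us @ [0] @ vs) i (V x))"
      by (rule lin_comp[OF V_linear insert_at_linear])
    ultimately show ?thesis by (simp only:)
  next
    case False
    define w where "w = (us @ [0] @ vs) ! i"
    have nth: "(us @ [x] @ vs) ! i = w" for x
      using False by (auto simp: w_def nth_append nth_Cons split: nat.split)
    have lin: "linear_on s UNIV scl (\<lambda>x. wedge s p ((us @ [x] @ vs)[i := v2 w j]))" for j
    proof -
      \<comment> \<open>Writing the varying entry as an update as well allows it to be exchanged
        with the insertion at \<open>i\<close>.\<close>
      have "(us @ [0] @ vs)[?k := x] = us @ [x] @ vs" for x by simp
      then have "(\<lambda>x. wedge s p ((us @ [x] @ vs)[i := v2 w j])) = (\<lambda>x. wedge s p ((us @ [0] @ vs)[i := v2 w j, ?k := x]))"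
        by (simp only: list_update_swap[OF False])
      moreover have "linear_on s UNIV scl (\<lambda>x. wedge s p ((us @ [0] @ vs)[i := v2 w j, ?k := x]))"
        by (rule wedge_update_linear) (use p in auto)
      ultimately show ?thesis by simp
    qed
    have "linear_on s UNIV scl (\<lambda>x. \<Sum>j<n w. ktri s p (v1 w j) (wedge s p ((us @ [x] @ vs)[i := v2 w j])) (v3 w j))"
      by (intro linear_on_setsum linear_on_comp[OF lin _ tri_lin2])
        (use p in \<open>auto intro!: sweedler wedge_Ext\<close>)
    then show ?thesis unfolding nth using i p by (subst insert_at_V) auto
  qed
qed

text \<open>An insertion elsewhere leaves both copies of \<open>x\<close> adjacent, so those
  summands vanish. The insertions at the two copies use the same decomposition of \<open>V x\<close>
  and cancel by antisymmetry.\<close>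

lemma nabla_repeat:
  assumes p: "length us + length vs + 2 = p"
  shows "nabla p (us @ [x, x] @ vs) = 0"
proof -
  let ?k = "length us" and ?w = "us @ [x, x] @ vs"
  let ?t = "\<lambda>i. \<Sum>j<n (?w ! i). ktri s p (v1 (?w ! i) j) (wedge s p (?w[i := v2 (?w ! i) j])) (v3 (?w ! i) j)"
  have tri0: "ktri s p a 0 c = 0" if "a \<in> Salg s" "c \<in> Salg s" for a c
    by (rule linear_on_zero[OF tri_lin2[OF that] fn.subspace_0[OF Ext_subspace]])
  have sw: "wedge s p (us @ [y, x] @ vs) + wedge s p (us @ [x, y] @ vs) = 0" for y
    by (simp only: wedge_swap[OF p, of s y x]) simp
  have "?t i = 0" if "i \<in> {..<p} - {?k, Suc ?k}" for i
  proof -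
    from that consider "i < ?k" | "i > Suc ?k" "i < p" by force
    then have "\<exists>us' vs'. length us' + length vs' + 2 = p \<and> ?w[i := y] = us' @ [x, x] @ vs'" for y
    proof cases
      case 1
      then show ?thesis using p by (intro exI[of _ "us[i := y]"] exI[of _ vs]) (simp add: list_update_append)
    next
      case 2
      then obtain m where m: "i = Suc (Suc (?k + m))"
        using less_imp_Suc_add[OF 2(1)] by auto
      show ?thesis using p m by (intro exI[of _ us] exI[of _ "vs[m := y]"]) (simp add: list_update_append)
    qed
    then have "wedge s p (?w[i := y]) = 0" for y using wedge_repeat[of _ _ p s x] by metis
    then show ?thesis by (simp add: tri0 sweedler)
  qed
  then have "(\<Sum>i<p. ?t i) = (\<Sum>i\<in>{?k, Suc ?k}. ?t i)"
    using p by (intro sum.mono_neutral_right) auto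
  also have "\<dots> = (\<Sum>j<n x. ktri s p (v1 x j) (wedge s p (us @ [v2 x j, x] @ vs)) (v3 x j)) +
      (\<Sum>j<n x. ktri s p (v1 x j) (wedge s p (us @ [x, v2 x j] @ vs)) (v3 x j))"
    by (simp add: nth_append list_update_append)
  also have "\<dots> = (\<Sum>j<n x. ktri s p (v1 x j) (wedge s p (us @ [v2 x j, x] @ vs) + wedge s p (us @ [x, v2 x j] @ vs)) (v3 x j))"
    unfolding sum.distrib[symmetric] using p
    by (intro sum.cong refl tri_add2[symmetric]) (auto intro!: sweedler wedge_Ext)
  also have "\<dots> = 0"
    by (simp only: sw) (simp add: tri0 sweedler)
  finally show ?thesis using p by (subst nabla_sweedler) auto
qed

definition Nabla where "Nabla p = lext (nabla p)"

lemma Nabla_linear: "lin A (Nabla p)" unfolding Nabla_def by (rule linear_on_lext)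
lemma Nabla_wedge: "Nabla p (wedge s p ws) = nabla p ws"
  unfolding Nabla_def by (rule lext_wedge_fun) (simp_all add: nabla_slot[simplified] nabla_repeat[simplified])
lemma Nabla_closed: "w \<in> Ext s p \<Longrightarrow> Nabla p w \<in> Kos s p"
  by (rule Ext_intoI[where f = "Nabla p", OF Nabla_linear SMS_subspace]) (simp_all add: Nabla_wedge nabla_closed)

lemma insert_at_act:
  assumes "i < p" "length ws = p" "x \<in> SVS"
  shows "kact p g (insert_at p ws i x) = insert_at p (map (\<rho> g) ws) i (vact g x)"
  using assms(3)
  by (rule SMS_eqI[OF lin_comp[OF insert_at_linear kos_act_linear] lin_comp[OF vact_linear insert_at_linear], rotated])
    (simp add: insert_at_tri vact_tri assms kact_tri Eact_wedge' map_update)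

lemma nabla_act: "length ws = p \<Longrightarrow> kact p g (nabla p ws) = nabla p (map (\<rho> g) ws)"
  unfolding nabla_def kos_act_sum
  by (intro sum.cong refl) (simp add: insert_at_act V_closed V_act)

lemma Nabla_act: "w \<in> Ext s p \<Longrightarrow> kact p g (Nabla p w) = Nabla p (Eact s \<rho> p g w)"
  by (rule Ext_eqI[OF lin_comp[OF Nabla_linear kos_act_linear] lin_comp[OF Eact_linear Nabla_linear]])
    (simp_all add: Nabla_wedge nabla_act Eact_wedge')

definition dK where
  "dK p = lext (\<lambda>(a, w, c). ktri s p (rbar a) w c + L p a (R p (Nabla p w) c) + ktri s p a w (rbar c))"

lemma dK_linear: "lin A (dK p)" unfolding dK_def by (rule linear_on_lext)

lemma rbar_add: "a \<in> Salg s \<Longrightarrow> b \<in> Salg s \<Longrightarrow> rbar (a + b) = rbar a + rbar b"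
  and rbar_scl: "a \<in> Salg s \<Longrightarrow> rbar (scl c a) = scl c (rbar a)"
  using rbar_linear by (auto simp: linear_on_def)

lemma Nabla_add: "Nabla p (x + y) = Nabla p x + Nabla p y" and Nabla_scl: "Nabla p (scl c x) = scl c (Nabla p x)"
  using Nabla_linear[of UNIV p] by (auto simp: linear_on_def)

lemma dK_tri: "dK p (ktri s p a w c) = ktri s p (rbar a) w c + L p a (R p (Nabla p w) c) + ktri s p a w (rbar c)"
  unfolding dK_def
  by (rule lext_tri_fun; rule linear_on_fieldI)
    (simp_all add: tri_lins rbar_add rbar_scl rbar_closed SMS_lins SMS_right_closed Nabla_closed Nabla_add Nabla_scl scl_lin_simps
      fn.subspace_add[OF Ext_subspace] fn.subspace_scale[OF Ext_subspace] add_ac)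

lemma dK_closed: "x \<in> Kos s p \<Longrightarrow> dK p x \<in> Kos s p"
  by (rule SMS_intoI[where f = "dK p", OF dK_linear SMS_subspace])
    (auto simp: dK_tri intro!: SMS_mems rbar_closed Nabla_closed)

lemma dK_scl: "dK p (scl c x) = scl c (dK p x)"
  using dK_linear[of UNIV p] by (auto simp: linear_on_def)
lemmas dK_sum = lin_sum[OF dK_linear]
lemmas dK_diff = lin_diff[OF dK_linear]

lemma dK_left: "x \<in> Kos s p \<Longrightarrow> f \<in> Salg s \<Longrightarrow> dK p (L p f x) = L p (rbar f) x + L p f (dK p x)"
  by (rule SMS_eqI[OF lin_comp[OF SMS_left_linear dK_linear]
        linear_on_plus[OF SMS_left_linear lin_comp[OF dK_linear SMS_left_linear]]])
    (auto simp: SMS_left_tri dK_tri rbar_smul rbar_closed smul_closed tri_lins SMS_left_smul SMS_right_closed Nabla_closed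
      SMS_left_add add_ac)

lemma dK_right: "x \<in> Kos s p \<Longrightarrow> f \<in> Salg s \<Longrightarrow> dK p (R p x f) = R p (dK p x) f + R p x (rbar f)"
  by (rule SMS_eqI[OF lin_comp[OF SMS_right_linear dK_linear]
        linear_on_plus[OF lin_comp[OF dK_linear SMS_right_linear] SMS_right_linear]])
    (auto simp: SMS_right_tri dK_tri rbar_smul rbar_closed smul_closed tri_lins SMS_right_smul SMS_right_closed Nabla_closed
      SMS_right_add SMS_left_right add_ac)

lemma dK_act: "x \<in> Kos s p \<Longrightarrow> dK p (kact p g x) = kact p g (dK p x)"
  by (rule SMS_eqI[OF lin_comp[OF kos_act_linear dK_linear] lin_comp[OF dK_linear kos_act_linear]])
    (auto simp: kact_tri dK_tri rbar_act kos_act_add kact_left kact_right SMS_right_closed Nabla_closed Nabla_act act_closed)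

text \<open>In degree 0 \<open>nabla\<close> is an empty sum, so only the derivative of the two
  coefficients remains, and the claim is the Leibniz rule for \<open>rbar\<close>.\<close>

lemma dK_aug: "x \<in> Kos s 0 \<Longrightarrow> kos_aug s (dK 0 x) = rbar (kos_aug s x)"
proof (rule kos_aug_wedge_Nil[of s "\<lambda>x. kos_aug s (dK 0 x)" "\<lambda>x. rbar (kos_aug s x)"])
  show "lin (Kos s 0) (\<lambda>x. rbar (kos_aug s x))"
    by (rule linear_on_comp[OF kos_aug_linear _ rbar_linear]) (auto intro: kos_aug_closed)
  show "kos_aug s (dK 0 (ktri s 0 a (wedge s 0 []) c)) = rbar (kos_aug s (ktri s 0 a (wedge s 0 []) c))"
    if "a \<in> Salg s" "c \<in> Salg s" for a c
    using that by (simp add: dK_tri kos_aug_add kos_aug_ktri rbar_closed rbar_smul Nabla_wedge nabla_def SMS_left_0 SMS_right_0 kos_aug_0)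
qed (rule lin_comp[OF dK_linear kos_aug_linear])

abbreviation KZ where "KZ p v x \<equiv> L p (svec s v) x - R p x (svec s v)"

text \<open>Deleting position \<open>i\<close> removes the inserted vector itself, which is what
  \<open>tau\<close> describes. Deleting another position \<open>j\<close> keeps the insertion, at
  its shifted place, and leaves the commutator with \<open>ws ! j\<close>.\<close>

lemma kos_d_insert_at:
  assumes i: "i < Suc p" and ws: "length ws = Suc p" and x: "x \<in> SVS"
  shows "kos_d s (Suc p) (insert_at (Suc p) ws i x) = scl ((-1) ^ i) (tau p (wedge s p (omit i ws)) x) +
    (\<Sum>j\<in>{..<Suc p} - {i}. scl ((-1) ^ j) (KZ p (ws ! j) (insert_at p (omit j ws) (shift j i) x)))"
    (is "_ = ?rhs x")
proof (rule SMS_eqI[where f = "\<lambda>x. kos_d s (Suc p) (insert_at (Suc p) ws i x)" and g = ?rhs, OF _ _ _ x])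
  show "lin SVS (\<lambda>x. kos_d s (Suc p) (insert_at (Suc p) ws i x))"
    by (rule lin_comp[OF insert_at_linear kos_d_linear])
  show "lin SVS ?rhs"
    by (intro linear_on_plus linear_on_setsum linear_on_times linear_on_minus tau_linear
        lin_comp[OF insert_at_linear SMS_left_linear] lin_comp[OF insert_at_linear SMS_right_linear])
  fix a v c assume a: "a \<in> Salg s" "c \<in> Salg s"
  have om: "length (omit j ws) = p" if "j < Suc p" for j using that ws by (simp add: length_omit)
  let ?F = "\<lambda>j. scl ((-1) ^ j)
      (ktri s p (smul s a (svec s (ws[i := v] ! j))) (wedge s p (omit j (ws[i := v]))) c -
       ktri s p a (wedge s p (omit j (ws[i := v]))) (smul s (svec s (ws[i := v] ! j)) c))"
  have "kos_d s (Suc p) (insert_at (Suc p) ws i (vtri a v c)) = (\<Sum>j<Suc p. ?F j)"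
    using i ws a by (simp add: insert_at_tri kos_d_ktri del: sum.lessThan_Suc)
  also have "\<dots> = ?F i + (\<Sum>j\<in>{..<Suc p} - {i}. ?F j)"
    using i by (intro sum.remove) auto
  also have "?F i = scl ((-1) ^ i) (tau p (wedge s p (omit i ws)) (vtri a v c))"
    using i ws by (simp add: omit_update_same tau_tri wedge_Ext om)
  also have "(\<Sum>j\<in>{..<Suc p} - {i}. ?F j) =
    (\<Sum>j\<in>{..<Suc p} - {i}. scl ((-1) ^ j) (KZ p (ws ! j) (insert_at p (omit j ws) (shift j i) (vtri a v c))))"
  proof (rule sum.cong[OF refl])
    fix j assume j: "j \<in> {..<Suc p} - {i}"
    then have o: "omit j (ws[i := v]) = (omit j ws)[(shift j i) := v]"
      using i ws by (intro omit_update_other) auto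
    have "(shift j i) < p" using i j by auto
    then have ins: "insert_at p (omit j ws) (shift j i) (vtri a v c) =
        ktri s p a (wedge s p ((omit j ws)[(shift j i) := v])) c"
      using om j by (intro insert_at_tri) auto
    have nth: "ws[i := v] ! j = ws ! j" using j by simp
    \<comment> \<open>The differential multiplies by \<open>ws ! j\<close> on the inner sides of the
      coefficients and \<open>KZ\<close> on the outer ones; the two agree because S(V) is
      commutative.\<close>
    show "?F j = scl ((-1) ^ j) (KZ p (ws ! j) (insert_at p (omit j ws) (shift j i) (vtri a v c)))"
      unfolding o ins nth SMS_left_tri[OF sword_Salg] SMS_right_tri[OF sword_Salg]
        smul_commute[OF a(1) sword_Salg] smul_commute[OF a(2) sword_Salg] ..
  qed
  finally show "kos_d s (Suc p) (insert_at (Suc p) ws i (vtri a v c)) = ?rhs (vtri a v c)" .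
qed

text \<open>The shift is a bijection from the positions other than \<open>j\<close> onto the
  positions of \<open>omit j ws\<close>.\<close>

lemma nabla_omit:
  assumes j: "j < Suc p" and ws: "length ws = Suc p"
  shows "(\<Sum>i\<in>{..<Suc p} - {j}. insert_at p (omit j ws) (shift j i) (V (ws ! i))) = nabla p (omit j ws)"
  unfolding nabla_def
  by (rule sum.reindex_bij_witness[of _ "\<lambda>i. if i < j then i else Suc i" "\<lambda>i. if i < j then i else i - 1"])
    (use j ws in \<open>auto simp: nth_omit split: if_splits\<close>)

text \<open>Exchanging the sums over inserted and deleted positions collects, for a fixed deleted
  \<open>j\<close>, the insertions at all other places into \<open>nabla\<close> of the shorter
  word. The \<open>tau\<close> terms become the commutators with \<open>r (ws ! j)\<close> by
  \<open>tau_V\<close>.\<close>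

lemma kos_d_nabla:
  assumes ws: "length ws = Suc p"
  shows "kos_d s (Suc p) (nabla (Suc p) ws) = (\<Sum>j<Suc p. scl ((-1) ^ j)
    (ktri s p (r (ws ! j)) (wedge s p (omit j ws)) (sone s) - ktri s p (sone s) (wedge s p (omit j ws)) (r (ws ! j)) +
     KZ p (ws ! j) (nabla p (omit j ws))))"
proof -
  have W: "wedge s p (omit j ws) \<in> Ext s p" if "j < Suc p" for j using that ws by (intro wedge_Ext) (simp add: length_omit)
  let ?T = "\<lambda>j. scl ((-1) ^ j) (ktri s p (r (ws ! j)) (wedge s p (omit j ws)) (sone s) -
    ktri s p (sone s) (wedge s p (omit j ws)) (r (ws ! j)))"
  let ?U = "\<lambda>i j. scl ((-1) ^ j) (KZ p (ws ! j) (insert_at p (omit j ws) (shift j i) (V (ws ! i))))"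
  have "kos_d s (Suc p) (nabla (Suc p) ws) = (\<Sum>i<Suc p. ?T i + (\<Sum>j\<in>{..<Suc p} - {i}. ?U i j))"
    unfolding nabla_def kos_d_sum
    by (intro sum.cong refl) (simp add: kos_d_insert_at ws V_closed tau_V W)
  also have "\<dots> = (\<Sum>i<Suc p. ?T i) + (\<Sum>i<Suc p. \<Sum>j\<in>{..<Suc p} - {i}. ?U i j)"
    by (rule sum.distrib)
  also have "(\<Sum>i<Suc p. \<Sum>j\<in>{..<Suc p} - {i}. ?U i j) = (\<Sum>j<Suc p. \<Sum>i\<in>{..<Suc p} - {j}. ?U i j)"
    unfolding sum.Sigma[OF finite_lessThan ballI[OF finite_Diff[OF finite_lessThan]]]
    by (rule sum.reindex_bij_witness[of _ "\<lambda>(i, j). (j, i)" "\<lambda>(i, j). (j, i)"]) auto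
  also have "\<dots> = (\<Sum>j<Suc p. scl ((-1) ^ j) (KZ p (ws ! j) (nabla p (omit j ws))))"
  proof (rule sum.cong[OF refl])
    fix j assume "j \<in> {..<Suc p}"
    then have j: "j < Suc p" by simp
    show "(\<Sum>i\<in>{..<Suc p} - {j}. ?U i j) = scl ((-1) ^ j) (KZ p (ws ! j) (nabla p (omit j ws)))"
      unfolding nabla_omit[OF j ws, symmetric] by (simp only: SMS_left_sum SMS_right_sum sum_subtractf flip: fn.scale_sum_right)
  qed
  finally show ?thesis unfolding sum.distrib[symmetric] scl_lin_simps(1)[symmetric] .
qed

text \<open>Both sides obey the same Leibniz rules over the two multiplications, so it is enough to
  compare them at 1 \<otimes> ws \<otimes> 1. There the right-hand side is the derivative of the
  coefficients \<open>ws ! j\<close> plus a commutator, which is the formula of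
  \<open>kos_d_nabla\<close>.\<close>

lemma kos_d_dK:
  assumes x: "x \<in> Kos s (Suc p)"
  shows "kos_d s (Suc p) (dK (Suc p) x) = dK p (kos_d s (Suc p) x)"
proof (rule Kos_eqI[OF lin_comp[OF dK_linear kos_d_linear] lin_comp[OF kos_d_linear dK_linear] _ x])
  fix a ws c assume a: "a \<in> Salg s" "length (ws :: 'v list) = Suc p" "c \<in> Salg s"
  let ?e = "ktri s (Suc p) (sone s) (wedge s (Suc p) ws) (sone s)"
  have W: "wedge s p (omit j ws) \<in> Ext s p" if "j < Suc p" for j using that a by (intro wedge_Ext) (simp add: length_omit)
  have e: "?e \<in> Kos s (Suc p)" using a by (intro tri_SMS sword_Salg wedge_Ext)
  have "dK (Suc p) ?e = nabla (Suc p) ws"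
    using a 
    by (simp add: tri_zero1 tri_zero3 dK_tri rbar_one Nabla_wedge wedge_Ext sword_Salg SMS_left_one SMS_right_one nabla_closed)
  moreover have "dK p (kos_d s (Suc p) ?e) = kos_d s (Suc p) (nabla (Suc p) ws)"
  proof -
    have "dK p (kos_d s (Suc p) ?e) = (\<Sum>j<Suc p. scl ((-1) ^ j)
        (dK p (ktri s p (svec s (ws ! j)) (wedge s p (omit j ws)) (sone s)) -
         dK p (ktri s p (sone s) (wedge s p (omit j ws)) (svec s (ws ! j)))))"
      by (simp add: kos_d_ktri sword_Salg smul_sword dK_sum dK_scl dK_diff del: sum.lessThan_Suc)
    also have "\<dots> = kos_d s (Suc p) (nabla (Suc p) ws)"
      unfolding kos_d_nabla[OF a(2)]
    proof (rule sum.cong[OF refl])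
      fix j assume "j \<in> {..<Suc p}"
      then have j: "j < Suc p" by simp
      then have "length (omit j ws) = p" using a by (simp add: length_omit)
      then show "scl ((-1) ^ j)
        (dK p (ktri s p (svec s (ws ! j)) (wedge s p (omit j ws)) (sone s)) -
         dK p (ktri s p (sone s) (wedge s p (omit j ws)) (svec s (ws ! j)))) =
        scl ((-1) ^ j) (ktri s p (r (ws ! j)) (wedge s p (omit j ws)) (sone s) - ktri s p (sone s) (wedge s p (omit j ws)) (r (ws ! j)) +
          KZ p (ws ! j) (nabla p (omit j ws)))"
        using W[OF j] 
        by (simp add: tri_zero1 tri_zero3 dK_tri rbar_one rbar(2) Nabla_wedge sword_Salg SMS_left_one SMS_right_one nabla_closed SMS_right_closed algebra_simps)
    qed
    finally show ?thesis .
  qed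
  ultimately have ee: "kos_d s (Suc p) (dK (Suc p) ?e) = dK p (kos_d s (Suc p) ?e)" by simp
  have de: "kos_d s (Suc p) ?e \<in> Kos s p" by (rule kos_d_closed[OF e])
  have k: "ktri s (Suc p) a (wedge s (Suc p) ws) c = L (Suc p) a (R (Suc p) ?e c)"
    using a by (intro tri_as_mults wedge_Ext)
  show "kos_d s (Suc p) (dK (Suc p) (ktri s (Suc p) a (wedge s (Suc p) ws) c)) =
    dK p (kos_d s (Suc p) (ktri s (Suc p) a (wedge s (Suc p) ws) c))"
    unfolding k using a e de
    by (simp add: dK_left dK_right kos_d_left kos_d_right SMS_right_closed SMS_left_closed rbar_closed kos_d_add dK_closed ee SMS_add)
qed

subsection \<open>The lifting on the smash product\<close>

definition dG where "dG p = rtimes_map (dK p)"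

lemma dG_rtimes: "dG p (rtimes x g) = rtimes (dK p x) g"
  by (simp add: dG_def rtimes_map_rtimes linear_on_zero[OF dK_linear UNIV_I])
lemma dG_linear: "lin A (dG p)"
  unfolding dG_def by (rule linear_on_subset[OF rtimes_map_linear[where M = UNIV, OF dK_linear]]) (simp add: Rtimes_UNIV)
lemma dG_closed: "x \<in> KG s p \<Longrightarrow> dG p x \<in> KG s p"
  unfolding dG_def by (rule rtimes_map_into[OF dK_closed])

text \<open>Multiplying by b \<rtimes> g replaces x by b g(x). The Leibniz rule of \<open>dK\<close>
  gives \<open>rbar\<close> of b times g(x) plus b times \<open>dK\<close> of g(x), and equivariance
  moves g out of \<open>dK\<close>. In \<open>dG_right\<close> it is \<open>rbar\<close> that has to
  commute with G.\<close>

lemma dG_left: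
  assumes x: "x \<in> KG s p" and b: "b \<in> B"
  shows "dG p (GL p b x) = GL p (\<delta> b) x + GL p b (dG p x)"
proof (rule SG_eqI[of "\<lambda>b. dG p (GL p b x)" "\<lambda>b. GL p (\<delta> b) x + GL p b (dG p x)"])
  show "lin B (\<lambda>b. dG p (GL p b x))"
    by (rule lin_comp[OF GL_linear_left[OF x] dG_linear])
  show "lin B (\<lambda>b. GL p (\<delta> b) x + GL p b (dG p x))"
    by (intro linear_on_plus GL_linear_left dG_closed x linear_on_comp[OF delta_linear _ GL_linear_left]) (auto intro: delta_closed)
  fix b and g :: 'g assume b: "b \<in> Salg s"
  show "dG p (GL p (rtimes b g) x) = GL p (\<delta> (rtimes b g)) x + GL p (rtimes b g) (dG p x)"
    by (rule KG_eqI[OF lin_comp[OF GL_linear dG_linear]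
          linear_on_plus[OF GL_linear lin_comp[OF dG_linear GL_linear]] _ x])
      (simp add: GL_rtimes b dG_rtimes delta_rtimes rbar_closed dK_left kact_closed dK_act dK_closed rtimes_add)
qed fact

lemma dG_right:
  assumes x: "x \<in> KG s p" and b: "b \<in> B"
  shows "dG p (GR p x b) = GR p (dG p x) b + GR p x (\<delta> b)"
proof (rule SG_eqI[of "\<lambda>b. dG p (GR p x b)" "\<lambda>b. GR p (dG p x) b + GR p x (\<delta> b)"])
  show "lin B (\<lambda>b. dG p (GR p x b))"
    by (rule lin_comp[OF GR_linear_right[OF x] dG_linear])
  show "lin B (\<lambda>b. GR p (dG p x) b + GR p x (\<delta> b))"
    by (intro linear_on_plus GR_linear_right dG_closed x linear_on_comp[OF delta_linear _ GR_linear_right]) (auto intro: delta_closed)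
  fix b and g :: 'g assume b: "b \<in> Salg s"
  show "dG p (GR p x (rtimes b g)) = GR p (dG p x) (rtimes b g) + GR p x (\<delta> (rtimes b g))"
    by (rule KG_eqI[OF lin_comp[OF GR_linear dG_linear]
          linear_on_plus[OF lin_comp[OF dG_linear GR_linear] GR_linear] _ x])
      (simp add: GR_rtimes b dG_rtimes delta_rtimes rbar_closed dK_right act_closed rbar_act dK_closed rtimes_add)
qed fact

lemma KG_d_dG: "x \<in> KG s (Suc p) \<Longrightarrow> KG_d s (Suc p) (dG (Suc p) x) = dG p (KG_d s (Suc p) x)"
  for x :: "'g \<times> _ \<Rightarrow> 'k"
  by (rule KG_eqI[OF lin_comp[OF dG_linear KG_d_linear] lin_comp[OF KG_d_linear dG_linear]])
    (simp_all add: dG_rtimes KG_d_rtimes kos_d_dK)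

lemma KG_aug_dG: "x \<in> KG s 0 \<Longrightarrow> KG_aug s (dG 0 x) = \<delta> (KG_aug s x)"
  by (rule KG_eqI[OF lin_comp[OF dG_linear KG_aug_linear] linear_on_comp[OF KG_aug_linear _ delta_linear]])
    (auto simp: dG_rtimes KG_aug_rtimes dK_aug delta_rtimes kos_aug_closed KG_aug_closed)

lemma dG_lifting: "delta_e_lifting B \<delta> (KG s) GL GR (KG_d s) (KG_aug s) dG"
  unfolding delta_e_lifting_def
  using dG_linear dG_closed KG_d_dG KG_aug_dG
  by (auto simp: dG_left dG_right GL_closed GR_closed KG_lins dG_closed delta_closed)

lemma dG_gen:
  assumes "length vs = p"
  shows "dG p (rtimes (ktri s p (sone s) (wedge s p vs) (sone s)) 0) =
    (\<Sum>i<p. \<Sum>j<n (vs ! i). rtimes (ktri s p (v1 (vs ! i) j) (wedge s p (vs[i := v2 (vs ! i) j])) (v3 (vs ! i) j)) (0::'g))"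
proof -
  have "dK p (ktri s p (sone s) (wedge s p vs) (sone s)) = nabla p vs"
    using assms 
    by (simp add: tri_zero1 tri_zero3 dK_tri rbar_one Nabla_wedge wedge_Ext sword_Salg SMS_left_one SMS_right_one nabla_closed)
  then show ?thesis
    by (simp add: dG_rtimes nabla_sweedler[OF assms] lin_sum[OF rtimes_linear])
qed

end


section \<open>The bar resolution\<close>

lemma merge_at_0: "merge_at f 0 (x # y # zs) = f x y # zs"
  and merge_at_Suc: "merge_at f (Suc i) (x # xs) = x # merge_at f i xs"
  by (simp_all add: merge_at_def)

lemma merge_at_append: "Suc i < length xs \<Longrightarrow> merge_at f i (xs @ ys) = merge_at f i xs @ ys"
  by (simp add: merge_at_def nth_append)

lemma merge_at_last: "merge_at f (length xs) (xs @ [x, y]) = xs @ [f x y]"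
  by (simp add: merge_at_def nth_append)

lemma length_merge_at: "Suc i < length xs \<Longrightarrow> length (merge_at f i xs) = length xs - 1"
  by (simp add: merge_at_def)

lemma set_merge_at:
  assumes "Suc i < length xs" "set xs \<subseteq> A" "\<And>x y. x \<in> A \<Longrightarrow> y \<in> A \<Longrightarrow> f x y \<in> A"
  shows "set (merge_at f i xs) \<subseteq> A"
proof -
  have "xs ! i \<in> A" "xs ! Suc i \<in> A" using assms(1,2) by (auto intro: subsetD[OF assms(2)] nth_mem)
  then show ?thesis using assms set_take_subset[of i xs] set_drop_subset[of "i + 2" xs] by (auto simp: merge_at_def)
qed

lemma tpow_slot:
  assumes "set us \<subseteq> A" "set vs \<subseteq> A" "length us + length vs + 1 = n"
  shows "linear_on s A scl (\<lambda>x. tpow s A n (us @ [x] @ vs))"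
  by (rule linear_on_pointwise) (rule tpow_linear[OF linear_on_ident _ assms], simp)

lemma lext_tpow_fun:
  assumes "\<And>us vs. set us \<subseteq> A \<Longrightarrow> set vs \<subseteq> A \<Longrightarrow> length us + length vs + 1 = n \<Longrightarrow>
    linear_on s A scl (\<lambda>x. F (us @ [x] @ vs))"
  shows "lext F (tpow s A n bs) = F bs"
  by (rule lext_tpow) (rule linear_on_apply[OF assms])

lemma Tpow_subspace: "fn.subspace (Tpow s A n)" by (simp add: Tpow_def)
lemma tpow_Tpow: "set xs \<subseteq> A \<Longrightarrow> length xs = n \<Longrightarrow> tpow s A n xs \<in> Tpow s A n"
  unfolding Tpow_def by (rule fn.span_base) blast

lemma Tpow_eqI:
  assumes "lin (Tpow s A n) f" "lin (Tpow s A n) g"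
    and "\<And>xs. set xs \<subseteq> A \<Longrightarrow> length xs = n \<Longrightarrow> f (tpow s A n xs) = g (tpow s A n xs)" and "x \<in> Tpow s A n"
  shows "f x = g x"
  using assms linear_on_span_eq[of "{tpow s A n xs |xs. set xs \<subseteq> A \<and> length xs = n}" f g x] unfolding Tpow_def by auto

lemma Tpow_intoI:
  assumes "lin (Tpow s A n) f" "fn.subspace N"
    and "\<And>xs. set xs \<subseteq> A \<Longrightarrow> length xs = n \<Longrightarrow> f (tpow s A n xs) \<in> N" and "x \<in> Tpow s A n"
  shows "f x \<in> N"
  using assms linear_on_span_into[of "{tpow s A n xs |xs. set xs \<subseteq> A \<and> length xs = n}" f N x] unfolding Tpow_def by auto

context smash
begin

section \<open>The bar complex is a complex of bimodules\<close>

abbreviation BL where "BL \<equiv> bar_left s \<rho>"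
abbreviation BR where "BR \<equiv> bar_right s \<rho>"
abbreviation bd where "bd \<equiv> bar_d s \<rho>"

lemma BL_linear: "lin A (BL n b)" unfolding bar_left_def by (rule linear_on_lext)
lemma BR_linear: "lin A (\<lambda>x. BR n x b)"
  unfolding bar_right_def using linear_on_lext[of A "\<lambda>bs. btens s (n + 2) (butlast bs @ [mul (last bs) b])"] by simp
lemma bd_linear: "lin A (bd n)" unfolding bar_d_def by (rule linear_on_lext)
lemma bar_aug_linear: "lin A (bar_aug s \<rho>)" unfolding bar_aug_def by (rule linear_on_lext)

lemma BL_btens: "b \<in> B \<Longrightarrow> BL n b (btens s (n + 2) (x # xs)) = btens s (n + 2) (mul b x # xs)"
  using bar_left_btens[of s \<rho>, OF rho_linear] by simp
lemma BR_btens: "b \<in> B \<Longrightarrow> BR n (btens s (n + 2) (xs @ [x])) b = btens s (n + 2) (xs @ [mul x b])"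
  using bar_right_btens[of s \<rho>, OF rho_linear] by simp
lemma bd_btens: "bd n (btens s (n + 2) bs) = (\<Sum>i<Suc n. scl ((-1) ^ i) (btens s (n + 1) (merge_at mul i bs)))"
  using bar_d_btens[of s \<rho>, OF rho_linear] by (simp del: sum.lessThan_Suc)
lemma bar_aug_pair: "bar_aug s \<rho> (btens s 2 [a, b]) = mul a b"
  by (rule bar_aug_btens[of s \<rho>, OF rho_linear])

lemma bd_closed: "x \<in> Btens s (n + 2) \<Longrightarrow> bd n x \<in> Btens s (n + 1)"
proof (rule Tpow_intoI[where f = "bd n", OF bd_linear Tpow_subspace])
  fix xs assume xs: "set xs \<subseteq> B" "length xs = n + 2"
  show "bd n (btens s (n + 2) xs) \<in> Btens s (n + 1)"
    unfolding bd_btens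
    by (intro fn.subspace_sum[OF Tpow_subspace] fn.subspace_scale[OF Tpow_subspace] tpow_Tpow set_merge_at)
      (use xs in \<open>auto simp: length_merge_at mul_closed\<close>)
qed

lemma list_last_cases: "length xs = n + 2 \<Longrightarrow> (\<And>a bs c. xs = a # bs @ [c] \<Longrightarrow> length bs = n \<Longrightarrow> P) \<Longrightarrow> P"
  by (cases xs; cases "tl xs" rule: rev_cases) auto

lemma Bar_eqI:
  assumes "lin (Bar s n) f" "lin (Bar s n) g"
    and "\<And>a bs c. a \<in> B \<Longrightarrow> c \<in> B \<Longrightarrow> set bs \<subseteq> B \<Longrightarrow> length bs = n \<Longrightarrow>
      f (btens s (n + 2) (a # bs @ [c])) = g (btens s (n + 2) (a # bs @ [c]))"
    and "x \<in> Bar s n"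
  shows "f x = g x"
  by (rule Tpow_eqI[OF assms(1,2) _ assms(4)]) (erule list_last_cases, use assms(3) in auto)

lemma Bar_intoI:
  assumes "lin (Bar s n) f" "fn.subspace N"
    and "\<And>a bs c. a \<in> B \<Longrightarrow> c \<in> B \<Longrightarrow> set bs \<subseteq> B \<Longrightarrow> length bs = n \<Longrightarrow> f (btens s (n + 2) (a # bs @ [c])) \<in> N"
    and "x \<in> Bar s n"
  shows "f x \<in> N"
  by (rule Tpow_intoI[OF assms(1,2) _ assms(4)]) (erule list_last_cases, use assms(3) in auto)

lemma BL_gen: "b \<in> B \<Longrightarrow> BL n b (btens s (n + 2) (a # bs @ [c])) = btens s (n + 2) (mul b a # bs @ [c])"
  by (rule BL_btens)
lemma BR_gen: "b \<in> B \<Longrightarrow> BR n (btens s (n + 2) (a # bs @ [c])) b = btens s (n + 2) (a # bs @ [mul c b])"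
  using BR_btens[of b n "a # bs" c] by simp

lemma gen_closed: "a \<in> B \<Longrightarrow> c \<in> B \<Longrightarrow> set bs \<subseteq> B \<Longrightarrow> length bs = n \<Longrightarrow> btens s (n + 2) (a # bs @ [c]) \<in> Bar s n"
  by (rule tpow_Tpow) auto

lemma BL_closed: "b \<in> B \<Longrightarrow> x \<in> Bar s n \<Longrightarrow> BL n b x \<in> Bar s n"
  by (rule Bar_intoI[where f = "BL n b", OF BL_linear Tpow_subspace]) (simp_all only: BL_gen gen_closed mul_closed)
lemma BR_closed: "b \<in> B \<Longrightarrow> x \<in> Bar s n \<Longrightarrow> BR n x b \<in> Bar s n"
  by (rule Bar_intoI[where f = "\<lambda>x. BR n x b", OF BR_linear Tpow_subspace]) (simp_all only: BR_gen gen_closed mul_closed)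

lemma gen_mults:
  assumes "a \<in> B" "c \<in> B"
  shows "btens s (n + 2) (a # bs @ [c]) = BR n (BL n a (btens s (n + 2) (one # bs @ [one]))) c"
  using assms by (simp only: BL_gen BR_gen mul_one_left mul_one_right)

lemma bd_left:
  assumes b: "b \<in> B" and x: "x \<in> Bar s (Suc n)"
  shows "bd (Suc n) (BL (Suc n) b x) = BL n b (bd (Suc n) x)"
proof (rule Tpow_eqI[OF lin_comp[OF BL_linear bd_linear] lin_comp[OF bd_linear BL_linear] _ x])
  fix xs assume xs: "set xs \<subseteq> B" "length xs = Suc n + 2"
  then obtain a a' ys where ys: "xs = a # a' # ys" by (cases xs; cases "tl xs") auto
  have "BL n b (bd (Suc n) (btens s (Suc n + 2) xs)) =
      (\<Sum>i<Suc (Suc n). scl ((-1) ^ i) (BL n b (btens s (n + 2) (merge_at mul i xs))))"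
    using BL_linear[of UNIV n b] unfolding bd_btens lin_sum[OF BL_linear]
    by (simp add: linear_on_def del: sum.lessThan_Suc)
  also have "\<dots> = (\<Sum>i<Suc (Suc n). scl ((-1) ^ i) (btens s (n + 2) (merge_at mul i (mul b a # a' # ys))))"
  proof (rule sum.cong[OF refl])
    fix i
    show "scl ((-1) ^ i) (BL n b (btens s (n + 2) (merge_at mul i xs))) =
      scl ((-1) ^ i) (btens s (n + 2) (merge_at mul i (mul b a # a' # ys)))"
      unfolding ys by (cases i) (use b xs ys in \<open>simp_all only: merge_at_0 merge_at_Suc BL_btens, simp add: mul_assoc\<close>)
  qed
  also have "\<dots> = bd (Suc n) (BL (Suc n) b (btens s (Suc n + 2) xs))"
    unfolding ys BL_btens[OF b] bd_btens by (simp del: sum.lessThan_Suc)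
  finally show "bd (Suc n) (BL (Suc n) b (btens s (Suc n + 2) xs)) = BL n b (bd (Suc n) (btens s (Suc n + 2) xs))" ..
qed

lemma bd_right:
  assumes b: "b \<in> B" and x: "x \<in> Bar s (Suc n)"
  shows "bd (Suc n) (BR (Suc n) x b) = BR n (bd (Suc n) x) b"
proof (rule Tpow_eqI[where f = "\<lambda>x. bd (Suc n) (BR (Suc n) x b)" and g = "\<lambda>x. BR n (bd (Suc n) x) b", OF
      lin_comp[OF BR_linear bd_linear] lin_comp[OF bd_linear BR_linear] _ x])
  fix xs assume xs: "set xs \<subseteq> B" "length xs = Suc n + 2"
  then obtain ys a a' where ys: "xs = ys @ [a, a']"
    by (cases xs rule: rev_cases; cases "butlast xs" rule: rev_cases) auto
  have "BR n (bd (Suc n) (btens s (Suc n + 2) xs)) b =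
      (\<Sum>i<Suc (Suc n). scl ((-1) ^ i) (BR n (btens s (n + 2) (merge_at mul i xs)) b))"
    using BR_linear[of UNIV n b] unfolding bd_btens lin_sum[OF BR_linear]
    by (simp add: linear_on_def del: sum.lessThan_Suc)
  also have "\<dots> = (\<Sum>i<Suc (Suc n). scl ((-1) ^ i) (btens s (n + 2) (merge_at mul i (ys @ [a, mul a' b]))))"
  proof (rule sum.cong[OF refl])
    fix i assume "i \<in> {..<Suc (Suc n)}"
    then consider "i < Suc n" | "i = length ys" using xs ys by fastforce
    then show "scl ((-1) ^ i) (BR n (btens s (n + 2) (merge_at mul i xs)) b) =
      scl ((-1) ^ i) (btens s (n + 2) (merge_at mul i (ys @ [a, mul a' b])))"
    proof cases
      case 1
      then have "merge_at mul i ((ys @ [a]) @ [z]) = merge_at mul i (ys @ [a]) @ [z]" for z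
        using xs ys by (intro merge_at_append) auto
      then show ?thesis unfolding ys by (simp add: BR_btens[OF b, of n, simplified])
    next
      case 2
      have "mul (mul a a') b = mul a (mul a' b)" using xs ys b by (intro mul_assoc) auto
      then show ?thesis unfolding ys 2 merge_at_last BR_btens[OF b] by simp
    qed
  qed
  also have "\<dots> = bd (Suc n) (BR (Suc n) (btens s (Suc n + 2) xs) b)"
    using BR_btens[OF b, of "Suc n" "ys @ [a]" a'] bd_btens[of "Suc n" "ys @ [a, mul a' b]"] unfolding ys
    by (simp del: sum.lessThan_Suc)
  finally show "bd (Suc n) (BR (Suc n) (btens s (Suc n + 2) xs) b) = BR n (bd (Suc n) (btens s (Suc n + 2) xs)) b" ..
qed

text \<open>The contracting homotopy x -> 1 \<otimes> x of the bar complex; the index counts tensor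
  factors. Together with left multiplication it produces all tensors, which allows inductions on the
  degree in place of cancellations in double sums.\<close>

definition cons1 where "cons1 m = lext (\<lambda>xs. btens s (Suc m) (one # xs))"

lemma cons1_linear: "lin A (cons1 m)" unfolding cons1_def by (rule linear_on_lext)

lemma cons1_btens: "cons1 m (btens s m xs) = btens s (Suc m) (one # xs)"
  unfolding cons1_def
proof (rule lext_tpow_fun)
  fix us vs assume "set us \<subseteq> B" "set vs \<subseteq> B" "length us + length vs + 1 = m"
  then show "lin B (\<lambda>x. btens s (Suc m) (one # us @ [x] @ vs))"
    using tpow_slot[of "one # us" B vs "Suc m" scl] one_SG by simp
qed

lemma cons1_closed: "x \<in> Btens s m \<Longrightarrow> cons1 m x \<in> Btens s (Suc m)"
  by (rule Tpow_intoI[where f = "cons1 m", OF cons1_linear Tpow_subspace])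
    (auto simp: cons1_btens one_SG intro!: tpow_Tpow)

lemma scl_minus_one: "scl (- c) x = - scl c x" by (simp add: fn.scale_minus_left)

lemma bd_cons1:
  assumes x: "x \<in> Btens s (n + 2)"
  shows "bd (Suc n) (cons1 (n + 2) x) = x - cons1 (n + 1) (bd n x)"
proof (rule Tpow_eqI[where f = "\<lambda>x. bd (Suc n) (cons1 (n + 2) x)", OF lin_comp[OF cons1_linear bd_linear]
      linear_on_minus[OF linear_on_ident lin_comp[OF bd_linear cons1_linear]] _ x])
  fix xs assume xs: "set xs \<subseteq> B" "length xs = n + 2"
  then obtain a ys where ys: "xs = a # ys" "a \<in> B" by (cases xs) auto
  have "bd (Suc n) (cons1 (n + 2) (btens s (n + 2) xs)) =
      (\<Sum>i<Suc (Suc n). scl ((-1) ^ i) (btens s (n + 2) (merge_at mul i (one # xs))))"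
    using bd_btens[of "Suc n" "one # xs"] by (simp add: cons1_btens del: sum.lessThan_Suc)
  also have "\<dots> = btens s (n + 2) xs - (\<Sum>i<Suc n. scl ((-1) ^ i) (btens s (n + 2) (one # merge_at mul i xs)))"
    unfolding sum.lessThan_Suc_shift[of _ "Suc n"]
    by (simp add: ys merge_at_0 merge_at_Suc mul_one_left scl_minus_one sum_negf del: sum.lessThan_Suc)
  also have "(\<Sum>i<Suc n. scl ((-1) ^ i) (btens s (n + 2) (one # merge_at mul i xs))) = cons1 (n + 1) (bd n (btens s (n + 2) xs))"
    using cons1_linear[of UNIV "n + 1"] unfolding bd_btens lin_sum[OF cons1_linear]
    by (simp add: linear_on_def cons1_btens[of "Suc n"] del: sum.lessThan_Suc)
  finally show "bd (Suc n) (cons1 (n + 2) (btens s (n + 2) xs)) = btens s (n + 2) xs - cons1 (n + 1) (bd n (btens s (n + 2) xs))" .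
qed

lemma bd_pair: "bd 0 (btens s (Suc (Suc 0)) [a, b]) = btens s (Suc 0) [mul a b]"
  using bd_btens[of 0 "[a, b]"] by (simp add: merge_at_0)

lemma bd_triple: "bd (Suc 0) (btens s (Suc (Suc (Suc 0))) [a, b, c]) =
    btens s (Suc (Suc 0)) [mul a b, c] - btens s (Suc (Suc 0)) [a, mul b c]"
  using bd_btens[of "Suc 0" "[a, b, c]"] by (simp add: merge_at_0 merge_at_Suc scl_minus_one)

lemma length_eq_3: "length xs = 3 \<Longrightarrow> \<exists>a b c. xs = [a, b, c]"
  by (auto simp: length_Suc_conv numeral_3_eq_3)
lemma length_eq_2: "length xs = 2 \<Longrightarrow> \<exists>a b. xs = [a, b]"
  by (auto simp: length_Suc_conv numeral_2_eq_2)

lemma bar_aug_bd: "x \<in> Bar s 1 \<Longrightarrow> bar_aug s \<rho> (bd 1 x) = 0"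
proof (rule Tpow_eqI[OF lin_comp[OF bd_linear bar_aug_linear] linear_on_const_zero])
  fix xs assume xs: "set xs \<subseteq> B" "length xs = 1 + 2"
  then obtain a b c where "xs = [a, b, c]" using length_eq_3[of xs] by auto
  with xs show "bar_aug s \<rho> (bd 1 (btens s (1 + 2) xs)) = 0"
    by (simp add: numeral_3_eq_3 bd_triple lin_diff[OF bar_aug_linear] bar_aug_pair[unfolded numeral_2_eq_2] mul_assoc)
qed

text \<open>A pure tensor is a(1 \<otimes> y), and d is left linear. By \<open>bd_cons1\<close>, d
  d(1 \<otimes> y) = dy - d(1 \<otimes> dy) = 1 \<otimes> d d y, which vanishes by induction. The
  induction starts at \<open>bd 0\<close>, the multiplication of two factors with values in the
  first tensor power.\<close>

lemma bd_bd: "x \<in> Btens s (n + 3) \<Longrightarrow> bd n (bd (Suc n) x) = 0"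
proof (induction n arbitrary: x)
  case 0
  show ?case
  proof (rule Tpow_eqI[OF lin_comp[OF bd_linear bd_linear] linear_on_const_zero _ 0])
    fix xs assume xs: "set xs \<subseteq> B" "length xs = 0 + 3"
    then obtain a b c where "xs = [a, b, c]" using length_eq_3[of xs] by auto
    with xs show "bd 0 (bd (Suc 0) (btens s (0 + 3) xs)) = 0"
      by (simp add: numeral_3_eq_3 bd_triple lin_diff[OF bd_linear] bd_pair mul_assoc)
  qed
next
  case (Suc k)
  show ?case
  proof (rule Tpow_eqI[OF lin_comp[OF bd_linear bd_linear] linear_on_const_zero _ Suc.prems])
    fix xs assume xs: "set xs \<subseteq> B" "length xs = Suc k + 3"
    then obtain a ys where ys: "xs = a # ys" "a \<in> B" "set ys \<subseteq> B" "length ys = k + 3" by (cases xs) auto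
    let ?y = "btens s (k + 3) ys"
    have y: "?y \<in> Btens s (k + 3)" using ys by (intro tpow_Tpow) auto
    have y': "?y \<in> Btens s (Suc k + 2)" using y by (simp add: numeral_3_eq_3)
    have z: "bd (Suc k) ?y \<in> Btens s (k + 2)" using bd_closed[OF y'] by simp
    have e: "cons1 (k + 3) ?y \<in> Bar s (Suc (Suc k))" using cons1_closed[OF y] by (simp add: numeral_3_eq_3 numeral_2_eq_2)
    have "btens s (Suc k + 3) xs = BL (Suc (Suc k)) a (cons1 (k + 3) ?y)"
      using BL_btens[of a "Suc (Suc k)" one ys] ys by (simp add: cons1_btens mul_one_right numeral_3_eq_3)
    moreover have "bd (Suc (Suc k)) (cons1 (k + 3) ?y) = ?y - cons1 (k + 2) (bd (Suc k) ?y)"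
      using bd_cons1[OF y'] by (simp add: numeral_3_eq_3)
    moreover have "bd (Suc k) (?y - cons1 (k + 2) (bd (Suc k) ?y)) = 0"
      using bd_cons1[OF z] Suc.IH[OF y] linear_on_zero[OF cons1_linear UNIV_I]
      by (simp add: lin_diff[OF bd_linear])
    moreover have "bd (Suc (Suc k)) (cons1 (k + 3) ?y) \<in> Bar s (Suc k)" using bd_closed[of _ "Suc (Suc k)"] e by simp
    ultimately show "bd (Suc k) (bd (Suc (Suc k)) (btens s (Suc k + 3) xs)) = 0"
      using ys e linear_on_zero[OF BL_linear UNIV_I] by (simp add: bd_left)
  qed
qed

subsection \<open>Projectivity\<close>

abbreviation bar_hom where "bar_hom n m \<equiv> bimodule_hom_on B (Bar s n) (BL n) (BR n) (KG s m) (GL m) (GR m)"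

text \<open>\<open>Bar s n\<close> is the free bimodule on the n-th tensor power of
  \<open>B\<close>; this is the bimodule map that restricts to a multilinear \<open>F\<close> on the
  inner factors.\<close>

definition hext where
  "hext m F = lext (\<lambda>xs. GL m (hd xs) (GR m (F (butlast (tl xs))) (last xs)))"

lemma hext_linear: "lin A (hext m F)" unfolding hext_def by (rule linear_on_lext)

lemma hext_btens:
  assumes F: "\<And>us vs. set us \<subseteq> B \<Longrightarrow> set vs \<subseteq> B \<Longrightarrow> length us + length vs + 1 = n \<Longrightarrow>
      lin B (\<lambda>x. F (us @ [x] @ vs))"
    and cl: "\<And>bs. set bs \<subseteq> B \<Longrightarrow> length bs = n \<Longrightarrow> F bs \<in> KG s m"
  shows "hext m F (btens s (n + 2) (a # bs @ [c])) = GL m a (GR m (F bs) c)"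
proof -
  let ?G = "\<lambda>xs. GL m (hd xs) (GR m (F (butlast (tl xs))) (last xs))"
  have "hext m F (btens s (n + 2) (a # bs @ [c])) = ?G (a # bs @ [c])"
    unfolding hext_def
  proof (rule lext_tpow_fun)
    fix us vs assume a: "set us \<subseteq> B" "set vs \<subseteq> B" "length us + length vs + 1 = n + 2"
    consider vs' c where "us = []" "vs = vs' @ [c]" | b us' where "us = b # us'" "vs = []"
      | b us' vs' c where "us = b # us'" "vs = vs' @ [c]"
      using a(3) by (cases us; cases vs rule: rev_cases) auto
    then show "lin B (\<lambda>x. ?G (us @ [x] @ vs))"
    proof cases
      case 1
      then have "GR m (F vs') c \<in> KG s m" using a by (intro GR_closed cl) auto
      then show ?thesis using 1 GL_linear_left by (simp add: butlast_append)
    next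
      case 2
      then have "F us' \<in> KG s m" using a by (intro cl) auto
      from lin_comp[OF GR_linear_right[OF this] GL_linear]
      show ?thesis using 2 by (simp add: butlast_append)
    next
      case 3
      then have "lin B (\<lambda>x. F (us' @ [x] @ vs'))" using a by (intro F) auto
      from lin_comp[OF lin_comp[OF this GR_linear] GL_linear]
      show ?thesis using 3 by (simp add: butlast_append)
    qed
  qed
  then show ?thesis by simp
qed

lemma hext_hom:
  assumes F: "\<And>us vs. set us \<subseteq> B \<Longrightarrow> set vs \<subseteq> B \<Longrightarrow> length us + length vs + 1 = n \<Longrightarrow>
      lin B (\<lambda>x. F (us @ [x] @ vs))"
    and cl: "\<And>bs. set bs \<subseteq> B \<Longrightarrow> length bs = n \<Longrightarrow> F bs \<in> KG s m"
  shows "bar_hom n m (hext m F)"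
proof -
  note h = hext_btens[OF F cl]
  have 1: "hext m F x \<in> KG s m" if "x \<in> Bar s n" for x
    by (rule Bar_intoI[OF hext_linear KG_subspace _ that]) (simp only: h GL_closed GR_closed cl)
  have 2: "hext m F (BL n b x) = GL m b (hext m F x)" if "b \<in> B" "x \<in> Bar s n" for b x
    by (rule Bar_eqI[OF lin_comp[OF BL_linear hext_linear] lin_comp[OF hext_linear GL_linear] _ that(2)])
      (simp only: h BL_gen that(1) GL_mul GR_closed cl)
  have 3: "hext m F (BR n x b) = GR m (hext m F x) b" if "b \<in> B" "x \<in> Bar s n" for b x
    by (rule Bar_eqI[OF lin_comp[OF BR_linear hext_linear] lin_comp[OF hext_linear GR_linear] _ that(2)])
      (simp only: h BR_gen that(1) GR_mul GL_GR GR_closed cl)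
  show ?thesis using 1 2 3 hext_linear by (auto simp: bimodule_hom_on_def)
qed

lemma bar_homD:
  assumes "bar_hom n m f"
  shows "lin (Bar s n) f" "x \<in> Bar s n \<Longrightarrow> f x \<in> KG s m"
    "b \<in> B \<Longrightarrow> x \<in> Bar s n \<Longrightarrow> f (BL n b x) = GL m b (f x)"
    "b \<in> B \<Longrightarrow> x \<in> Bar s n \<Longrightarrow> f (BR n x b) = GR m (f x) b"
  using assms by (auto simp: bimodule_hom_on_def)

lemma bar_homI:
  assumes "lin (Bar s n) f" "\<And>x. x \<in> Bar s n \<Longrightarrow> f x \<in> KG s m"
    "\<And>b x. b \<in> B \<Longrightarrow> x \<in> Bar s n \<Longrightarrow> f (BL n b x) = GL m b (f x)"
    "\<And>b x. b \<in> B \<Longrightarrow> x \<in> Bar s n \<Longrightarrow> f (BR n x b) = GR m (f x) b"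
  shows "bar_hom n m f"
  using assms by (auto simp: bimodule_hom_on_def)

lemma bar_hom_zero: "bar_hom n m f \<Longrightarrow> f 0 = 0"
  using linear_on_zero[OF bar_homD(1) fn.subspace_0[OF Tpow_subspace]] .

text \<open>Lifting through the Koszul differential is first done linearly, by a section on its
  image, and only for the generators 1 \<otimes> bs \<otimes> 1. Since the section and
  \<open>g\<close> are linear the result is multilinear in \<open>bs\<close>, so it extends to a
  bimodule map.\<close>

lemma bar_lift:
  assumes g: "bar_hom n m g" and ex: "\<And>x. x \<in> Bar s n \<Longrightarrow> \<exists>y\<in>KG s (Suc m). KG_d s (Suc m) y = g x"
  shows "\<exists>h. bar_hom n (Suc m) h \<and> (\<forall>x\<in>Bar s n. KG_d s (Suc m) (h x) = g x)"
proof -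
  \<comment> \<open>The spaces \<open>KG s p\<close> for all \<open>p\<close> lie in one function
    type, so the differential is a linear map from that type to itself.\<close>
  interpret pr: vector_space_pair
    "scl :: 'k \<Rightarrow> ('g \<times> ((('v list \<Rightarrow> 'k) \<Rightarrow> 'k) \<times> (('v list \<Rightarrow> 'k) \<Rightarrow> 'k) \<times> (('v list \<Rightarrow> 'k) \<Rightarrow> 'k) \<Rightarrow> 'k) \<Rightarrow> 'k) \<Rightarrow> _"
    "scl :: 'k \<Rightarrow> ('g \<times> ((('v list \<Rightarrow> 'k) \<Rightarrow> 'k) \<times> (('v list \<Rightarrow> 'k) \<Rightarrow> 'k) \<times> (('v list \<Rightarrow> 'k) \<Rightarrow> 'k) \<Rightarrow> 'k) \<Rightarrow> 'k) \<Rightarrow> _"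
    by unfold_locales
  have "Vector_Spaces.linear scl scl (KG_d s (Suc m) :: ('g \<times> _ \<Rightarrow> 'k) \<Rightarrow> _)"
    using KG_d_linear[of UNIV "Suc m"] by (simp add: Vector_Spaces.linear_iff linear_on_def fn.vector_space_axioms)
  from pr.linear_exists_right_inverse_on[OF this KG_subspace[of "Suc m"]] obtain t :: "('g \<times> _ \<Rightarrow> 'k) \<Rightarrow> 'g \<times> _ \<Rightarrow> 'k" where
    t0: "range t \<subseteq> KG s (Suc m) \<and> Vector_Spaces.linear scl scl t \<and>
      (\<forall>v\<in>KG_d s (Suc m) ` KG s (Suc m). KG_d s (Suc m) (t v) = v)" ..
  note t = conjunct1[OF t0] conjunct1[OF conjunct2[OF t0]] bspec[OF conjunct2[OF conjunct2[OF t0]]]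
  have tlin: "lin UNIV t"
    unfolding linear_on_def using pr.linear_add[OF t(2)] pr.linear_scale[OF t(2)] by metis
  define F where "F bs = t (g (btens s (n + 2) (one # bs @ [one])))" for bs
  have F1: "lin B (\<lambda>x. F (us @ [x] @ vs))"
    if "set us \<subseteq> B" "set vs \<subseteq> B" "length us + length vs + 1 = n" for us vs
  proof -
    have "lin B (\<lambda>x. btens s (n + 2) (one # (us @ [x] @ vs) @ [one]))"
      using tpow_slot[of "one # us" B "vs @ [one]" "n + 2" scl] that one_SG by simp
    moreover have "(\<lambda>x. btens s (n + 2) (one # (us @ [x] @ vs) @ [one])) ` B \<subseteq> Bar s n"
      using that one_SG by (intro image_subsetI gen_closed) auto
    ultimately show ?thesis unfolding F_def
      by (rule lin_comp[OF linear_on_comp[OF _ _ bar_homD(1)[OF g]] tlin])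
  qed
  have F2: "F bs \<in> KG s (Suc m)" for bs unfolding F_def by (rule subsetD[OF t(1) rangeI])
  have F3: "KG_d s (Suc m) (F bs) = g (btens s (n + 2) (one # bs @ [one]))" if hb: "set bs \<subseteq> B" "length bs = n" for bs
  proof -
    obtain y where "y \<in> KG s (Suc m)" "g (btens s (n + 2) (one # bs @ [one])) = KG_d s (Suc m) y"
      using ex[OF gen_closed[OF one_SG one_SG hb]] by metis
    then show ?thesis unfolding F_def by (intro t(3) image_eqI)
  qed
  have "KG_d s (Suc m) (hext (Suc m) F x) = g x" if "x \<in> Bar s n" for x
  proof (rule Bar_eqI[OF lin_comp[OF hext_linear KG_d_linear] bar_homD(1)[OF g] _ that])
    fix a bs c assume a: "a \<in> B" "c \<in> B" "set bs \<subseteq> B" "length bs = n"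
    let ?z = "btens s (n + 2) (one # bs @ [one])"
    have z: "?z \<in> Bar s n" by (rule gen_closed[OF one_SG one_SG a(3,4)])
    have hb: "hext (Suc m) F (btens s (n + 2) (a # bs @ [c])) = GL (Suc m) a (GR (Suc m) (F bs) c)"
      by (rule hext_btens[where F = F]) (use F1 F2 in blast)+
    have "KG_d s (Suc m) (hext (Suc m) F (btens s (n + 2) (a # bs @ [c]))) = GL m a (GR m (g ?z) c)"
      unfolding hb KG_d_left[OF GR_closed[OF a(2) F2] a(1)] KG_d_right[OF F2 a(2)] F3[OF a(3,4)] ..
    also have "\<dots> = g (btens s (n + 2) (a # bs @ [c]))"
      unfolding gen_mults[OF a(1,2)] using a z
      by (simp only: bar_homD(3)[OF g] bar_homD(4)[OF g] BL_closed bar_homD(2)[OF g] GL_GR)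
    finally show "KG_d s (Suc m) (hext (Suc m) F (btens s (n + 2) (a # bs @ [c]))) = g (btens s (n + 2) (a # bs @ [c]))" .
  qed
  then show ?thesis using hext_hom[OF F1 F2] by blast
qed

lemma bar_hom_bd:
  assumes f: "bar_hom n m f"
  shows "bar_hom (Suc n) m (\<lambda>x. f (bd (Suc n) x))"
proof (rule bar_homI)
  have cl: "bd (Suc n) x \<in> Bar s n" if "x \<in> Bar s (Suc n)" for x using bd_closed[OF that] by simp
  show "lin (Bar s (Suc n)) (\<lambda>x. f (bd (Suc n) x))"
    by (rule linear_on_comp[OF bd_linear _ bar_homD(1)[OF f]]) (use cl in blast)
  show "f (bd (Suc n) x) \<in> KG s m" if "x \<in> Bar s (Suc n)" for x by (rule bar_homD(2)[OF f cl[OF that]])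
  show "f (bd (Suc n) (BL (Suc n) b x)) = GL m b (f (bd (Suc n) x))" if "b \<in> B" "x \<in> Bar s (Suc n)" for b x
    unfolding bd_left[OF that] by (rule bar_homD(3)[OF f that(1) cl[OF that(2)]])
  show "f (bd (Suc n) (BR (Suc n) x b)) = GR m (f (bd (Suc n) x)) b" if "b \<in> B" "x \<in> Bar s (Suc n)" for b x
    unfolding bd_right[OF that] by (rule bar_homD(4)[OF f that(1) cl[OF that(2)]])
qed

lemma bar_hom_diff:
  assumes f: "bar_hom n m f" and g: "bar_hom n m g"
  shows "bar_hom n m (\<lambda>x. f x - g x)"
proof (rule bar_homI)
  show "lin (Bar s n) (\<lambda>x. f x - g x)"
    by (rule linear_on_minus[OF bar_homD(1)[OF f] bar_homD(1)[OF g]])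
  show "f x - g x \<in> KG s m" if "x \<in> Bar s n" for x
    using that by (intro KG_diff bar_homD(2)[OF f] bar_homD(2)[OF g])
  show "f (BL n b x) - g (BL n b x) = GL m b (f x - g x)" if "b \<in> B" "x \<in> Bar s n" for b x
    unfolding GL_diff bar_homD(3)[OF f that] bar_homD(3)[OF g that] ..
  show "f (BR n x b) - g (BR n x b) = GR m (f x - g x) b" if "b \<in> B" "x \<in> Bar s n" for b x
    unfolding GR_diff bar_homD(4)[OF f that] bar_homD(4)[OF g that] ..
qed

end

section \<open>Comparison maps and null-homotopies, built degree by degree\<close>

context fin_smash
begin

lemma comparison_exists: "\<exists>\<theta>. comparison s \<rho> \<theta>"
proof -
  \<comment> \<open>In degree 0 a bimodule map is determined by the image of 1 \<otimes> 1, and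
    compatibility with the augmentations asks for an element of augmentation 1.\<close>
  define e :: "'g \<times> _ \<Rightarrow> 'k" where "e = rtimes (ktri s 0 (sone s) (wedge s 0 []) (sone s)) 0"
  have e: "e \<in> KG s 0" unfolding e_def by (intro rtimes_KG tri_SMS sword_Salg wedge_Ext) simp
  define t0 where "t0 = hext 0 (\<lambda>_. e)"
  have t0: "bar_hom 0 0 t0" unfolding t0_def by (rule hext_hom) (simp_all add: e)
  have t0_gen: "t0 (btens s (0 + 2) (a # [] @ [c])) = GL 0 a (GR 0 e c)" for a c
    unfolding t0_def by (rule hext_btens) (simp_all add: e)
  have aug: "KG_aug s (t0 x) = bar_aug s \<rho> x" if "x \<in> Bar s 0" for x
  proof (rule Bar_eqI[OF lin_comp[OF bar_homD(1)[OF t0] KG_aug_linear] bar_aug_linear _ that])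
    fix a c and bs :: "('g \<times> ('v list \<Rightarrow> 'k) \<Rightarrow> 'k) list" assume a: "a \<in> B" "c \<in> B" "length bs = 0"
    have "KG_aug s e = one" unfolding e_def by (simp add: KG_aug_rtimes kos_aug_ktri sword_Salg smul_sword)
    then show "KG_aug s (t0 (btens s (0 + 2) (a # bs @ [c]))) = bar_aug s \<rho> (btens s (0 + 2) (a # bs @ [c]))"
      using a t0_gen[of a c] bar_aug_pair[of a c, unfolded numeral_2_eq_2] by (simp add: KG_aug_left KG_aug_right GR_closed e mul_one_left)
  qed
  \<comment> \<open>The second clause is the premise of \<open>bar_lift\<close> for the next degree.
    The last one remembers the initial map, so that the compatibility with the augmentation is not
    lost in the choice.\<close>
  let ?P = "\<lambda>n f. bar_hom n n f \<and> (\<forall>x\<in>Bar s (Suc n). \<exists>y\<in>KG s (Suc n). KG_d s (Suc n) y = f (bd (Suc n) x)) \<and> (n = 0 \<longrightarrow> f = t0)"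
  let ?Q = "\<lambda>n f f'. \<forall>x\<in>Bar s (Suc n). KG_d s (Suc n) (f' x) = f (bd (Suc n) x)"
  have "\<exists>\<theta>. \<forall>n. ?P n (\<theta> n) \<and> ?Q n (\<theta> n) (\<theta> (Suc n))"
  proof (rule dependent_nat_choice[where P = ?P and Q = ?Q])
    have "\<exists>y\<in>KG s 1. KG_d s 1 y = t0 (bd (Suc 0) x)" if "x \<in> Bar s (Suc 0)" for x
    proof (rule KG_exact_0)
      have b: "bd 1 x \<in> Bar s 0" using bd_closed[OF that] by simp
      show "t0 (bd (Suc 0) x) \<in> KG s 0" using bar_homD(2)[OF t0 b] by simp
      show "KG_aug s (t0 (bd (Suc 0) x)) = 0" using aug[OF b] bar_aug_bd[of x] that by simp
    qed
    then show "\<exists>f. ?P 0 f" using t0 by auto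
  next
    fix f n assume P: "?P n f"
    then have f: "bar_hom n n f" by blast
    from P bar_lift[OF bar_hom_bd[OF f]] obtain f' where
      f': "bar_hom (Suc n) (Suc n) f'" "\<And>x. x \<in> Bar s (Suc n) \<Longrightarrow> KG_d s (Suc n) (f' x) = f (bd (Suc n) x)" by blast
    have "\<exists>y\<in>KG s (Suc (Suc n)). KG_d s (Suc (Suc n)) y = f' (bd (Suc (Suc n)) x)" if x: "x \<in> Bar s (Suc (Suc n))" for x
    proof (rule KG_exact)
      have b: "bd (Suc (Suc n)) x \<in> Bar s (Suc n)" using bd_closed[OF x] by simp
      show "f' (bd (Suc (Suc n)) x) \<in> KG s (Suc n)" by (rule bar_homD(2)[OF f'(1) b])
      have "bd (Suc n) (bd (Suc (Suc n)) x) = 0" using bd_bd[of x "Suc n"] x by (simp add: numeral_3_eq_3)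
      then show "KG_d s (Suc n) (f' (bd (Suc (Suc n)) x)) = 0" by (simp add: f'(2)[OF b] bar_hom_zero[OF f])
    qed
    then show "\<exists>f'. ?P (Suc n) f' \<and> ?Q n f f'" using f' by blast
  qed
  then obtain \<theta> where "\<And>n. ?P n (\<theta> n)" "\<And>n. ?Q n (\<theta> n) (\<theta> (Suc n))" by blast
  moreover from this(1)[of 0] have "\<theta> 0 = t0" by blast
  ultimately have "comparison s \<rho> \<theta>" unfolding comparison_def using aug by auto
  then show ?thesis by blast
qed

lemma bar_null_homotopy:
  assumes h: "\<And>n. bar_hom n n (h n)" and ch: "\<And>n x. x \<in> Bar s (Suc n) \<Longrightarrow> KG_d s (Suc n) (h (Suc n) x) = h n (bd (Suc n) x)"
    and aug: "\<And>x. x \<in> Bar s 0 \<Longrightarrow> KG_aug s (h 0 x) = 0"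
  shows "\<exists>H. (\<forall>n. bar_hom n (Suc n) (H n)) \<and> (\<forall>x\<in>Bar s 0. KG_d s 1 (H 0 x) = h 0 x) \<and>
    (\<forall>n. \<forall>x\<in>Bar s (Suc n). KG_d s (Suc (Suc n)) (H (Suc n) x) = h (Suc n) x - H n (bd (Suc n) x))"
proof -
  have b: "bd (Suc n) x \<in> Bar s n" if "x \<in> Bar s (Suc n)" for n x using bd_closed[OF that] by simp
  \<comment> \<open>As \<open>h\<close> is a chain map, the second clause says that
    \<open>h (Suc n)\<close> minus the current map after \<open>bd (Suc n)\<close> takes values in
    cycles, hence in boundaries. It passes to the next degree because the bar differential squares
    to zero.\<close>
  let ?P = "\<lambda>n f. bar_hom n (Suc n) f \<and>
    (\<forall>x\<in>Bar s (Suc n). KG_d s (Suc n) (f (bd (Suc n) x)) = h n (bd (Suc n) x)) \<and>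
    (n = 0 \<longrightarrow> (\<forall>x\<in>Bar s 0. KG_d s 1 (f x) = h 0 x))"
  let ?Q = "\<lambda>n f f'. \<forall>x\<in>Bar s (Suc n). KG_d s (Suc (Suc n)) (f' x) = h (Suc n) x - f (bd (Suc n) x)"
  have "\<exists>H. \<forall>n. ?P n (H n) \<and> ?Q n (H n) (H (Suc n))"
  proof (rule dependent_nat_choice[where P = ?P and Q = ?Q])
    have ex: "\<exists>y\<in>KG s (Suc 0). KG_d s (Suc 0) y = h 0 x" if "x \<in> Bar s 0" for x
      using KG_exact_0[OF bar_homD(2)[OF h[of 0] that] aug[OF that]] by simp
    have "\<exists>f. bar_hom 0 (Suc 0) f \<and> (\<forall>x\<in>Bar s 0. KG_d s (Suc 0) (f x) = h 0 x)"
      by (rule bar_lift[OF h[of 0]]) (rule ex)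
    then obtain f where f: "bar_hom 0 (Suc 0) f" "\<forall>x\<in>Bar s 0. KG_d s (Suc 0) (f x) = h 0 x" by (elim exE conjE)
    have fb: "\<forall>x\<in>Bar s (Suc 0). KG_d s (Suc 0) (f (bd (Suc 0) x)) = h 0 (bd (Suc 0) x)"
      by (intro ballI bspec[OF f(2)] b)
    have "?P 0 f" unfolding One_nat_def by (intro conjI impI f fb)
    then show "\<exists>f. ?P 0 f" by (rule exI[of _ f])
  next
    fix f n assume P: "?P n f"
    then have f: "bar_hom n (Suc n) f" by blast
    have g: "bar_hom (Suc n) (Suc n) (\<lambda>x. h (Suc n) x - f (bd (Suc n) x))"
      by (rule bar_hom_diff[OF h[of "Suc n"] bar_hom_bd[OF f]])
    have ex: "\<exists>y\<in>KG s (Suc (Suc n)). KG_d s (Suc (Suc n)) y = h (Suc n) x - f (bd (Suc n) x)" if x: "x \<in> Bar s (Suc n)" for x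
    proof (rule KG_exact)
      show "h (Suc n) x - f (bd (Suc n) x) \<in> KG s (Suc n)" by (rule bar_homD(2)[OF g x])
      show "KG_d s (Suc n) (h (Suc n) x - f (bd (Suc n) x)) = 0"
        using P x by (simp add: lin_diff[OF KG_d_linear] ch)
    qed
    have "\<exists>f'. bar_hom (Suc n) (Suc (Suc n)) f' \<and>
      (\<forall>x\<in>Bar s (Suc n). KG_d s (Suc (Suc n)) (f' x) = h (Suc n) x - f (bd (Suc n) x))"
      by (rule bar_lift[OF g]) (rule ex)
    then obtain f' where f'0: "bar_hom (Suc n) (Suc (Suc n)) f' \<and>
      (\<forall>x\<in>Bar s (Suc n). KG_d s (Suc (Suc n)) (f' x) = h (Suc n) x - f (bd (Suc n) x))" ..
    note f' = conjunct1[OF f'0] bspec[OF conjunct2[OF f'0]]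
    have fb: "KG_d s (Suc (Suc n)) (f' (bd (Suc (Suc n)) x)) = h (Suc n) (bd (Suc (Suc n)) x)" if x: "x \<in> Bar s (Suc (Suc n))" for x
    proof -
      have "bd (Suc n) (bd (Suc (Suc n)) x) = 0" using bd_bd[of x "Suc n"] x by (simp add: numeral_3_eq_3)
      then show ?thesis using f'(2)[OF b[OF x]] by (simp add: bar_hom_zero[OF f])
    qed
    have "?P (Suc n) f' \<and> ?Q n f f'"
      by (intro conjI impI ballI f' fb) (assumption | simp)+
    then show "\<exists>f'. ?P (Suc n) f' \<and> ?Q n f f'" by (rule exI[of _ f'])
  qed
  then obtain H where H: "\<forall>n. ?P n (H n) \<and> ?Q n (H n) (H (Suc n))" ..
  show ?thesis
  proof (intro exI conjI allI)
    show "bar_hom n (Suc n) (H n)" for n using H by blast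
    show "\<forall>x\<in>Bar s 0. KG_d s 1 (H 0 x) = h 0 x" using H by blast
    show "\<forall>x\<in>Bar s (Suc n). KG_d s (Suc (Suc n)) (H (Suc n) x) = h (Suc n) x - H n (bd (Suc n) x)" for n
      using H by blast
  qed
qed

end


lemma linear_on_add: "linear_on s A t f \<Longrightarrow> x \<in> A \<Longrightarrow> y \<in> A \<Longrightarrow> f (x + y) = f x + f y"
  by (simp add: linear_on_def)

context smash
begin

section \<open>Cochains as bimodule maps\<close>

abbreviation sg_hom where "sg_hom p \<equiv> bimodule_hom_on B (KG s p) (GL p) (GR p) B mul mul"

lemma sg_homD:
  assumes "sg_hom p \<Psi>"
  shows "lin (KG s p) \<Psi>" "x \<in> KG s p \<Longrightarrow> \<Psi> x \<in> B"
    "b \<in> B \<Longrightarrow> x \<in> KG s p \<Longrightarrow> \<Psi> (GL p b x) = mul b (\<Psi> x)"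
    "b \<in> B \<Longrightarrow> x \<in> KG s p \<Longrightarrow> \<Psi> (GR p x b) = mul (\<Psi> x) b"
  using assms by (auto simp: bimodule_hom_on_def)

lemma kos_ext_linear: "lin A (kos_ext s \<rho> \<phi>)"
  unfolding kos_ext_def
  by (simp add: linear_on_def component_add component_scl lext_add lext_scl sum.distrib fn.scale_sum_right)

lemma KG_tri_eqI:
  assumes f: "lin (KG s p) f" and f': "lin (KG s p) f'"
    and eq: "\<And>a w c g. a \<in> Salg s \<Longrightarrow> w \<in> Ext s p \<Longrightarrow> c \<in> Salg s \<Longrightarrow>
      f (rtimes (ktri s p a w c) (g :: 'g)) = f' (rtimes (ktri s p a w c) g)"
    and x: "x \<in> KG s p"
  shows "f x = f' x"
proof (rule KG_eqI[OF f f' _ x])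
  fix m and g :: 'g assume m: "m \<in> Kos s p"
  have "(\<lambda>m. rtimes m g) ` Kos s p \<subseteq> KG s p" by (intro image_subsetI rtimes_KG)
  then show "f (rtimes m g) = f' (rtimes m g)"
    by (intro SMS_eqI[where f = "\<lambda>m. f (rtimes m g)" and g = "\<lambda>m. f' (rtimes m g)", OF _ _ _ m]
        linear_on_comp[OF rtimes_linear _ f] linear_on_comp[OF rtimes_linear _ f'] eq)
qed

abbreviation kone where "kone p w \<equiv> rtimes (ktri s p (sone s) w (sone s)) (0 :: 'g)"

lemma kone_closed: "w \<in> Ext s p \<Longrightarrow> kone p w \<in> KG s p" by (intro rtimes_KG tri_SMS sword_Salg)

text \<open>The group element can be carried by the right coefficient, so K \<rtimes> G is generated
  as a bimodule by the elements \<open>kone p w\<close>.\<close>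

lemma rtimes_tri_mults:
  assumes "a \<in> Salg s" "w \<in> Ext s p" "c \<in> Salg s"
  shows "rtimes (ktri s p a w c) g = GR p (GL p (rtimes a 0) (kone p w)) (rtimes c g)"
proof -
  have "ktri s p (sone s) w (sone s) \<in> Kos s p" using assms by (intro tri_SMS sword_Salg)
  then show ?thesis using assms
    by (simp add: GL_rtimes GR_rtimes kact_id SMS_left_closed act_id tri_as_mults[OF assms] SMS_left_right)
qed

lemma sg_hom_tri:
  assumes \<Psi>: "sg_hom p \<Psi>" and "a \<in> Salg s" "w \<in> Ext s p" "c \<in> Salg s"
  shows "\<Psi> (rtimes (ktri s p a w c) g) = mul (mul (rtimes a 0) (\<Psi> (kone p w))) (rtimes c g)"
  using assms by (simp add: rtimes_tri_mults sg_homD[OF \<Psi>] GL_closed kone_closed rtimes_SG)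

lemma kos_cochainD:
  assumes "kos_cochain s \<rho> p \<phi>"
  shows "lin (Ext s p) \<phi>" "w \<in> Ext s p \<Longrightarrow> \<phi> w \<in> B"
    "w \<in> Ext s p \<Longrightarrow> mul (mul (rtimes (sone s) g) (\<phi> (Eact s \<rho> p (- g) w))) (rtimes (sone s) (- g)) = \<phi> w"
  using assms by (auto simp: kos_cochain_def)

lemma kos_ext_tri:
  assumes "kos_cochain s \<rho> p \<phi>"
  shows "kos_ext s \<rho> \<phi> (rtimes (ktri s p a w c) g) = mul (mul (rtimes a 0) (\<phi> w)) (rtimes c g)"
  by (rule kos_ext_rtimes[of s \<rho>, OF rho_linear]) (use kos_cochainD[OF assms] in auto)

text \<open>Invariance of \<phi> enters in left linearity: multiplying by a group element h replaces
  w by hw, and \<phi>(hw) is the conjugate of \<phi>(w) by h. The first h joins the coefficient on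
  the left, and the inverse of h cancels against h(c) \<rtimes> hg, leaving c \<rtimes> g.\<close>

lemma kos_ext_hom:
  assumes \<phi>: "kos_cochain s \<rho> p \<phi>"
  shows "sg_hom p (kos_ext s \<rho> \<phi>)"
proof -
  let ?\<Phi> = "kos_ext s \<rho> \<phi>"
  note c\<phi> = kos_cochainD(2)[OF \<phi>]
  have closed: "?\<Phi> x \<in> B" if x: "x \<in> KG s p" for x
  proof -
    have "?\<Phi> (rtimes m g) \<in> B" if m: "m \<in> Kos s p" for m and g :: 'g
      by (rule SMS_intoI[where f = "\<lambda>m. ?\<Phi> (rtimes m g)", OF lin_comp[OF rtimes_linear kos_ext_linear] SG_subspace _ m])
        (simp add: kos_ext_tri[OF \<phi>] mul_closed rtimes_SG c\<phi>)
    then show ?thesis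
      by (subst Rtimes_expand) (simp add: lin_sum[OF kos_ext_linear] SG_sum KG_component[OF x])
  qed
  have left: "?\<Phi> (GL p b x) = mul b (?\<Phi> x)" if b: "b \<in> B" and x: "x \<in> KG s p" for b x
  proof (rule SG_eqI[of "\<lambda>b. ?\<Phi> (GL p b x)" "\<lambda>b. mul b (?\<Phi> x)", OF _ _ _ b])
    show "lin B (\<lambda>b. ?\<Phi> (GL p b x))"
      by (rule lin_comp[OF GL_linear_left[OF x] kos_ext_linear])
    fix f and h :: 'g assume f: "f \<in> Salg s"
    show "?\<Phi> (GL p (rtimes f h) x) = mul (rtimes f h) (?\<Phi> x)"
    proof (rule KG_tri_eqI[OF lin_comp[OF GL_linear kos_ext_linear]
          linear_on_comp[OF kos_ext_linear _ mul_linear_right] _ x])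
      fix a w c and g :: 'g assume a: "a \<in> Salg s" "w \<in> Ext s p" "c \<in> Salg s"
      have "\<phi> (Eact s \<rho> p h w) = mul (mul (rtimes (sone s) h) (\<phi> w)) (rtimes (sone s) (- h))"
        using kos_cochainD(3)[OF \<phi> Eact_in[OF a(2)], of h h] Eact_plus[OF a(2), of "- h" h] Eact_id[OF a(2)] by simp
      then have "?\<Phi> (GL p (rtimes f h) (rtimes (ktri s p a w c) g)) =
          mul (mul (rtimes (smul s f (act h a)) 0) (mul (mul (rtimes (sone s) h) (\<phi> w)) (rtimes (sone s) (- h)))) (rtimes (act h c) (h + g))"
        using a f by (simp add: GL_rtimes tri_SMS kact_tri SMS_left_tri kos_ext_tri[OF \<phi>])
      also have "\<dots> = mul (mul (rtimes (smul s f (act h a)) 0) (rtimes (sone s) h)) (mul (\<phi> w) (mul (rtimes (sone s) (- h)) (rtimes (act h c) (h + g))))"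
        using a f by (simp add: mul_assoc SG_mems c\<phi>)
      also have "mul (rtimes (smul s f (act h a)) 0) (rtimes (sone s) h) = mul (rtimes f h) (rtimes a 0)"
        using a f by (simp add: mul_rtimes SG_mems act_one smul_one_right)
      also have "mul (rtimes (sone s) (- h)) (rtimes (act h c) (h + g)) = rtimes c g"
        using a act_plus[of c "- h" h] by (simp add: mul_rtimes SG_mems smul_one_left act_id add.assoc[symmetric])
      also have "mul (mul (rtimes f h) (rtimes a 0)) (mul (\<phi> w) (rtimes c g)) =
          mul (rtimes f h) (?\<Phi> (rtimes (ktri s p a w c) g))"
        using a f by (simp add: kos_ext_tri[OF \<phi>] mul_assoc SG_mems c\<phi>)
      finally show "?\<Phi> (GL p (rtimes f h) (rtimes (ktri s p a w c) g)) = mul (rtimes f h) (?\<Phi> (rtimes (ktri s p a w c) g))" .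
    qed (use closed f in \<open>auto intro: rtimes_SG\<close>)
  qed (rule mul_linear_left)
  have right: "?\<Phi> (GR p x b) = mul (?\<Phi> x) b" if b: "b \<in> B" and x: "x \<in> KG s p" for b x
  proof (rule SG_eqI[of "\<lambda>b. ?\<Phi> (GR p x b)" "mul (?\<Phi> x)", OF _ _ _ b])
    show "lin B (\<lambda>b. ?\<Phi> (GR p x b))"
      by (rule lin_comp[OF GR_linear_right[OF x] kos_ext_linear])
    fix f and h :: 'g assume f: "f \<in> Salg s"
    show "?\<Phi> (GR p x (rtimes f h)) = mul (?\<Phi> x) (rtimes f h)"
      by (rule KG_tri_eqI[OF lin_comp[OF GR_linear kos_ext_linear]
          lin_comp[OF kos_ext_linear mul_linear_left] _ x])
        (use f in \<open>simp add: GR_rtimes tri_SMS SMS_right_tri act_closed kos_ext_tri[OF \<phi>] mul_assoc SG_mems c\<phi> mul_rtimes\<close>)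
  qed (rule mul_linear_right[OF closed[OF x]])
  show ?thesis using closed left right kos_ext_linear by (auto simp: bimodule_hom_on_def)
qed

text \<open>In K \<rtimes> G the generator for w is the conjugate by g of the generator for the
  image of w under the inverse of g; a bimodule map turns this into invariance. With
  \<open>kos_ext_hom\<close> this is the identification of invariant cochains with bimodule
  maps.\<close>

lemma sg_hom_restrict:
  assumes \<Psi>: "sg_hom p \<Psi>"
  shows "kos_cochain s \<rho> p (\<lambda>w. \<Psi> (kone p w))" "x \<in> KG s p \<Longrightarrow> kos_ext s \<rho> (\<lambda>w. \<Psi> (kone p w)) x = \<Psi> x"
proof -
  show c: "kos_cochain s \<rho> p (\<lambda>w. \<Psi> (kone p w))"
    unfolding kos_cochain_def
  proof (intro conjI allI ballI image_subsetI)
    have "lin (Ext s p) (kone p)"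
      by (rule lin_comp[OF tri_lin2[OF sword_Salg sword_Salg] rtimes_linear])
    then show "lin (Ext s p) (\<lambda>w. \<Psi> (kone p w))"
      by (rule linear_on_comp[OF _ _ sg_homD(1)[OF \<Psi>]]) (use kone_closed in blast)
    show "\<Psi> (kone p w) \<in> B" if "w \<in> Ext s p" for w by (rule sg_homD(2)[OF \<Psi> kone_closed[OF that]])
    fix g w assume w: "w \<in> Ext s p"
    have e: "Eact s \<rho> p g (Eact s \<rho> p (- g) w) = w"
      using Eact_plus[OF w, of g "- g"] Eact_id[OF w] by simp
    have "kone p w = GR p (GL p (rtimes (sone s) g) (kone p (Eact s \<rho> p (- g) w))) (rtimes (sone s) (- g))"
      using w by (simp add: GL_rtimes GR_rtimes sword_Salg tri_SMS Eact_in kact_tri act_one SMS_left_tri SMS_right_tri e smul_sword)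
    then show "mul (mul (rtimes (sone s) g) (\<Psi> (kone p (Eact s \<rho> p (- g) w)))) (rtimes (sone s) (- g)) = \<Psi> (kone p w)"
      using w by (simp add: sg_homD[OF \<Psi>] GL_closed kone_closed Eact_in rtimes_SG sword_Salg)
  qed
  show "kos_ext s \<rho> (\<lambda>w. \<Psi> (kone p w)) x = \<Psi> x" if "x \<in> KG s p"
    by (rule KG_tri_eqI[OF kos_ext_linear sg_homD(1)[OF \<Psi>] _ that])
      (simp add: kos_ext_tri[OF c] sg_hom_tri[OF \<Psi>])
qed

text \<open>The cocycle condition is stated on the elements \<open>kone (Suc p) w\<close>. They
  generate, and the extension of \<phi> composed with the differential is a bimodule map.\<close>

lemma kos_cocycle_kills:
  assumes \<phi>: "kos_cocycle s \<rho> p \<phi>" and x: "x \<in> KG s (Suc p)"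
  shows "kos_ext s \<rho> \<phi> (KG_d s (Suc p) x) = 0"
proof -
  have h: "sg_hom p (kos_ext s \<rho> \<phi>)" using \<phi> by (intro kos_ext_hom) (simp add: kos_cocycle_def)
  have z: "kos_ext s \<rho> \<phi> (KG_d s (Suc p) (kone (Suc p) w)) = 0" if "w \<in> Ext s (Suc p)" for w
    using \<phi> that by (simp add: kos_cocycle_def)
  have mz: "mul (mul b 0) b' = 0" if "b \<in> B" for b b'
    using linear_on_zero[OF mul_linear_right[OF that] fn.subspace_0[OF SG_subspace]] linear_on_zero[OF mul_linear_left UNIV_I] by simp
  show ?thesis
  proof (rule KG_tri_eqI[OF lin_comp[OF KG_d_linear kos_ext_linear] linear_on_const_zero _ x])
    fix a w c and g :: 'g assume a: "a \<in> Salg s" "w \<in> Ext s (Suc p)" "c \<in> Salg s"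
    show "kos_ext s \<rho> \<phi> (KG_d s (Suc p) (rtimes (ktri s (Suc p) a w c) g)) = 0"
      unfolding rtimes_tri_mults[OF a]
      using a by (simp add: KG_d_left KG_d_right GL_closed GR_closed kone_closed KG_d_closed rtimes_SG sg_homD[OF h] z mz)
  qed
qed

section \<open>From bimodule maps on the bar resolution to Hochschild cochains\<close>

definition pad where "pad p = lext (\<lambda>bs. btens s (p + 2) (one # bs @ [one]))"

lemma pad_linear: "lin A (pad p)" unfolding pad_def by (rule linear_on_lext)

lemma pad_btens: "pad p (btens s p bs) = btens s (p + 2) (one # bs @ [one])"
  unfolding pad_def
proof (rule lext_tpow_fun)
  fix us vs assume "set us \<subseteq> B" "set vs \<subseteq> B" "length us + length vs + 1 = p"
  then show "lin B (\<lambda>x. btens s (p + 2) (one # (us @ [x] @ vs) @ [one]))"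
    using tpow_slot[of "one # us" B "vs @ [one]" "p + 2" scl] one_SG by simp
qed

lemma pad_closed: "x \<in> Btens s p \<Longrightarrow> pad p x \<in> Bar s p"
  by (rule Tpow_intoI[where f = "pad p", OF pad_linear Tpow_subspace])
    (simp_all only: pad_btens gen_closed one_SG)

text \<open>The inner faces of the bar differential on 1 \<otimes> bs \<otimes> 1 keep the outer
  units. The first and the last face merge an outer entry of \<open>bs\<close> into a unit, and
  bimodule linearity turns them into the outer multiplications of the Hochschild
  differential.\<close>

lemma hoch_d_hom:
  assumes lin: "lin (Bar s m) E"
    and left: "\<And>b x. b \<in> B \<Longrightarrow> x \<in> Bar s m \<Longrightarrow> E (BL m b x) = mul b (E x)"
    and right: "\<And>b x. b \<in> B \<Longrightarrow> x \<in> Bar s m \<Longrightarrow> E (BR m x b) = mul (E x) b"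
    and bs: "set bs \<subseteq> B" "length bs = Suc m"
  shows "E (bd (Suc m) (pad (Suc m) (btens s (Suc m) bs))) = hoch_d s \<rho> m (\<lambda>w. E (pad m w)) bs"
proof -
  obtain a ys where ys: "bs = a # ys" "a \<in> B" "set ys \<subseteq> B" "length ys = m" using bs by (cases bs) auto
  obtain zs b where zs: "bs = zs @ [b]" "b \<in> B" "set zs \<subseteq> B" "length zs = m" using bs by (cases bs rule: rev_cases) auto
  let ?w = "one # bs @ [one]"
  let ?t = "\<lambda>i. btens s (m + 2) (merge_at mul i ?w)"
  have t0: "?t 0 = BL m a (btens s (m + 2) (one # ys @ [one]))"
    using ys by (simp add: merge_at_0 mul_one_left mul_one_right BL_btens[of a m, simplified])
  have ti: "?t (Suc i) = btens s (m + 2) (one # merge_at mul i bs @ [one])" if "i < m" for i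
    using merge_at_append[of i bs mul "[one]"] that bs by (simp add: merge_at_Suc)
  have tm: "?t (Suc m) = BR m (btens s (m + 2) (one # zs @ [one])) b"
    using BR_gen[OF zs(2), of m one zs one] merge_at_last[of mul "one # zs" b one] zs
    by (simp add: mul_one_left mul_one_right)
  have cl: "?t i \<in> Bar s m" if "i < Suc (Suc m)" for i
  proof (rule tpow_Tpow)
    show "set (merge_at mul i ?w) \<subseteq> B" by (rule set_merge_at) (use that bs one_SG in \<open>auto intro: mul_closed\<close>)
    show "length (merge_at mul i ?w) = m + 2" using that bs by (simp add: length_merge_at)
  qed
  have gm: "btens s (m + 2) (one # ys @ [one]) \<in> Bar s m" "btens s (m + 2) (one # zs @ [one]) \<in> Bar s m"
    using ys zs one_SG by (auto intro!: gen_closed simp del: add_2_eq_Suc')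
  have "bd (Suc m) (pad (Suc m) (btens s (Suc m) bs)) = (\<Sum>i<Suc (Suc m). scl ((-1) ^ i) (?t i))"
    using bd_btens[of "Suc m" ?w] by (simp add: pad_btens del: sum.lessThan_Suc)
  then have "E (bd (Suc m) (pad (Suc m) (btens s (Suc m) bs))) = (\<Sum>i<Suc (Suc m). scl ((-1) ^ i) (E (?t i)))"
    using linear_on_image_sum[OF lin Tpow_subspace, of "{..<Suc (Suc m)}" "\<lambda>i. scl ((-1) ^ i) (?t i)"]
      fn.subspace_scale[OF Tpow_subspace cl] lin cl
    by (simp add: linear_on_def del: sum.lessThan_Suc)
  also have "\<dots> = E (?t 0) + (\<Sum>i<m. scl ((-1) ^ (i + 1)) (E (?t (Suc i)))) + scl ((-1) ^ (m + 1)) (E (?t (Suc m)))"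
    unfolding sum.lessThan_Suc[of _ "Suc m"] sum.lessThan_Suc_shift[of _ m] by simp
  also have "(\<Sum>i<m. scl ((-1) ^ (i + 1)) (E (?t (Suc i)))) = (\<Sum>i<m. scl ((-1) ^ (i + 1)) (E (pad m (btens s m (merge_at mul i bs)))))"
    by (intro sum.cong refl) (simp only: ti pad_btens lessThan_iff)
  also have "E (?t 0) = mul (hd bs) (E (pad m (btens s m (tl bs))))"
    unfolding t0 using left[OF ys(2) gm(1)] by (simp add: pad_btens ys(1))
  also have "E (?t (Suc m)) = mul (E (pad m (btens s m (butlast bs)))) (last bs)"
    unfolding tm using right[OF zs(2) gm(2)] by (simp add: pad_btens zs(1))
  finally show ?thesis by (simp add: hoch_d_def)
qed

end

context delta_data
begin

section \<open>The lifting on the bar resolution\<close>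

text \<open>The index counts tensor factors: the lifting on \<open>Bar s q\<close> is
  \<open>dB (q + 2)\<close>, and \<open>dB p\<close> is the action of \<delta> on the arguments of a
  p-cochain that occurs in the bracket.\<close>

definition dB where "dB m = lext (\<lambda>bs. \<Sum>j<m. btens s m (bs[j := \<delta> (bs ! j)]))"

lemma dB_linear: "lin A (dB m)" unfolding dB_def by (rule linear_on_lext)

lemma dB_btens: "dB m (btens s m bs) = (\<Sum>j<m. btens s m (bs[j := \<delta> (bs ! j)]))"
proof -
  let ?S = "\<Sum>j<m. btens s m (bs[j := \<delta> (bs ! j)])"
  \<comment> \<open>\<open>gerst_bracket_btens\<close> computes \<open>c (dB m _)\<close> for an arbitrary function \<open>c\<close>; this one detects \<open>?S\<close>.\<close>
  define c :: "((('g \<times> ('v list \<Rightarrow> 'k) \<Rightarrow> 'k) list \<Rightarrow> 'k) \<Rightarrow> 'k) \<Rightarrow> 'g \<times> ('v list \<Rightarrow> 'k) \<Rightarrow> 'k"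
    where "c z = (if z = ?S then 0 else (\<lambda>_. 1))" for z
  have "\<delta> (c (btens s m bs)) - c (dB m (btens s m bs)) = \<delta> (c (btens s m bs)) - c ?S"
    using gerst_bracket_btens[of s \<delta> m c bs] delta_linear delta_closed by (simp add: gerst_bracket_def dB_def image_subset_iff)
  then have "c (dB m (btens s m bs)) = c ?S" by simp
  then show ?thesis by (auto simp: c_def fun_eq_iff zero_fun_apply split: if_splits)
qed

lemma dB_Cons: "dB (Suc m) (btens s (Suc m) (x # xs)) =
    btens s (Suc m) (\<delta> x # xs) + (\<Sum>j<m. btens s (Suc m) (x # xs[j := \<delta> (xs ! j)]))"
  unfolding dB_btens sum.lessThan_Suc_shift by simp

lemma dB_snoc: "length xs = m \<Longrightarrow> dB (Suc m) (btens s (Suc m) (xs @ [x])) =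
    (\<Sum>j<m. btens s (Suc m) (xs[j := \<delta> (xs ! j)] @ [x])) + btens s (Suc m) (xs @ [\<delta> x])"
  unfolding dB_btens sum.lessThan_Suc
  by (intro arg_cong2[of _ _ _ _ "(+)"] sum.cong refl) (auto simp: nth_append list_update_append)

lemma update_closed: "set bs \<subseteq> B \<Longrightarrow> j < length bs \<Longrightarrow> set (bs[j := \<delta> (bs ! j)]) \<subseteq> B"
  using set_update_subset_insert[of bs j "\<delta> (bs ! j)"] delta_closed[of "bs ! j"] by (auto simp: subset_iff)

lemma dB_closed: "x \<in> Btens s m \<Longrightarrow> dB m x \<in> Btens s m"
  by (rule Tpow_intoI[where f = "dB m", OF dB_linear Tpow_subspace])
    (auto simp: dB_btens intro!: fn.subspace_sum[OF Tpow_subspace] tpow_Tpow dest: update_closed)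

lemma BL_add: "BL q b (x + y) = BL q b x + BL q b y" and BL_sum: "BL q b (\<Sum>i\<in>I. f i) = (\<Sum>i\<in>I. BL q b (f i))"
  using BL_linear[of UNIV q b] lin_sum[OF BL_linear] by (auto simp: linear_on_def)
lemma BR_add: "BR q (x + y) b = BR q x b + BR q y b" and BR_sum: "BR q (\<Sum>i\<in>I. f i) b = (\<Sum>i\<in>I. BR q (f i) b)"
  using BR_linear[of UNIV q b] lin_sum[OF BR_linear, where x = f and I = I] by (auto simp: linear_on_def)

lemma dB_left:
  assumes b: "b \<in> B" and x: "x \<in> Bar s q"
  shows "dB (q + 2) (BL q b x) = BL q (\<delta> b) x + BL q b (dB (q + 2) x)"
proof (rule Tpow_eqI[OF lin_comp[OF BL_linear dB_linear]
      linear_on_plus[OF BL_linear lin_comp[OF dB_linear BL_linear]] _ x])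
  fix xs assume xs: "set xs \<subseteq> B" "length xs = q + 2"
  then obtain a ys where ys: "xs = a # ys" "a \<in> B" "set ys \<subseteq> B" "length ys = Suc q" by (cases xs) auto
  have lin: "lin B (\<lambda>x. btens s (Suc (Suc q)) (x # ys))"
    using tpow_slot[of "[]" B ys "Suc (Suc q)" scl] ys by simp
  have "btens s (Suc (Suc q)) (\<delta> (mul b a) # ys) = btens s (Suc (Suc q)) (mul (\<delta> b) a # ys) + btens s (Suc (Suc q)) (mul b (\<delta> a) # ys)"
    unfolding delta_mul[OF b ys(2)] by (rule linear_on_add[OF lin]) (use b ys in \<open>auto intro: mul_closed delta_closed\<close>)
  then show "dB (q + 2) (BL q b (btens s (q + 2) xs)) = BL q (\<delta> b) (btens s (q + 2) xs) + BL q b (dB (q + 2) (btens s (q + 2) xs))"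
    unfolding ys(1) BL_btens[OF b] BL_btens[OF delta_closed[OF b]]
    using dB_Cons[of "Suc q" "mul b a" ys] dB_Cons[of "Suc q" a ys] BL_btens[OF b, of q]
    by (simp add: BL_add BL_sum del: sum.lessThan_Suc)
qed

lemma dB_right:
  assumes b: "b \<in> B" and x: "x \<in> Bar s q"
  shows "dB (q + 2) (BR q x b) = BR q (dB (q + 2) x) b + BR q x (\<delta> b)"
proof (rule Tpow_eqI[where f = "\<lambda>x. dB (q + 2) (BR q x b)", OF lin_comp[OF BR_linear dB_linear]
      linear_on_plus[OF lin_comp[OF dB_linear BR_linear] BR_linear] _ x])
  fix xs assume xs: "set xs \<subseteq> B" "length xs = q + 2"
  then obtain a ys where ys: "xs = ys @ [a]" "a \<in> B" "set ys \<subseteq> B" "length ys = Suc q" by (cases xs rule: rev_cases) auto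
  have lin: "lin B (\<lambda>x. btens s (Suc (Suc q)) (ys @ [x]))"
    using tpow_slot[of ys B "[]" "Suc (Suc q)" scl] ys by simp
  have "btens s (Suc (Suc q)) (ys @ [\<delta> (mul a b)]) = btens s (Suc (Suc q)) (ys @ [mul (\<delta> a) b]) + btens s (Suc (Suc q)) (ys @ [mul a (\<delta> b)])"
    unfolding delta_mul[OF ys(2) b] by (rule linear_on_add[OF lin]) (use b ys in \<open>auto intro: mul_closed delta_closed\<close>)
  then show "dB (q + 2) (BR q (btens s (q + 2) xs) b) = BR q (dB (q + 2) (btens s (q + 2) xs)) b + BR q (btens s (q + 2) xs) (\<delta> b)"
    unfolding ys(1) BR_btens[OF b] BR_btens[OF delta_closed[OF b]]
    using dB_snoc[OF ys(4), of "mul a b"] dB_snoc[OF ys(4), of a] BR_btens[OF b, of q]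
    by (simp add: BR_add BR_sum add.assoc del: sum.lessThan_Suc)
qed

text \<open>A derivation kills 1, so the added unit contributes nothing. The same reason applies to
  both units in \<open>dB_pad\<close>.\<close>

lemma dB_cons1: "x \<in> Btens s m \<Longrightarrow> dB (Suc m) (cons1 m x) = cons1 m (dB m x)"
proof (rule Tpow_eqI[OF lin_comp[OF cons1_linear dB_linear] lin_comp[OF dB_linear cons1_linear]])
  fix xs assume xs: "set xs \<subseteq> B" "length xs = m"
  have "lin B (\<lambda>x. btens s (Suc m) (x # xs))" using tpow_slot[of "[]" B xs "Suc m" scl] xs by simp
  then have "btens s (Suc m) (0 # xs) = 0" by (rule linear_on_zero[OF _ fn.subspace_0[OF SG_subspace]])
  then show "dB (Suc m) (cons1 m (btens s m xs)) = cons1 m (dB m (btens s m xs))"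
    unfolding cons1_btens dB_Cons delta_one by (simp add: dB_btens lin_sum[OF cons1_linear] cons1_btens)
qed

lemma dB_pad: "x \<in> Btens s p \<Longrightarrow> dB (p + 2) (pad p x) = pad p (dB p x)"
proof (rule Tpow_eqI[OF lin_comp[OF pad_linear dB_linear] lin_comp[OF dB_linear pad_linear]])
  fix xs assume xs: "set xs \<subseteq> B" "length xs = p"
  have "lin B (\<lambda>x. btens s (Suc (Suc p)) (x # xs @ [one]))" using tpow_slot[of "[]" B "xs @ [one]" "Suc (Suc p)" scl] xs one_SG by simp
  then have 1: "btens s (Suc (Suc p)) (0 # xs @ [one]) = 0" by (rule linear_on_zero[OF _ fn.subspace_0[OF SG_subspace]])
  have "lin B (\<lambda>x. btens s (Suc (Suc p)) (one # xs @ [x]))" using tpow_slot[of "one # xs" B "[]" "Suc (Suc p)" scl] xs one_SG by simp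
  then have 2: "btens s (Suc (Suc p)) (one # xs @ [0]) = 0" by (rule linear_on_zero[OF _ fn.subspace_0[OF SG_subspace]])
  have "dB (Suc (Suc p)) (btens s (Suc (Suc p)) (one # xs @ [one])) =
      (\<Sum>j<p. btens s (Suc (Suc p)) (one # xs[j := \<delta> (xs ! j)] @ [one]))"
    unfolding dB_Cons delta_one 1 sum.lessThan_Suc using xs
    by (simp add: delta_one 2 nth_append list_update_append)
  then show "dB (p + 2) (pad p (btens s p xs)) = pad p (dB p (btens s p xs))"
    by (simp add: pad_btens dB_btens lin_sum[OF pad_linear])
qed

text \<open>The same induction as for \<open>bd_bd\<close>: the left Leibniz rule reduces to tensors
  1 \<otimes> y, where \<open>bd_cons1\<close> and \<open>dB_cons1\<close> lead back to y. The
  induction starts with the Leibniz rule of \<delta> itself, as \<open>bd 0\<close> is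
  multiplication.\<close>

lemma bd_dB: "x \<in> Btens s (q + 2) \<Longrightarrow> bd q (dB (q + 2) x) = dB (q + 1) (bd q x)"
proof (induction q arbitrary: x)
  case 0
  show ?case
  proof (rule Tpow_eqI[OF lin_comp[OF dB_linear bd_linear] lin_comp[OF bd_linear dB_linear] _ 0])
    fix xs assume xs: "set xs \<subseteq> B" "length xs = 0 + 2"
    then obtain a b where ab: "xs = [a, b]" "a \<in> B" "b \<in> B" using length_eq_2[of xs] by auto
    have "btens s (Suc 0) [mul (\<delta> a) b + mul a (\<delta> b)] = btens s (Suc 0) [mul (\<delta> a) b] + btens s (Suc 0) [mul a (\<delta> b)]"
      by (rule linear_on_add[OF tpow_slot[of "[]" B "[]" "Suc 0" scl, simplified]]) (use ab in \<open>auto intro: mul_closed delta_closed\<close>)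
    moreover have "bd 0 (x + y) = bd 0 x + bd 0 y" for x y using bd_linear[of UNIV 0] by (simp add: linear_on_def)
    ultimately show "bd 0 (dB (0 + 2) (btens s (0 + 2) xs)) = dB (0 + 1) (bd 0 (btens s (0 + 2) xs))"
      using ab by (simp add: dB_btens bd_pair delta_mul)
  qed
next
  case (Suc k)
  show ?case
  proof (rule Tpow_eqI[OF lin_comp[OF dB_linear bd_linear] lin_comp[OF bd_linear dB_linear] _ Suc.prems])
    fix xs assume xs: "set xs \<subseteq> B" "length xs = Suc k + 2"
    then obtain a ys where ys: "xs = a # ys" "a \<in> B" "set ys \<subseteq> B" "length ys = k + 2" by (cases xs) auto
    let ?y = "btens s (k + 2) ys"
    let ?e = "cons1 (k + 2) ?y"
    have y: "?y \<in> Btens s (k + 2)" using ys by (intro tpow_Tpow) auto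
    have e: "?e \<in> Bar s (Suc k)" using cons1_closed[OF y] by simp
    have be: "bd (Suc k) ?e \<in> Bar s k" using bd_closed[of ?e "Suc k"] e by simp
    have de: "dB (Suc k + 2) ?e \<in> Bar s (Suc k)" by (rule dB_closed[OF e])
    have x: "btens s (Suc k + 2) xs = BL (Suc k) a ?e"
      using BL_btens[of a "Suc k" one ys] ys by (simp add: cons1_btens mul_one_right)
    have by': "bd k ?y \<in> Btens s (k + 1)" by (rule bd_closed[OF y])
    have "bd (Suc k) (dB (Suc k + 2) ?e) = dB (k + 2) ?y - cons1 (k + 1) (dB (k + 1) (bd k ?y))"
      using dB_cons1[OF y] bd_cons1[OF dB_closed[OF y]] Suc.IH[OF y] by simp
    also have "\<dots> = dB (k + 2) (bd (Suc k) ?e)"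
      using dB_cons1[OF by'] unfolding bd_cons1[OF y] by (simp add: lin_diff[OF dB_linear])
    finally have c: "bd (Suc k) (dB (Suc k + 2) ?e) = dB (k + 2) (bd (Suc k) ?e)" .
    have bda: "bd (Suc k) (x + y) = bd (Suc k) x + bd (Suc k) y" for x y using bd_linear[of UNIV "Suc k"] by (simp add: linear_on_def)
    have "bd (Suc k) (dB (Suc k + 2) (btens s (Suc k + 2) xs)) = BL k (\<delta> a) (bd (Suc k) ?e) + BL k a (bd (Suc k) (dB (Suc k + 2) ?e))"
      unfolding x dB_left[OF ys(2) e] bda bd_left[OF delta_closed[OF ys(2)] e] bd_left[OF ys(2) de] ..
    also have "\<dots> = dB (k + 2) (bd (Suc k) (btens s (Suc k + 2) xs))"
      unfolding c x bd_left[OF ys(2) e] dB_left[OF ys(2) be] ..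
    finally show "bd (Suc k) (dB (Suc k + 2) (btens s (Suc k + 2) xs)) = dB (Suc k + 1) (bd (Suc k) (btens s (Suc k + 2) xs))"
      by simp
  qed
qed

lemma bar_aug_dB: "x \<in> Bar s 0 \<Longrightarrow> bar_aug s \<rho> (dB 2 x) = \<delta> (bar_aug s \<rho> x)"
proof -
  assume x: "x \<in> Bar s 0"
  have cl: "bar_aug s \<rho> ` Bar s 0 \<subseteq> B"
  proof
    fix z assume "z \<in> bar_aug s \<rho> ` Bar s 0"
    then obtain y where y: "y \<in> Btens s 2" "z = bar_aug s \<rho> y" by (auto simp: numeral_2_eq_2)
    show "z \<in> B" unfolding y(2)
      by (rule Tpow_intoI[where f = "bar_aug s \<rho>", OF bar_aug_linear SG_subspace _ y(1)])
        (auto dest!: length_eq_2 simp: bar_aug_pair mul_closed)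
  qed
  show ?thesis
  proof (rule Tpow_eqI[OF lin_comp[OF dB_linear bar_aug_linear] linear_on_comp[OF bar_aug_linear cl delta_linear] _ x])
    fix xs assume xs: "set xs \<subseteq> B" "length xs = 0 + 2"
    then obtain a b where ab: "xs = [a, b]" "a \<in> B" "b \<in> B" using length_eq_2[of xs] by auto
    have "bar_aug s \<rho> (x + y) = bar_aug s \<rho> x + bar_aug s \<rho> y" for x y using bar_aug_linear[of UNIV] by (simp add: linear_on_def)
    then show "bar_aug s \<rho> (dB 2 (btens s (0 + 2) xs)) = \<delta> (bar_aug s \<rho> (btens s (0 + 2) xs))"
      using ab by (simp add: dB_btens numeral_2_eq_2 bar_aug_pair[unfolded numeral_2_eq_2] delta_mul)
  qed
qed

end


section \<open>The bracket\<close>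

locale fin_delta_data = fin_smash s \<rho> basis + delta_data s \<rho> r rbar \<delta> \<sigma> D n v1 v3 v2
  for s :: "'k::field \<Rightarrow> 'v::ab_group_add \<Rightarrow> 'v" and \<rho> :: "'g::{finite,group_add} \<Rightarrow> 'v \<Rightarrow> 'v" and basis
    and r rbar \<delta> \<sigma> D n v1 v3 v2
begin

lemma kos_ext_diff: "kos_ext s \<rho> \<phi> (x - y) = kos_ext s \<rho> \<phi> x - kos_ext s \<rho> \<phi> y"
  by (rule lin_diff[OF kos_ext_linear])
lemma kos_ext_add: "kos_ext s \<rho> \<phi> (x + y) = kos_ext s \<rho> \<phi> x + kos_ext s \<rho> \<phi> y"
  using kos_ext_linear[of UNIV \<phi>] by (simp add: linear_on_def)

text \<open>The commutator of \<delta> and its lifting with the bimodule map extending \<phi>. Its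
  restriction to the generators \<open>kone p w\<close> is the cocycle of the theorem.\<close>

definition bracket where "bracket p \<phi> x = \<delta> (kos_ext s \<rho> \<phi> x) - kos_ext s \<rho> \<phi> (dG p x)"

text \<open>Both summands are twisted by \<delta> in the same way: the terms containing \<delta>(b)
  occur in each of them and cancel in the difference.\<close>

lemma bracket_hom:
  assumes \<phi>: "kos_cochain s \<rho> p \<phi>"
  shows "sg_hom p (bracket p \<phi>)"
proof -
  note h = sg_homD[OF kos_ext_hom[OF \<phi>]]
  have lin: "lin (KG s p) (bracket p \<phi>)"
    unfolding bracket_def
    by (rule linear_on_minus[OF linear_on_comp[OF kos_ext_linear _ delta_linear] lin_comp[OF dG_linear kos_ext_linear]])
      (use h(2) in blast)
  have cl: "bracket p \<phi> x \<in> B" if "x \<in> KG s p" for x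
    unfolding bracket_def using that by (intro SG_diff delta_closed h(2) dG_closed)
  have 1: "bracket p \<phi> (GL p b x) = mul b (bracket p \<phi> x)" if "b \<in> B" "x \<in> KG s p" for b x
    unfolding bracket_def using that
    by (simp add: h dG_left kos_ext_add GL_closed dG_closed delta_closed delta_mul mul_diff_right)
  have 2: "bracket p \<phi> (GR p x b) = mul (bracket p \<phi> x) b" if "b \<in> B" "x \<in> KG s p" for b x
    unfolding bracket_def using that
    by (simp add: h dG_right kos_ext_add GR_closed dG_closed delta_closed delta_mul mul_diff_left)
  show ?thesis using lin cl 1 2 by (auto simp: bimodule_hom_on_def)
qed

text \<open>The lifting commutes with the differential, so in both summands the bimodule map
  extending \<phi> is applied to a boundary.\<close>

lemma bracket_cocycle:
  assumes \<phi>: "kos_cocycle s \<rho> p \<phi>"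
  shows "kos_cocycle s \<rho> p (\<lambda>w. bracket p \<phi> (kone p w))"
  unfolding kos_cocycle_def
proof (intro conjI ballI)
  have h: "sg_hom p (bracket p \<phi>)" using \<phi> by (intro bracket_hom) (simp add: kos_cocycle_def)
  show "kos_cochain s \<rho> p (\<lambda>w. bracket p \<phi> (kone p w))" by (rule sg_hom_restrict(1)[OF h])
  fix w assume "w \<in> Ext s (Suc p)"
  then have k: "kone (Suc p) w \<in> KG s (Suc p)" by (rule kone_closed)
  have z: "\<delta> 0 = 0" by (rule linear_on_zero[OF delta_linear fn.subspace_0[OF SG_subspace]])
  show "kos_ext s \<rho> (\<lambda>w. bracket p \<phi> (kone p w)) (KG_d s (Suc p) (kone (Suc p) w)) = 0"
    unfolding sg_hom_restrict(2)[OF h KG_d_closed[OF k]]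
    by (simp add: bracket_def kos_cocycle_kills[OF \<phi>] k z flip: KG_d_dG) (simp add: kos_cocycle_kills[OF \<phi>] dG_closed k)
qed

lemma bracket_wedge:
  assumes \<phi>: "kos_cochain s \<rho> p \<phi>" and vs: "length vs = p"
  shows "bracket p \<phi> (kone p (wedge s p vs)) = \<delta> (\<phi> (wedge s p vs)) -
    (\<Sum>i<p. \<Sum>j<n (vs ! i).
      mul (mul (rtimes (v1 (vs ! i) j) 0) (\<phi> (wedge s p (vs[i := v2 (vs ! i) j])))) (rtimes (v3 (vs ! i) j) 0))"
proof -
  have "kos_ext s \<rho> \<phi> (kone p (wedge s p vs)) = \<phi> (wedge s p vs)"
    using kos_cochainD(2)[OF \<phi> wedge_Ext[OF vs]] by (simp add: kos_ext_tri[OF \<phi>] mul_one_left mul_one_right)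
  then show ?thesis
    by (simp add: bracket_def dG_gen[OF vs] lin_sum[OF kos_ext_linear] kos_ext_tri[OF \<phi>])
qed

lemma bracket_cohomologous:
  assumes \<phi>: "kos_cocycle s \<rho> p \<phi>" and \<theta>: "comparison s \<rho> \<theta>"
  shows "hoch_cohomologous s \<rho> p (gerst_bracket s p \<delta> (to_hoch s \<rho> \<theta> p \<phi>))
    (to_hoch s \<rho> \<theta> p (\<lambda>w. bracket p \<phi> (kone p w)))"
proof -
  have \<phi>c: "kos_cochain s \<rho> p \<phi>" using \<phi> by (simp add: kos_cocycle_def)
  let ?\<Phi> = "kos_ext s \<rho> \<phi>"
  have t: "bar_hom m m (\<theta> m)" for m using \<theta> unfolding comparison_def by blast
  have td: "KG_d s (Suc m) (\<theta> (Suc m) x) = \<theta> m (bd (Suc m) x)" if "x \<in> Bar s (Suc m)" for m x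
    using \<theta> that unfolding comparison_def by blast
  have ta: "KG_aug s (\<theta> 0 x) = bar_aug s \<rho> x" if "x \<in> Bar s 0" for x
    using \<theta> that unfolding comparison_def by blast
  have b: "bd (Suc m) x \<in> Bar s m" if "x \<in> Bar s (Suc m)" for m x using bd_closed[OF that] by simp
  define h where "h m x = dG m (\<theta> m x) - \<theta> m (dB (m + 2) x)" for m x
  have hh: "bar_hom m m (h m)" for m
  proof (rule bar_homI)
    note t' = bar_homD[OF t[of m]]
    have add: "\<theta> m (x + y) = \<theta> m x + \<theta> m y" if "x \<in> Bar s m" "y \<in> Bar s m" for x y
      by (rule linear_on_add[OF t'(1) that])
    show "lin (Bar s m) (h m)"
      unfolding h_def
      by (rule linear_on_minus[OF lin_comp[OF t'(1) dG_linear] linear_on_comp[OF dB_linear _ t'(1)]])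
        (use dB_closed in blast)
    show "h m x \<in> KG s m" if "x \<in> Bar s m" for x
      unfolding h_def by (intro KG_diff dG_closed t'(2) dB_closed that)
    show "h m (BL m b x) = GL m b (h m x)" if "b \<in> B" "x \<in> Bar s m" for b x
      unfolding h_def dB_left[OF that] t'(3)[OF that] dG_left[OF t'(2)[OF that(2)] that(1)]
        add[OF BL_closed[OF delta_closed[OF that(1)] that(2)] BL_closed[OF that(1) dB_closed[OF that(2)]]]
        t'(3)[OF delta_closed[OF that(1)] that(2)] t'(3)[OF that(1) dB_closed[OF that(2)]] GL_diff by (simp only: add_diff_cancel_left)
    show "h m (BR m x b) = GR m (h m x) b" if "b \<in> B" "x \<in> Bar s m" for b x
      unfolding h_def dB_right[OF that] t'(4)[OF that] dG_right[OF t'(2)[OF that(2)] that(1)]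
        add[OF BR_closed[OF that(1) dB_closed[OF that(2)]] BR_closed[OF delta_closed[OF that(1)] that(2)]]
        t'(4)[OF delta_closed[OF that(1)] that(2)] t'(4)[OF that(1) dB_closed[OF that(2)]] GR_diff by (simp only: add_diff_cancel_right)
  qed
  have hd: "KG_d s (Suc m) (h (Suc m) x) = h m (bd (Suc m) x)" if x: "x \<in> Bar s (Suc m)" for m x
  proof -
    have "KG_d s (Suc m) (h (Suc m) x) = KG_d s (Suc m) (dG (Suc m) (\<theta> (Suc m) x)) - KG_d s (Suc m) (\<theta> (Suc m) (dB (Suc m + 2) x))"
      unfolding h_def by (rule lin_diff[OF KG_d_linear])
    also have "\<dots> = dG m (\<theta> m (bd (Suc m) x)) - \<theta> m (bd (Suc m) (dB (Suc m + 2) x))"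
      unfolding KG_d_dG[OF bar_homD(2)[OF t x]] td[OF x] td[OF dB_closed[OF x]] ..
    also have "\<dots> = h m (bd (Suc m) x)" unfolding bd_dB[OF x] h_def by simp
    finally show ?thesis .
  qed
  have ha: "KG_aug s (h 0 x) = 0" if x: "x \<in> Bar s 0" for x
  proof -
    have "KG_aug s (h 0 x) = KG_aug s (dG 0 (\<theta> 0 x)) - KG_aug s (\<theta> 0 (dB (0 + 2) x))"
      unfolding h_def by (rule lin_diff[OF KG_aug_linear])
    also have "\<dots> = 0"
      unfolding KG_aug_dG[OF bar_homD(2)[OF t x]] ta[OF x] ta[OF dB_closed[OF x]] using bar_aug_dB[OF x] by (simp add: numeral_2_eq_2)
    finally show ?thesis .
  qed
  obtain H where H: "\<And>m. bar_hom m (Suc m) (H m)" "\<And>x. x \<in> Bar s 0 \<Longrightarrow> KG_d s 1 (H 0 x) = h 0 x"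
    "\<And>m x. x \<in> Bar s (Suc m) \<Longrightarrow> KG_d s (Suc (Suc m)) (H (Suc m) x) = h (Suc m) x - H m (bd (Suc m) x)"
    using bar_null_homotopy[of h, OF hh hd ha] by blast
  \<comment> \<open>The term with \<delta> outermost occurs in both cochains and cancels;
    \<open>dB_pad\<close> then moves \<delta> past the outer units.\<close>
  have key: "gerst_bracket s p \<delta> (to_hoch s \<rho> \<theta> p \<phi>) w - to_hoch s \<rho> \<theta> p (\<lambda>w. bracket p \<phi> (kone p w)) w = ?\<Phi> (h p (pad p w))"
    if w: "w \<in> Btens s p" for w
  proof -
    have z: "pad p w \<in> Bar s p" by (rule pad_closed[OF w])
    have "gerst_bracket s p \<delta> (to_hoch s \<rho> \<theta> p \<phi>) w = \<delta> (?\<Phi> (\<theta> p (pad p w))) - ?\<Phi> (\<theta> p (pad p (dB p w)))"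
      by (simp add: gerst_bracket_def to_hoch_def pad_def dB_def)
    moreover have "to_hoch s \<rho> \<theta> p (\<lambda>w. bracket p \<phi> (kone p w)) w = bracket p \<phi> (\<theta> p (pad p w))"
      unfolding to_hoch_def pad_def[symmetric] by (rule sg_hom_restrict(2)[OF bracket_hom[OF \<phi>c] bar_homD(2)[OF t z]])
    ultimately show ?thesis
      unfolding bracket_def h_def kos_ext_diff dB_pad[OF w] by simp
  qed
  show ?thesis
  proof (cases p)
    case 0
    \<comment> \<open>There are no coboundaries in degree 0, so equality is required. It holds
      because \<open>h 0\<close> takes values in boundaries, which a cocycle kills.\<close>
    have "gerst_bracket s p \<delta> (to_hoch s \<rho> \<theta> p \<phi>) w = to_hoch s \<rho> \<theta> p (\<lambda>w. bracket p \<phi> (kone p w)) w" if w: "w \<in> Btens s 0" for w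
    proof -
      have z: "pad 0 w \<in> Bar s 0" by (rule pad_closed[OF w])
      have "?\<Phi> (h 0 (pad 0 w)) = 0"
        using kos_cocycle_kills[OF \<phi>] bar_homD(2)[OF H(1)[of 0] z] unfolding 0 H(2)[OF z, symmetric] by simp
      with key[unfolded 0, OF w] show ?thesis
        unfolding 0 by (simp only: eq_iff_diff_eq_0[symmetric] right_minus_eq)
    qed
    then show ?thesis by (simp add: hoch_cohomologous_def 0)
  next
    case (Suc m)
    \<comment> \<open>\<open>H m\<close> ends in degree \<open>Suc m\<close>, which is
      \<open>p\<close>, where \<open>?\<Phi>\<close> is a bimodule map.\<close>
    define E where "E x = ?\<Phi> (H m x)" for x
    note \<Phi> = sg_homD[OF kos_ext_hom[OF \<phi>c]]
    note Hm = bar_homD[OF H(1)[of m]]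
    have E1: "lin (Bar s m) E"
      unfolding E_def by (rule lin_comp[OF Hm(1) kos_ext_linear])
    have E2: "E (BL m b x) = mul b (E x)" "E (BR m x b) = mul (E x) b" if "b \<in> B" "x \<in> Bar s m" for b x
      unfolding E_def Hm(3)[OF that] Hm(4)[OF that]
      using \<Phi>(3,4)[OF that(1), of "H m x"] Hm(2)[OF that(2)] unfolding Suc by auto
    have "hoch_cochain s m (\<lambda>w. E (pad m w))"
      unfolding hoch_cochain_def
    proof (intro conjI image_subsetI)
      show "lin (Btens s m) (\<lambda>w. E (pad m w))"
        by (rule linear_on_comp[OF pad_linear _ E1]) (use pad_closed in blast)
      show "E (pad m w) \<in> B" if "w \<in> Btens s m" for w
        unfolding E_def using \<Phi>(2) Hm(2)[OF pad_closed[OF that]] unfolding Suc by blast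
    qed
    moreover have "gerst_bracket s p \<delta> (to_hoch s \<rho> \<theta> p \<phi>) (btens s p bs) -
        to_hoch s \<rho> \<theta> p (\<lambda>w. bracket p \<phi> (kone p w)) (btens s p bs) = hoch_d s \<rho> m (\<lambda>w. E (pad m w)) bs"
      if bs: "set bs \<subseteq> B" "length bs = p" for bs
    proof -
      let ?z = "pad p (btens s p bs)"
      have w: "btens s p bs \<in> Btens s p" by (rule tpow_Tpow[OF bs])
      have z: "?z \<in> Bar s (Suc m)" using pad_closed[OF w] unfolding Suc .
      have "h (Suc m) ?z = KG_d s (Suc (Suc m)) (H (Suc m) ?z) + H m (bd (Suc m) ?z)" using H(3)[OF z] by simp
      \<comment> \<open>Of the two parts of the null-homotopy formula the boundary is killed by the
        cocycle, so only \<open>H m\<close> after the bar differential survives.\<close>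
      moreover have "?\<Phi> (KG_d s (Suc (Suc m)) (H (Suc m) ?z)) = 0"
        using kos_cocycle_kills[OF \<phi>] bar_homD(2)[OF H(1) z] unfolding Suc by blast
      ultimately have "?\<Phi> (h p ?z) = E (bd (Suc m) ?z)" unfolding E_def by (simp add: Suc kos_ext_add)
      also have "\<dots> = hoch_d s \<rho> m (\<lambda>w. E (pad m w)) bs"
        using hoch_d_hom[OF E1 E2 bs(1)] bs(2) unfolding Suc by blast
      finally show ?thesis unfolding key[OF w] .
    qed
    ultimately show ?thesis unfolding hoch_cohomologous_def Suc nat.case by blast
  qed
qed

end

text \<open>That a comparison exists is part of the conclusion because the claim about the bracket
  quantifies over all comparisons and would otherwise be open to being vacuous.\<close>

theorem mainTheorem5:
  fixes s :: "'k::field \<Rightarrow> 'v::ab_group_add \<Rightarrow> 'v" and basis :: "'v set"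
    and \<rho> :: "'g::{finite,group_add} \<Rightarrow> 'v \<Rightarrow> 'v"
    and r :: "'v \<Rightarrow> ('v list \<Rightarrow> 'k) \<Rightarrow> 'k"
    and rbar :: "(('v list \<Rightarrow> 'k) \<Rightarrow> 'k) \<Rightarrow> ('v list \<Rightarrow> 'k) \<Rightarrow> 'k"
    and \<delta> :: "('g \<times> ('v list \<Rightarrow> 'k) \<Rightarrow> 'k) \<Rightarrow> 'g \<times> ('v list \<Rightarrow> 'k) \<Rightarrow> 'k"
    and \<sigma> :: "(('v list \<Rightarrow> 'k) \<Rightarrow> 'k) \<Rightarrow> ('v list \<Rightarrow> 'k) \<Rightarrow> 'k"
    and D :: "(('v list \<Rightarrow> 'k) \<Rightarrow> 'k) \<Rightarrow>
      ((('v list \<Rightarrow> 'k) \<Rightarrow> 'k) \<times> 'v \<times> (('v list \<Rightarrow> 'k) \<Rightarrow> 'k) \<Rightarrow> 'k) \<Rightarrow> 'k"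
    and n :: "'v \<Rightarrow> nat"
    and v1 v3 :: "'v \<Rightarrow> nat \<Rightarrow> ('v list \<Rightarrow> 'k) \<Rightarrow> 'k"
    and v2 :: "'v \<Rightarrow> nat \<Rightarrow> 'v"
  assumes V: "finite_dimensional_vector_space s basis"
    and order: "of_nat (card (UNIV :: 'g set)) \<noteq> (0 :: 'k)"
    and split: "group_split_by TYPE('g) TYPE('k)"
    and rep: "group_rep_on s UNIV \<rho>"
    and r: "linear_on s UNIV scl r" "range r \<subseteq> Salg s" "\<And>g v. r (\<rho> g v) = Sact s \<rho> g (r v)"
    and rbar: "derivation_on (Salg s) (smul s) (Salg s) (smul s) (smul s) rbar"
      "\<And>v. rbar (svec s v) = r v"
    and delta: "derivation_on (SG s) (SG_mul s \<rho>) (SG s) (SG_mul s \<rho>) (SG_mul s \<rho>) \<delta>"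
      "\<And>f g. f \<in> Salg s \<Longrightarrow> \<delta> (rtimes f g) = rtimes (rbar f) g"
    and sigma: "lin (Salg s) \<sigma>" "\<sigma> ` Salg s \<subseteq> Talg s"
      "\<And>g f. f \<in> Salg s \<Longrightarrow> \<sigma> (Sact s \<rho> g f) = Tact s \<rho> g (\<sigma> f)"
      "\<And>f. f \<in> Salg s \<Longrightarrow> proj_TS s (\<sigma> f) = f"
    and D: "derivation_on (Talg s) (tmul s) (SMS s s UNIV)
        (\<lambda>t. SMS_left s s UNIV (proj_TS s t)) (\<lambda>x t. SMS_right s s UNIV x (proj_TS s t)) D"
      "\<And>v. D (tword s [v]) = tri s s UNIV (sone s) v (sone s)"
    and sweedler: "\<And>v. D (\<sigma> (r v)) = (\<Sum>j<n v. tri s s UNIV (v1 v j) (v2 v j) (v3 v j))"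
      "\<And>v j. j < n v \<Longrightarrow> v1 v j \<in> Salg s" "\<And>v j. j < n v \<Longrightarrow> v3 v j \<in> Salg s"
  shows "(\<exists>\<delta>s. delta_e_lifting (SG s) \<delta> (KG s) (KG_left s \<rho>) (KG_right s \<rho>) (KG_d s) (KG_aug s) \<delta>s \<and>
      (\<forall>p vs. length vs = p \<longrightarrow>
        \<delta>s p (rtimes (ktri s p (sone s) (wedge s p vs) (sone s)) 0) =
          (\<Sum>i<p. \<Sum>j<n (vs ! i).
            rtimes (ktri s p (v1 (vs ! i) j) (wedge s p (vs[i := v2 (vs ! i) j])) (v3 (vs ! i) j)) 0))) \<and>
    (\<exists>\<theta>. comparison s \<rho> \<theta>) \<and>
    (\<forall>p \<phi>. kos_cocycle s \<rho> p \<phi> \<longrightarrow>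
      (\<exists>\<psi>. kos_cocycle s \<rho> p \<psi> \<and>
        (\<forall>vs. length vs = p \<longrightarrow>
          \<psi> (wedge s p vs) = \<delta> (\<phi> (wedge s p vs)) -
            (\<Sum>i<p. \<Sum>j<n (vs ! i).
              SG_mul s \<rho> (SG_mul s \<rho> (rtimes (v1 (vs ! i) j) 0)
                (\<phi> (wedge s p (vs[i := v2 (vs ! i) j])))) (rtimes (v3 (vs ! i) j) 0))) \<and>
        (\<forall>\<theta>. comparison s \<rho> \<theta> \<longrightarrow>
          hoch_cohomologous s \<rho> p (gerst_bracket s p \<delta> (to_hoch s \<rho> \<theta> p \<phi>)) (to_hoch s \<rho> \<theta> p \<psi>))))"
proof -
  have 1: "smash s \<rho>" using rep by unfold_locales
  interpret fin_delta_data s \<rho> basis r rbar \<delta> \<sigma> D n v1 v3 v2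
    by (intro fin_delta_data.intro fin_smash.intro delta_data.intro delta_data_axioms.intro 1 V r rbar delta sigma D sweedler)
  show ?thesis
  proof (intro conjI allI impI, goal_cases)
    case 1
    show ?case using dG_lifting dG_gen by (intro exI[of _ dG]) simp
  next
    case 2
    show ?case by (rule comparison_exists)
  next
    case (3 p \<phi>)
    then show ?case
      using bracket_cocycle[OF 3] bracket_cohomologous[OF 3] bracket_wedge[of p \<phi>]
      by (intro exI[of _ "\<lambda>w. bracket p \<phi> (kone p w)"]) (simp add: kos_cocycle_def)
  qed
qed

end
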